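(* Let $a>0$ and let $q\in L^2(0,a)$ be real-valued and even ($q(x)=q(a-x)$). Consider the periodic Schrödinger operator $H=-\frac{d^2}{dx^2}+q$, with continuity–Kirchhoff (Neumann) vertex conditions, on the metric graph $G$ of each of the Archimedean tilings listed below, with the same potential $q$ on every edge. Write $S=S(a,\rho)$, $S'=S'(a,\rho)$, $\lambda=\rho^2$, and let $\theta_1,\theta_2\in[-\pi,\pi]$. Then the dispersion relation (the equation in $(\rho,\theta_1,\theta_2)$ whose solution set is the set of $(\lambda,\Theta)$ with $\lambda$ an eigenvalue of the Bloch Hamiltonian $H^{\Theta}$, $\Theta=(\theta_1,\theta_2)$) is as follows. (a) For the truncated hexagonal tiling $(3,12^2)$ (operator $H_{trH}$): $$3S^3S'(3S'+2)\left\{81(S')^4-54(S')^3-45(S')^2+18S'-8\cos\tfrac{\theta_1}{2}\cos\tfrac{\theta_2}{2}\cos\tfrac{\theta_1-\theta_2}{2}+8\right\}=0.$$ (b) For the snub square tiling $(3^2,4,3,4)$ (operator $H_{SS}$), with $c=\cos\theta_1$, $d=\cos\theta_2$: $$S^6\left\{625(S')^4-250(S')^2-40S'+1-100(c+d)(S')^2-40(c+d+cd)S'-4(c+d+4cd-c^2-d^2)\right\}=0.$$ (c) For the rhombi-trihexagonal tiling $(3,4,6,4)$ (operator $H_{RTH}$): $$S^6\Big\{2048(S')^6-1536(S')^4-128(S')^3+192(S')^2-3-2(64(S')^3+32(S')^2-1)(\cos\theta_1+\cos(\theta_1+\theta_2)+\cos\theta_2)$$ $$+(\cos2(\theta_1+\theta_2)+\cos2\theta_1+\cos2\theta_2)-2(\cos(2\theta_1+\theta_2)+\cos(\theta_1-\theta_2)+\cos(\theta_1+2\theta_2))\Big\}=0.$$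 (d) For the snub trihexagonal tiling $(3^4,6)$ (operator $H_{STH}$): $$S^9\Big\{15625(S')^6-9375(S')^4-2000(S')^3+675(S')^2+120S'-11+2(\cos2\theta_1+\cos2\theta_2+\cos2(\theta_1+\theta_2))$$ $$-4(\cos(2\theta_1+\theta_2)+\cos(\theta_1+2\theta_2)+\cos(\theta_2-\theta_1))(2+5S')$$ $$-4(\cos\theta_1+\cos\theta_2+\cos(\theta_1+\theta_2))(250(S')^3+150(S')^2+15S'-2)\Big\}=0.$$ (e) For the truncated trihexagonal tiling $(4,6,12)$ (operator $H_{trTH}$): $$S^6\Big\{531441(S')^{12}-1062882(S')^{10}+728271(S')^8-204120(S')^6+21627(S')^4-918(S')^2+15$$ $$+2(\cos2\theta_1+\cos2\theta_2+\cos2(\theta_1-\theta_2))+4(\cos(2\theta_1-\theta_2)+\cos(\theta_1+\theta_2)+\cos(\theta_1-2\theta_2))(1-18(S')^2)$$ $$+4(\cos\theta_1+\cos(\theta_1-\theta_2)+\cos\theta_2)(-2187(S')^6+1215(S')^4-135(S')^2+4)\Big\}=0.$$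
   Context: Each tiling is viewed as an infinite metric graph $G$ in the plane whose edges are the sides of the regular polygons, all of length $a$. Vertex configurations: truncated hexagonal $(3,12,12)$ (a triangle and two dodecagons at each vertex); snub square $(3,3,4,3,4)$; rhombi-trihexagonal $(3,4,6,4)$; snub trihexagonal $(3,3,3,3,6)$; truncated trihexagonal $(4,6,12)$. The tilings are positioned so that their translation lattices are generated by $\vec k_1,\vec k_2$ as follows: truncated hexagonal $\vec k_1=((2+\sqrt3)a,0)$, $\vec k_2=((1+\frac{\sqrt3}{2})a,(\frac32+\sqrt3)a)$; snub square $\vec k_1=(\frac{\sqrt3+1}{2}a,\frac{\sqrt3+1}{2}a)$, $\vec k_2=(\frac{\sqrt3+1}{2}a,-\frac{\sqrt3+1}{2}a)$; rhombi-trihexagonal $\vec k_1=(\frac{\sqrt3+1}{2}a,\frac{\sqrt3+3}{2}a)$, $\vec k_2=(\frac{\sqrt3+1}{2}a,-\frac{\sqrt3+3}{2}a)$; snub trihexagonal $\vec k_1=(2a,\sqrt3 a)$, $\vec k_2=(\frac{5a}{2},-\frac{\sqrt3 a}{2})$; truncated trihexagonal $\vec k_1=(\frac{3+3\sqrt3}{2}a,\frac{3+\sqrt3}{2}a)$, $\vec k_2=(\frac{3+3\sqrt3}{2}a,-\frac{3+\sqrt3}{2}a)$. Each edge is identified with $[0,a]$. The operator $H$ acts by $y_e\mapsto -y_e''+q y_e$ on each edge $e$, with domain the functions $\mathbf y=(y_e)$ with $y_e\in H^2(e)$, $\sum_e\|y_e\|^2_{H^2(e)}<\infty$, continuous at each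 vertex and with the sum of outgoing derivatives at each vertex equal to zero; $H$ is self-adjoint. For $\Theta=(\theta_1,\theta_2)\in[-\pi,\pi]^2$, the Bloch Hamiltonian $H^\Theta$ is the same differential expression acting on admissible functions satisfying $\mathbf y(x+p_1\vec k_1+p_2\vec k_2)=e^{i(p_1\theta_1+p_2\theta_2)}\mathbf y(x)$ for all $(p_1,p_2)\in\mathbb Z^2$; it has discrete spectrum and $\sigma(H)=\bigcup_{\Theta\in[-\pi,\pi]^2}\sigma(H^\Theta)$. $C(x,\rho)$ and $S(x,\rho)$ denote the solutions of $-y''+qy=\rho^2y$ on $[0,a]$ with $C(0,\rho)=S'(0,\rho)=1$, $C'(0,\rho)=S(0,\rho)=0$ (prime is $d/dx$); for even $q$ one has $C(a,\rho)=S'(a,\rho)$.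
   Formalization: For the snub trihexagonal tiling (d), the second lattice vector is taken as (-5a/2, √3a/2), the negative of the stated k₂; with the stated k₂ formula (d) is false and holds only with θ₂ replaced by -θ₂ (e.g. q=0, Θ=(π/2,π/2)). *)

theory Defs
  imports "HOL-Analysis.Analysis"
begin

(* ---------- ODE on one edge [0,a] ----------
   y solves  -y'' + q y = lam y  in the H^2 sense on [0,a]:
   y is differentiable on [0,a] with derivative y', and y' is the indefinite
   integral of (q - lam) y (so y' is absolutely continuous, y'' = (q - lam) y a.e.). *)
definition edge_sol ::
  "(real \<Rightarrow> real) \<Rightarrow> real \<Rightarrow> complex \<Rightarrow> (real \<Rightarrow> complex) \<Rightarrow> (real \<Rightarrow> complex) \<Rightarrow> bool" where
  "edge_sol q a lam y y' \<longleftrightarrow>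
     (\<forall>t\<in>{0..a}. (y has_vector_derivative y' t) (at t within {0..a})) \<and>
     (\<lambda>s. (complex_of_real (q s) - lam) * y s) integrable_on {0..a} \<and>
     (\<forall>t\<in>{0..a}. y' t = y' 0 + integral {0..t} (\<lambda>s. (complex_of_real (q s) - lam) * y s))"

definition S_data :: "(real \<Rightarrow> real) \<Rightarrow> real \<Rightarrow> complex \<Rightarrow> complex \<times> complex" where
  "S_data q a \<rho> = (THE p. \<exists>y y'. edge_sol q a (\<rho>^2) y y' \<and> y 0 = 0 \<and> y' 0 = 1 \<and> p = (y a, y' a))"

definition S_end :: "(real \<Rightarrow> real) \<Rightarrow> real \<Rightarrow> complex \<Rightarrow> complex" where
  "S_end q a \<rho> = fst (S_data q a \<rho>)"

definition S'_end :: "(real \<Rightarrow> real) \<Rightarrow> real \<Rightarrow> complex \<Rightarrow> complex" where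
  "S'_end q a \<rho> = snd (S_data q a \<rho>)"

definition lattice :: "real \<times> real \<Rightarrow> real \<times> real \<Rightarrow> (real \<times> real) set" where
  "lattice k1 k2 = {real_of_int p1 *\<^sub>R k1 + real_of_int p2 *\<^sub>R k2 | p1 p2. True}"

definition periodic_vertices ::
  "(real \<times> real) list \<Rightarrow> real \<times> real \<Rightarrow> real \<times> real \<Rightarrow> (real \<times> real) set" where
  "periodic_vertices V0 k1 k2 = {v + t | v t. v \<in> set V0 \<and> t \<in> lattice k1 k2}"

(* edges = sides of the polygons = pairs of vertices at distance a
   (for the Archimedean tilings below these coincide; ordered pairs, both orientations) *)
definition tiling_edges :: "real \<Rightarrow> (real \<times> real) set \<Rightarrow> ((real \<times> real) \<times> (real \<times> real)) set" where
  "tiling_edges a V = {(v, w). v \<in> V \<and> w \<in> V \<and> dist v w = a}"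

definition metric_graph :: "real \<Rightarrow> (real \<times> real) set \<Rightarrow> (real \<times> real) set" where
  "metric_graph a V = \<Union> {closed_segment v w | v w. (v, w) \<in> tiling_edges a V}"

definition edge_fun :: "real \<Rightarrow> real \<times> real \<Rightarrow> real \<times> real \<Rightarrow> (real \<times> real \<Rightarrow> complex) \<Rightarrow> real \<Rightarrow> complex" where
  "edge_fun a v w f = (\<lambda>t. f (v + (t / a) *\<^sub>R (w - v)))"

(* lam is an eigenvalue of the Bloch Hamiltonian H^Theta, Theta = (th1, th2):
   there is a nonzero function on G (continuous at vertices automatically, since it is a
   function of the point of the plane), H^2 on each edge solving -y''+qy = lam y,
   Kirchhoff condition (sum of outgoing derivatives = 0) at every vertex,
   and the Bloch condition y(x + p1 k1 + p2 k2) = e^{i(p1 th1 + p2 th2)} y(x). *)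
definition bloch_eigenvalue ::
  "real \<Rightarrow> (real \<Rightarrow> real) \<Rightarrow> (real \<times> real) set \<Rightarrow> real \<times> real \<Rightarrow> real \<times> real
     \<Rightarrow> real \<Rightarrow> real \<Rightarrow> complex \<Rightarrow> bool" where
  "bloch_eigenvalue a q V k1 k2 th1 th2 lam \<longleftrightarrow>
    (\<exists>f :: real \<times> real \<Rightarrow> complex.
       (\<forall>p1 p2 :: int. \<forall>x\<in>metric_graph a V.
          f (x + real_of_int p1 *\<^sub>R k1 + real_of_int p2 *\<^sub>R k2)
            = cis (real_of_int p1 * th1 + real_of_int p2 * th2) * f x) \<and>
       (\<forall>(v, w)\<in>tiling_edges a V. \<exists>y'. edge_sol q a lam (edge_fun a v w f) y') \<and>
       (\<forall>v\<in>V. (\<Sum>w\<in>{w. (v, w) \<in> tiling_edges a V}.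
                 vector_derivative (edge_fun a v w f) (at 0 within {0..a})) = 0) \<and>
       (\<exists>x\<in>metric_graph a V. f x \<noteq> 0))"

(* truncated hexagonal (3,12,12): dodecagons centred at lattice points *)
definition trH_k1 :: "real \<Rightarrow> real \<times> real" where "trH_k1 a = a *\<^sub>R (2 + sqrt 3, 0)"
definition trH_k2 :: "real \<Rightarrow> real \<times> real" where "trH_k2 a = a *\<^sub>R (1 + sqrt 3 / 2, 3/2 + sqrt 3)"
definition trH_V :: "real \<Rightarrow> (real \<times> real) set" where
  "trH_V a = periodic_vertices (map (\<lambda>p. a *\<^sub>R p)
     [(1 + sqrt 3 / 2, 1/2), (1/2 + sqrt 3 / 2, 1/2 + sqrt 3 / 2), (1/2, 1 + sqrt 3 / 2),
      (-1/2, 1 + sqrt 3 / 2), (-1/2 - sqrt 3 / 2, 1/2 + sqrt 3 / 2), (-1 - sqrt 3 / 2, -1/2)])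
     (trH_k1 a) (trH_k2 a)"

(* snub square (3,3,4,3,4): squares centred at lattice points *)
definition SS_k1 :: "real \<Rightarrow> real \<times> real" where "SS_k1 a = a *\<^sub>R ((sqrt 3 + 1) / 2, (sqrt 3 + 1) / 2)"
definition SS_k2 :: "real \<Rightarrow> real \<times> real" where "SS_k2 a = a *\<^sub>R ((sqrt 3 + 1) / 2, - (sqrt 3 + 1) / 2)"
definition SS_V :: "real \<Rightarrow> (real \<times> real) set" where
  "SS_V a = periodic_vertices (map (\<lambda>p. a *\<^sub>R p)
     [((1 + sqrt 3) / 4, (sqrt 3 - 1) / 4), ((1 - sqrt 3) / 4, (1 + sqrt 3) / 4),
      (- (1 + sqrt 3) / 4, (1 - sqrt 3) / 4), ((sqrt 3 - 1) / 4, - (1 + sqrt 3) / 4)])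
     (SS_k1 a) (SS_k2 a)"

(* rhombi-trihexagonal (3,4,6,4): hexagons centred at lattice points *)
definition RTH_k1 :: "real \<Rightarrow> real \<times> real" where "RTH_k1 a = a *\<^sub>R ((sqrt 3 + 1) / 2, (sqrt 3 + 3) / 2)"
definition RTH_k2 :: "real \<Rightarrow> real \<times> real" where "RTH_k2 a = a *\<^sub>R ((sqrt 3 + 1) / 2, - (sqrt 3 + 3) / 2)"
definition RTH_V :: "real \<Rightarrow> (real \<times> real) set" where
  "RTH_V a = periodic_vertices (map (\<lambda>p. a *\<^sub>R p)
     [(sqrt 3 / 2, 1/2), (0, 1), (- sqrt 3 / 2, 1/2), (- sqrt 3 / 2, -1/2), (0, -1), (sqrt 3 / 2, -1/2)])
     (RTH_k1 a) (RTH_k2 a)"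

definition STH_k1 :: "real \<Rightarrow> real \<times> real" where "STH_k1 a = a *\<^sub>R (2, sqrt 3)"
definition STH_k2 :: "real \<Rightarrow> real \<times> real" where "STH_k2 a = a *\<^sub>R (-5/2, sqrt 3 / 2)"
definition STH_V :: "real \<Rightarrow> (real \<times> real) set" where
  "STH_V a = periodic_vertices (map (\<lambda>p. a *\<^sub>R p)
     [(1, 0), (1/2, sqrt 3 / 2), (-1/2, sqrt 3 / 2), (-1, 0), (-1/2, - sqrt 3 / 2), (1/2, - sqrt 3 / 2)])
     (STH_k1 a) (STH_k2 a)"

(* truncated trihexagonal (4,6,12): dodecagons centred at lattice points *)
definition trTH_k1 :: "real \<Rightarrow> real \<times> real" where "trTH_k1 a = a *\<^sub>R ((3 + 3 * sqrt 3) / 2, (3 + sqrt 3) / 2)"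
definition trTH_k2 :: "real \<Rightarrow> real \<times> real" where "trTH_k2 a = a *\<^sub>R ((3 + 3 * sqrt 3) / 2, - (3 + sqrt 3) / 2)"
definition trTH_V :: "real \<Rightarrow> (real \<times> real) set" where
  "trTH_V a = periodic_vertices (map (\<lambda>p. a *\<^sub>R p)
     [(1 + sqrt 3 / 2, 1/2), (1/2 + sqrt 3 / 2, 1/2 + sqrt 3 / 2), (1/2, 1 + sqrt 3 / 2),
      (-1/2, 1 + sqrt 3 / 2), (-1/2 - sqrt 3 / 2, 1/2 + sqrt 3 / 2), (-1 - sqrt 3 / 2, 1/2),
      (-1 - sqrt 3 / 2, -1/2), (-1/2 - sqrt 3 / 2, -1/2 - sqrt 3 / 2), (-1/2, -1 - sqrt 3 / 2),
      (1/2, -1 - sqrt 3 / 2), (1/2 + sqrt 3 / 2, -1/2 - sqrt 3 / 2), (1 + sqrt 3 / 2, -1/2)])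
     (trTH_k1 a) (trTH_k2 a)"

end

theory Submission
  imports Defs "Jordan_Normal_Form.Determinant"
begin

text \<open>On an edge \<open>[0, a]\<close> with even potential a solution is \<open>y = y(0) C + y'(0) S\<close> with \<open>C(a) = S'(a)\<close>, so if
  \<open>S(a) \<noteq> 0\<close> it is determined by its end values and \<open>y'(0) = (y(a) - S'(a) y(0)) / S(a)\<close>. The Kirchhoff
  conditions for a Bloch function then say that its vertex values \<open>u\<close> satisfy \<open>A(\<Theta>) u = d S'(a) u\<close>, where
  \<open>A(\<Theta>)\<close> is the Floquet adjacency matrix of the \<open>d\<close>-regular tiling, and the factor in braces in the
  dispersion relation is \<open>det (A(\<Theta>) - d S'(a))\<close> up to a constant. If \<open>S(a) = 0\<close> there are always
  eigenfunctions vanishing at all vertices, since a fundamental domain has more edges than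
  vertices. That a function on the plane can be prescribed edge by edge rests on planarity, which
  follows because distinct vertices have distance at least \<open>a\<close> and edges have length exactly \<open>a\<close>.\<close>

section \<open>The edge equation\<close>

text \<open>As \<open>q\<close> is only square integrable, \<open>y''\<close> exists merely almost
  everywhere, so the initial value problem is treated as a Volterra equation in a weighted sup norm.
  The number \<open>\<rho>\<close> is an arbitrary complex number: the equivalence rests on explicit
  constructions in both directions and not on self-adjointness. Since the theorem compares zero
  sets, determinants are needed only up to nonzero factors, here constants and monomials in
  \<open>cis \<theta>1\<close> and \<open>cis \<theta>2\<close>. The exponent of \<open>S\<close> in
  each relation is the number of edges minus the number of vertices in a fundamental domain. That
  the edges are exactly the listed ones is a statement about infinitely many pairs of points with
  irrational coordinates: a bound on the periods leaves nine translates for each pair of base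
  vertices, and signs of numbers \<open>D + B * sqrt 3\<close> are decided by squaring.\<close>

lemma absolutely_integrable_mult_continuous:
  fixes p u :: "real \<Rightarrow> 'a :: {euclidean_space, real_normed_algebra}"
  assumes "p absolutely_integrable_on {s..t}" "continuous_on {s..t} u"
  shows "(\<lambda>x. p x * u x) absolutely_integrable_on {s..t}"
proof -
  have "bounded_bilinear (\<lambda>x y :: 'a. y * x)"
    using bounded_bilinear.flip[OF bounded_bilinear_mult] .
  moreover have "u \<in> borel_measurable (lebesgue_on {s..t})"
    using assms(2) by (intro continuous_imp_measurable_on_sets_lebesgue) auto
  moreover have "bounded (u ` {s..t})"
    using assms(2) by (intro compact_imp_bounded compact_continuous_image) auto
  ultimately show ?thesis
    using absolutely_integrable_bounded_measurable_product[of "\<lambda>x y. y * x" u "{s..t}" p] assms(1)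
    by (auto simp: bilinear_conv_bounded_bilinear)
qed

lemma integral_diff_Icc:
  fixes f :: "real \<Rightarrow> 'a :: banach"
  assumes "f integrable_on {0..a}" "0 \<le> s" "s \<le> t" "t \<le> a"
  shows "integral {0..t} f - integral {0..s} f = integral {s..t} f"
proof -
  have "f integrable_on {0..t}"
    using assms by (auto intro: integrable_on_subinterval)
  then have "integral {0..s} f + integral {s..t} f = integral {0..t} f"
    using assms by (intro Henstock_Kurzweil_Integration.integral_combine) auto
  then show ?thesis by (simp add: algebra_simps)
qed

text \<open>The weight is an exponential of the primitive of \<open>g\<close>. Since \<open>g\<close> is merely integrable the
  chain rule is not available; the inequality on short intervals with a factor 2 to spare is
  enough, because both sides are additive in the interval.\<close>

lemma gronwall_weight:
  fixes g :: "real \<Rightarrow> real"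
  assumes g: "g integrable_on {0..a}" and nn: "\<And>x. x \<in> {0..a} \<Longrightarrow> 0 \<le> g x" and c: "c > 0" and a: "a \<ge> 0"
  shows "\<exists>w. continuous_on {0..a} w \<and> mono_on {0..a} w \<and> (\<forall>t\<in>{0..a}. 1 \<le> w t) \<and>
    (\<forall>t\<in>{0..a}. integral {0..t} (\<lambda>x. g x * w x) \<le> c * w t)"
proof -
  define P where "P t = integral {0..t} g" for t
  \<comment> \<open>With a chain rule the exponent \<open>1 / c\<close> would do; doubling it pays
    for the factor 2 in \<open>w u \<le> 2 * w s\<close> on short intervals.\<close>
  define k where "k = 2 / c"
  have k: "k > 0" using c by (simp add: k_def)
  define w where "w t = exp (k * P t)" for t
  have Pcont: "continuous_on {0..a} P"
    unfolding P_def using indefinite_integral_continuous_1[OF g] .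
  have Pdiff: "P t - P s = integral {s..t} g" if "0 \<le> s" "s \<le> t" "t \<le> a" for s t
    unfolding P_def using integral_diff_Icc[OF g] that by simp
  have gsub: "g integrable_on {s..t}" if "0 \<le> s" "t \<le> a" for s t
    using g that by (auto intro: integrable_on_subinterval)
  have Pmono: "P s \<le> P t" if "0 \<le> s" "s \<le> t" "t \<le> a" for s t
  proof -
    have "0 \<le> integral {s..t} g"
      using that by (intro integral_nonneg gsub nn) auto
    then show ?thesis using Pdiff[OF that] by simp
  qed
  have wcont: "continuous_on {0..a} w"
    unfolding w_def by (intro continuous_intros Pcont)
  have wmono: "w s \<le> w t" if "0 \<le> s" "s \<le> t" "t \<le> a" for s t
    using Pmono[OF that] k by (simp add: w_def)
  have P0: "P 0 = 0" by (simp add: P_def)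
  have w1: "1 \<le> w t" if "t \<in> {0..a}" for t
    using Pmono[of 0 t] P0 that k by (simp add: w_def)
  have gabs: "g absolutely_integrable_on {0..a}"
    using g nn by (rule nonnegative_absolutely_integrable_1)
  have gw: "(\<lambda>x. g x * w x) integrable_on {0..a}"
    using absolutely_integrable_mult_continuous[OF gabs wcont]
    using set_lebesgue_integral_eq_integral(1) by blast
  define R where "R s t \<longleftrightarrow> (0 \<le> s \<and> s \<le> t \<and> t \<le> a \<longrightarrow>
     integral {s..t} (\<lambda>x. g x * w x) \<le> c * (w t - w s))" for s t
  \<comment> \<open>Bisection: \<open>R\<close> passes from two adjacent intervals to their union
    and holds on all short intervals around any point, hence on the whole interval.\<close>
  have main: "R 0 t" if t: "t \<in> {0..a}" for t
  proof (rule Bolzano[of 0 t R])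
    show "0 \<le> t" using t by simp
    fix x y z assume "R x y" "R y z" and xy: "x \<le> y" "y \<le> z"
    show "R x z" unfolding R_def
    proof
      assume A: "0 \<le> x \<and> x \<le> z \<and> z \<le> a"
      have "(\<lambda>x. g x * w x) integrable_on {x..z}"
        using gw A by (auto intro: integrable_on_subinterval)
      then have "integral {x..z} (\<lambda>x. g x * w x)
        = integral {x..y} (\<lambda>x. g x * w x) + integral {y..z} (\<lambda>x. g x * w x)"
        using xy by (intro Henstock_Kurzweil_Integration.integral_combine[symmetric]) auto
      also have "\<dots> \<le> c * (w y - w x) + c * (w z - w y)"
        using \<open>R x y\<close> \<open>R y z\<close> A xy unfolding R_def by (intro add_mono) auto
      finally show "integral {x..z} (\<lambda>x. g x * w x) \<le> c * (w z - w x)"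
        by (simp add: algebra_simps)
    qed
  next
    fix x assume x: "0 \<le> x" "x \<le> t"
    then have "x \<in> {0..a}" using t by simp
    \<comment> \<open>If \<open>P s\<close> and \<open>P u\<close> are this close to
      \<open>P x\<close>, they differ by less than \<open>ln 2 / k\<close>, so
      \<open>w = exp (k * P)\<close> at most doubles from \<open>s\<close> to
      \<open>u\<close>.\<close>
    moreover have "ln 2 / (2 * k) > 0" using k by simp
    ultimately obtain d where d: "d > 0"
      "\<And>y. y \<in> {0..a} \<Longrightarrow> dist y x < d \<Longrightarrow> dist (P y) (P x) < ln 2 / (2 * k)"
      using Pcont unfolding continuous_on_iff by blast
    show "\<exists>d>0. \<forall>s u. s \<le> x \<and> x \<le> u \<and> u - s < d \<longrightarrow> R s u"
    proof (intro exI[of _ d] conjI allI impI)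
      fix s u assume su: "s \<le> x \<and> x \<le> u \<and> u - s < d"
      show "R s u" unfolding R_def
      proof
        assume A: "0 \<le> s \<and> s \<le> u \<and> u \<le> a"
        have "dist (P s) (P x) < ln 2 / (2 * k)" "dist (P u) (P x) < ln 2 / (2 * k)"
          using su A by (intro d(2); use su A in \<open>simp add: dist_real_def\<close>)+
        then have "P u - P s < ln 2 / (2 * k) + ln 2 / (2 * k)"
          unfolding dist_real_def by linarith
        also have "\<dots> = ln 2 / k" using k by (simp add: field_simps)
        finally have "k * (P u - P s) \<le> ln 2"
          using k by (simp add: field_simps)
        then have "k * P u \<le> ln 2 + k * P s" by (simp add: algebra_simps)
        then have "w u \<le> exp (ln 2 + k * P s)" unfolding w_def by simp
        then have wu: "w u \<le> 2 * w s" by (simp add: exp_add w_def)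
        have "integral {s..u} (\<lambda>x. g x * w x) \<le> integral {s..u} (\<lambda>x. g x * w u)"
        proof (rule integral_le)
          show "(\<lambda>x. g x * w x) integrable_on {s..u}"
            using gw A by (auto intro: integrable_on_subinterval)
          show "(\<lambda>x. g x * w u) integrable_on {s..u}"
            using gsub[of s u] A by (intro integrable_on_mult_left) auto
          show "g x * w x \<le> g x * w u" if "x \<in> {s..u}" for x
            using that A by (intro mult_left_mono wmono nn) auto
        qed
        also have "\<dots> = (P u - P s) * w u"
          using Pdiff[of s u] A by simp
        also have "\<dots> \<le> (P u - P s) * (2 * w s)"
          using wu Pmono[of s u] A by (intro mult_left_mono) auto
        also have "\<dots> = c * (w s * (k * (P u - P s)))"
          using c by (simp add: k_def)
        also have "\<dots> \<le> c * (w s * (exp (k * (P u - P s)) - 1))"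
        proof -
          have "k * (P u - P s) \<le> exp (k * (P u - P s)) - 1"
            using exp_ge_add_one_self[of "k * (P u - P s)"] by linarith
          moreover have "w s \<ge> 0" by (simp add: w_def)
          ultimately show ?thesis using c by (intro mult_left_mono) auto
        qed
        also have "w s * (exp (k * (P u - P s)) - 1) = w u - w s"
          by (simp add: w_def algebra_simps flip: exp_add)
        finally show "integral {s..u} (\<lambda>x. g x * w x) \<le> c * (w u - w s)" .
      qed
    qed (use d in auto)
  qed
  have "integral {0..t} (\<lambda>x. g x * w x) \<le> c * w t" if t: "t \<in> {0..a}" for t
  proof -
    have "integral {0..t} (\<lambda>x. g x * w x) \<le> c * (w t - w 0)"
      using main[OF t] t unfolding R_def by auto
    also have "\<dots> \<le> c * w t" using c by (simp add: w_def)
    finally show ?thesis .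
  qed
  moreover have "mono_on {0..a} w" by (rule mono_onI) (simp add: wmono)
  ultimately show ?thesis using wcont w1 by blast
qed

section \<open>Volterra equation with an integrable coefficient\<close>

locale volterra =
  fixes p :: "real \<Rightarrow> complex" and a :: real
  assumes a_pos: "a > 0" and p: "p absolutely_integrable_on {0..a}"
begin

definition V1 :: "(real \<Rightarrow> complex) \<Rightarrow> real \<Rightarrow> complex" where
  "V1 u t = integral {0..t} (\<lambda>s. p s * u s)"

text \<open>Integrating \<open>y'' = p y\<close> twice gives
  \<open>y = y(0) + y'(0) t + K y\<close>, a fixed-point equation that makes sense for merely
  integrable \<open>p\<close>.\<close>

definition K :: "(real \<Rightarrow> complex) \<Rightarrow> real \<Rightarrow> complex" where
  "K u t = integral {0..t} (V1 u)"

lemma pu_integrable: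
  assumes "continuous_on {0..a} u" "t \<le> a"
  shows "(\<lambda>s. p s * u s) integrable_on {0..t}"
proof -
  have "(\<lambda>s. p s * u s) integrable_on {0..a}"
    using absolutely_integrable_mult_continuous[OF p assms(1)]
      set_lebesgue_integral_eq_integral(1) by blast
  then show ?thesis using assms by (auto intro: integrable_on_subinterval)
qed

lemma V1_cont: "continuous_on {0..a} u \<Longrightarrow> continuous_on {0..a} (V1 u)"
  unfolding V1_def by (intro indefinite_integral_continuous_1 pu_integrable) auto

lemma V1_integrable:
  assumes "continuous_on {0..a} u" "t \<le> a"
  shows "V1 u integrable_on {0..t}"
proof -
  have "continuous_on {0..t} (V1 u)"
    using V1_cont[OF assms(1)] assms(2) by (elim continuous_on_subset) auto
  then show ?thesis by (rule integrable_continuous_real)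
qed

lemma K_cont: "continuous_on {0..a} u \<Longrightarrow> continuous_on {0..a} (K u)"
  unfolding K_def by (intro indefinite_integral_continuous_1 V1_integrable) auto

lemma K_linear:
  assumes u: "continuous_on {0..a} u" and v: "continuous_on {0..a} v" and t: "t \<le> a"
  shows "K (\<lambda>x. \<alpha> * u x + \<beta> * v x) t = \<alpha> * K u t + \<beta> * K v t"
proof -
  have V: "V1 (\<lambda>x. \<alpha> * u x + \<beta> * v x) s = \<alpha> * V1 u s + \<beta> * V1 v s" if "s \<in> {0..t}" for s
  proof -
    have s: "s \<le> a" using that t by simp
    have "V1 (\<lambda>x. \<alpha> * u x + \<beta> * v x) s = integral {0..s} (\<lambda>x. \<alpha> * (p x * u x) + \<beta> * (p x * v x))"
      unfolding V1_def by (rule integral_cong) (simp add: algebra_simps)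
    also have "\<dots> = integral {0..s} (\<lambda>x. \<alpha> * (p x * u x)) + integral {0..s} (\<lambda>x. \<beta> * (p x * v x))"
      using pu_integrable[OF u s] pu_integrable[OF v s]
      by (intro integral_add integrable_on_mult_right) auto
    finally show ?thesis by (simp add: V1_def)
  qed
  have "K (\<lambda>x. \<alpha> * u x + \<beta> * v x) t = integral {0..t} (\<lambda>s. \<alpha> * V1 u s + \<beta> * V1 v s)"
    unfolding K_def by (rule integral_cong) (rule V)
  also have "\<dots> = integral {0..t} (\<lambda>x. \<alpha> * V1 u x) + integral {0..t} (\<lambda>x. \<beta> * V1 v x)"
    using V1_integrable[OF u t] V1_integrable[OF v t]
    by (intro integral_add integrable_on_mult_right) auto
  finally show ?thesis by (simp add: K_def)
qed

text \<open>\<open>K\<close> is a contraction with constant 1/2 in the norm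
  \<open>sup |u| / w\<close>. This replaces a smallness condition on \<open>p\<close> or on the
  length \<open>a\<close>; the lower bound 1 for \<open>w\<close> turns a sup bound into a weighted
  one.\<close>

definition halving_weight :: "(real \<Rightarrow> real) \<Rightarrow> bool" where
  "halving_weight w \<longleftrightarrow> continuous_on {0..a} w \<and> (\<forall>t\<in>{0..a}. 1 \<le> w t) \<and>
     (\<forall>u M. continuous_on {0..a} u \<longrightarrow> 0 \<le> M \<longrightarrow> (\<forall>t\<in>{0..a}. norm (u t) \<le> M * w t) \<longrightarrow>
        (\<forall>t\<in>{0..a}. norm (K u t) \<le> M / 2 * w t))"

lemma halving_weightD:
  assumes "halving_weight w"
  shows "continuous_on {0..a} w" "\<And>t. t \<in> {0..a} \<Longrightarrow> 1 \<le> w t"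
    "\<And>u M t. continuous_on {0..a} u \<Longrightarrow> 0 \<le> M \<Longrightarrow> (\<And>t. t \<in> {0..a} \<Longrightarrow> norm (u t) \<le> M * w t) \<Longrightarrow>
        t \<in> {0..a} \<Longrightarrow> norm (K u t) \<le> M / 2 * w t"
  using assms unfolding halving_weight_def by simp_all

text \<open>Apply \<open>gronwall_weight\<close> to \<open>|p|\<close> with
  \<open>c = 1 / (2 * a)\<close>: the inner integral gains \<open>1 / (2 * a)\<close>, monotonicity
  replaces \<open>w s\<close> by \<open>w t\<close>, and the outer integral costs at most a factor
  \<open>a\<close>.\<close>

lemma halving_weight_exists: "\<exists>w. halving_weight w"
proof -
  have pn: "(\<lambda>x. norm (p x)) integrable_on {0..a}"
    using p by (simp add: absolutely_integrable_on_def)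
  have "\<exists>w. continuous_on {0..a} w \<and> mono_on {0..a} w \<and> (\<forall>t\<in>{0..a}. 1 \<le> w t) \<and>
      (\<forall>t\<in>{0..a}. integral {0..t} (\<lambda>x. norm (p x) * w x) \<le> 1 / (2 * a) * w t)"
    using a_pos by (intro gronwall_weight[OF pn]) auto
  then obtain w where w: "continuous_on {0..a} w" "mono_on {0..a} w"
    and w1: "\<forall>t\<in>{0..a}. 1 \<le> w t"
    and wi: "\<forall>t\<in>{0..a}. integral {0..t} (\<lambda>x. norm (p x) * w x) \<le> 1 / (2 * a) * w t"
    by blast
  have pw: "(\<lambda>x. norm (p x) * w x) integrable_on {0..t}" if "t \<le> a" for t
  proof -
    have "(\<lambda>x. norm (p x)) absolutely_integrable_on {0..a}"
      using absolutely_integrable_norm[OF p] by (simp add: o_def)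
    then have "(\<lambda>x. norm (p x) * w x) integrable_on {0..a}"
      using absolutely_integrable_mult_continuous[OF _ w(1)]
        set_lebesgue_integral_eq_integral(1) by blast
    then show ?thesis using that by (auto intro: integrable_on_subinterval)
  qed
  have main: "norm (K u t) \<le> (M / 2) * w t"
    if u: "continuous_on {0..a} u" and M: "0 \<le> M" and
       le: "\<And>t. t \<in> {0..a} \<Longrightarrow> norm (u t) \<le> M * w t" and t: "t \<in> {0..a}" for u M t
  proof -
    have V: "norm (V1 u s) \<le> M * (1 / (2 * a) * w t)" if s: "s \<in> {0..t}" for s
    proof -
      have sa: "s \<in> {0..a}" using s t by simp
      have "norm (V1 u s) \<le> integral {0..s} (\<lambda>x. M * (norm (p x) * w x))"
        unfolding V1_def
      proof (rule integral_norm_bound_integral)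
        show "(\<lambda>x. p x * u x) integrable_on {0..s}" using pu_integrable[OF u] sa by simp
        show "(\<lambda>x. M * (norm (p x) * w x)) integrable_on {0..s}"
          using pw[of s] sa by (intro integrable_on_mult_right) auto
        show "norm (p x * u x) \<le> M * (norm (p x) * w x)" if "x \<in> {0..s}" for x
          using mult_left_mono[OF le[of x] norm_ge_zero[of "p x"]] that sa
          by (simp add: norm_mult mult_ac)
      qed
      also have "\<dots> = M * integral {0..s} (\<lambda>x. norm (p x) * w x)" by simp
      also have "\<dots> \<le> M * (1 / (2 * a) * w s)"
        using wi[rule_format, OF sa] M by (rule mult_left_mono)
      also have "\<dots> \<le> M * (1 / (2 * a) * w t)"
        using mono_onD[OF w(2), of s t] s t M a_pos by (intro mult_left_mono) auto
      finally show ?thesis .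
    qed
    have "norm (K u t) \<le> integral {0..t} (\<lambda>_. M * (1 / (2 * a) * w t))"
      unfolding K_def using V1_integrable[OF u] t V
      by (intro integral_norm_bound_integral) auto
    also have "\<dots> = t * (M * (1 / (2 * a) * w t))" using t by simp
    also have "\<dots> \<le> a * (M * (1 / (2 * a) * w t))"
      using t M a_pos w1[rule_format, OF t] by (intro mult_right_mono mult_nonneg_nonneg) auto
    also have "\<dots> = (M / 2) * w t" using a_pos by (simp add: field_simps)
    finally show ?thesis .
  qed
  then have "halving_weight w"
    unfolding halving_weight_def using w(1) w1 by simp
  then show ?thesis by blast
qed

lemma bound:
  assumes "continuous_on {0..a} (u :: real \<Rightarrow> complex)"
  obtains M where "0 \<le> M" "\<And>t. t \<in> {0..a} \<Longrightarrow> norm (u t) \<le> M"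
proof -
  have "bounded (u ` {0..a})"
    using assms by (intro compact_imp_bounded compact_continuous_image) auto
  then obtain M where M: "\<And>t. t \<in> {0..a} \<Longrightarrow> norm (u t) \<le> M"
    unfolding bounded_iff by blast
  have "norm (u 0) \<le> M" using M a_pos by simp
  then have "0 \<le> M" using norm_ge_zero[of "u 0"] by linarith
  then show thesis using that M by blast
qed

text \<open>A fixed point may be bounded again after each application of \<open>K\<close>, so its
  bound \<open>M * w t\<close> is halved arbitrarily often.\<close>

lemma K_fixpoint_zero:
  assumes u: "continuous_on {0..a} u" and fp: "\<And>t. t \<in> {0..a} \<Longrightarrow> u t = K u t" and t: "t \<in> {0..a}"
  shows "u t = 0"
proof -
  obtain w where "halving_weight w" using halving_weight_exists by blast
  note w = halving_weightD[OF this]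
  obtain M where M: "0 \<le> M" "\<And>t. t \<in> {0..a} \<Longrightarrow> norm (u t) \<le> M"
    using bound[OF u] by blast
  have "norm (u t) \<le> M / 2 ^ n * w t" if "t \<in> {0..a}" for n t
    using that
  proof (induction n arbitrary: t)
    case 0
    then show ?case using M(2)[OF 0] mult_left_mono[OF w(2)[OF 0] M(1)] by simp
  next
    case (Suc n)
    have "norm (K u t) \<le> (M / 2 ^ n / 2) * w t"
      using Suc M(1) by (intro w(3)[OF u]) auto
    then show ?case using fp[OF Suc.prems] by (simp add: mult.commute)
  qed
  then have "norm (u t) \<le> M * w t * (1 / 2) ^ n" for n
    using t by (simp add: power_divide)
  moreover have "(\<lambda>n. M * w t * (1 / 2) ^ n) \<longlonglongrightarrow> M * w t * 0"
    by (intro tendsto_intros LIMSEQ_power_zero) auto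
  ultimately have "norm (u t) \<le> 0"
    using LIMSEQ_le_const[of "\<lambda>n. M * w t * (1 / 2) ^ n" 0 "norm (u t)"] by auto
  then show ?thesis by simp
qed

text \<open>Neumann series: the solution is the sum of the iterates of \<open>K\<close> on
  \<open>u0\<close>, dominated by a geometric series because \<open>w\<close> is bounded by some
  \<open>W\<close>.\<close>

lemma K_fixpoint_exists:
  assumes u0: "continuous_on {0..a} u0"
  shows "\<exists>y. continuous_on {0..a} y \<and> (\<forall>t\<in>{0..a}. y t = u0 t + K y t)"
proof -
  obtain w where "halving_weight w" using halving_weight_exists by blast
  note w = halving_weightD[OF this]
  obtain W where W: "0 \<le> W" "\<And>t. t \<in> {0..a} \<Longrightarrow> w t \<le> W"
  proof -
    have "continuous_on {0..a} (\<lambda>t. complex_of_real (w t))"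
      using w(1) by (intro continuous_intros)
    from bound[OF this] obtain M where M: "0 \<le> M"
      "\<And>t. t \<in> {0..a} \<Longrightarrow> norm (complex_of_real (w t)) \<le> M" by blast
    show thesis
    proof (rule that[of M])
      show "w t \<le> M" if "t \<in> {0..a}" for t using M(2)[OF that] by simp
    qed (rule M(1))
  qed
  obtain M where M: "0 \<le> M" "\<And>t. t \<in> {0..a} \<Longrightarrow> norm (u0 t) \<le> M"
    using bound[OF u0] by blast
  define u where "u n = (K ^^ n) u0" for n
  have cont: "continuous_on {0..a} (u n)" for n
    by (induction n) (auto simp: u_def u0 K_cont)
  have uS: "u (Suc n) = K (u n)" for n by (simp add: u_def)
  have le: "norm (u n t) \<le> M / 2 ^ n * w t" if "t \<in> {0..a}" for n t
    using that
  proof (induction n arbitrary: t)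
    case 0
    then show ?case using M(2)[OF 0] mult_left_mono[OF w(2)[OF 0] M(1)] by (simp add: u_def)
  next
    case (Suc n)
    have "norm (K (u n) t) \<le> (M / 2 ^ n / 2) * w t"
      using Suc M(1) by (intro w(3)[OF cont]) auto
    then show ?case by (simp add: uS mult.commute)
  qed
  define y where "y t = (\<Sum>n. u n t)" for t
  have unif: "uniform_limit {0..a} (\<lambda>n t. \<Sum>i<n. u i t) y sequentially"
    unfolding y_def
  proof (rule Weierstrass_m_test)
    show "norm (u n t) \<le> M * W * (1 / 2) ^ n" if "t \<in> {0..a}" for n t
    proof -
      have "M / 2 ^ n * w t \<le> M / 2 ^ n * W"
        using W(2)[OF that] M(1) by (intro mult_left_mono) auto
      then show ?thesis using le[OF that, of n] by (simp add: power_divide)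
    qed
    show "summable (\<lambda>n. M * W * (1 / 2) ^ n)" by (intro summable_mult summable_geometric) auto
  qed
  have ycont: "continuous_on {0..a} y"
    by (rule uniform_limit_theorem[OF _ unif])
       (auto intro!: always_eventually continuous_intros cont)
  have Ksum: "K (\<lambda>t. \<Sum>i<n. u i t) t = (\<Sum>i<n. u (Suc i) t)" if "t \<le> a" for n t
  proof (induction n)
    case 0
    have "V1 (\<lambda>t. 0) = (\<lambda>t. 0)" by (simp add: V1_def fun_eq_iff)
    then show ?case by (simp add: K_def)
  next
    case (Suc n)
    have c: "continuous_on {0..a} (\<lambda>t. \<Sum>i<n. u i t)" by (intro continuous_intros cont)
    have "K (\<lambda>t. \<Sum>i<Suc n. u i t) t = K (\<lambda>t. 1 * (\<Sum>i<n. u i t) + 1 * u n t) t" by simp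
    also have "\<dots> = 1 * K (\<lambda>t. \<Sum>i<n. u i t) t + 1 * K (u n) t"
      by (rule K_linear[OF c cont that])
    finally show ?case using Suc by (simp add: uS)
  qed
  have "y t = u0 t + K y t" if t: "t \<in> {0..a}" for t
  proof -
    have lim1: "(\<lambda>n. \<Sum>i<n. u i t) \<longlonglongrightarrow> y t"
      using tendsto_uniform_limitI[OF unif t] .
    \<comment> \<open>The halving bound applied to the difference of a partial sum and
      \<open>y\<close> lets \<open>K\<close> pass to the uniform limit; dividing \<open>e\<close> by
      \<open>W\<close> absorbs the weight.\<close>
    have "(\<lambda>n. K (\<lambda>t. \<Sum>i<n. u i t) t) \<longlonglongrightarrow> K y t"
    proof (rule tendstoI)
      fix e :: real assume e: "e > 0"
      have W1: "W \<ge> 1" using w(2)[OF t] W(2)[OF t] by linarith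
      define e' where "e' = e / W"
      have e': "e' > 0" using e W1 by (simp add: e'_def)
      have "\<forall>\<^sub>F n in sequentially. \<forall>t\<in>{0..a}. dist (\<Sum>i<n. u i t) (y t) < e'"
        using unif e' unfolding uniform_limit_iff by blast
      then show "\<forall>\<^sub>F n in sequentially. dist (K (\<lambda>t. \<Sum>i<n. u i t) t) (K y t) < e"
      proof eventually_elim
        case (elim n)
        have c: "continuous_on {0..a} (\<lambda>t. \<Sum>i<n. u i t)" by (intro continuous_intros cont)
        have "K (\<lambda>t. 1 * (\<Sum>i<n. u i t) + (-1) * y t) t = 1 * K (\<lambda>t. \<Sum>i<n. u i t) t + (-1) * K y t"
          using t by (intro K_linear c ycont) auto
        moreover have "norm (K (\<lambda>t. 1 * (\<Sum>i<n. u i t) + (-1) * y t) t) \<le> e' / 2 * w t"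
        proof (rule w(3)[OF _ _ _ t])
          show "continuous_on {0..a} (\<lambda>t. 1 * (\<Sum>i<n. u i t) + (-1) * y t)"
            by (intro continuous_intros cont ycont)
          show "0 \<le> e'" using e' by simp
          fix s assume s: "s \<in> {0..a}"
          have "norm ((\<Sum>i<n. u i s) - y s) \<le> e'"
            using elim s by (auto simp: dist_norm less_imp_le)
          also have "e' \<le> e' * w s" using w(2)[OF s] e' by simp
          finally show "norm (1 * (\<Sum>i<n. u i s) + (-1) * y s) \<le> e' * w s" by simp
        qed
        moreover have "e' / 2 * w t \<le> e' / 2 * W" using W(2)[OF t] e' by (intro mult_left_mono) auto
        moreover have "e' / 2 * W < e" using e W1 by (simp add: e'_def)
        ultimately show ?case by (simp add: dist_norm)
      qed
    qed
    then have lim2: "(\<lambda>n. \<Sum>i<n. u (Suc i) t) \<longlonglongrightarrow> K y t" using Ksum t by simp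
    have "(\<lambda>n. u 0 t + (\<Sum>i<n. u (Suc i) t)) \<longlonglongrightarrow> u0 t + K y t"
      using tendsto_add[OF tendsto_const[of "u 0 t"] lim2] by (simp add: u_def)
    moreover have "u 0 t + (\<Sum>i<n. u (Suc i) t) = (\<Sum>i<Suc n. u i t)" for n
      by (simp only: sum.lessThan_Suc_shift)
    ultimately have "(\<lambda>n. \<Sum>i<Suc n. u i t) \<longlonglongrightarrow> u0 t + K y t" by simp
    moreover have "(\<lambda>n. \<Sum>i<Suc n. u i t) \<longlonglongrightarrow> y t"
      using LIMSEQ_Suc[OF lim1] .
    ultimately show ?thesis using LIMSEQ_unique by blast
  qed
  then show ?thesis using ycont by blast
qed

end

lemma has_integral_reflect_about:
  fixes f :: "real \<Rightarrow> 'b :: real_normed_vector"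
  assumes "(f has_integral i) {s..t}"
  shows "((\<lambda>x. f (c - x)) has_integral i) {c - t..c - s}"
proof -
  have "((\<lambda>x. f ((-1) *\<^sub>R x + c)) has_integral i) ((\<lambda>x. c - x) ` {s..t})"
    using has_integral_affinity[of f i s t "-1" c] assms by (simp add: algebra_simps)
  then show ?thesis by simp
qed

section \<open>Solutions and transfer matrix on an edge with even potential\<close>

locale even_potential =
  fixes q :: "real \<Rightarrow> real" and a :: real
  assumes a_pos: "a > 0"
    and q_meas: "q \<in> borel_measurable (lebesgue_on {0..a})"
    and q_L2: "(\<lambda>x. (q x)\<^sup>2) integrable_on {0..a}"
    and q_even: "\<forall>x\<in>{0..a}. q x = q (a - x)"
begin

text \<open>On a bounded interval \<open>L^2\<close> lies in \<open>L^1\<close>, with majorant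
  \<open>1 + q^2\<close>.\<close>

lemma q_abs_integrable: "q absolutely_integrable_on {0..a}"
proof (rule measurable_bounded_by_integrable_imp_absolutely_integrable[OF q_meas])
  show "(\<lambda>x. 1 + (q x)\<^sup>2) integrable_on {0..a}"
    using q_L2 by (intro integrable_add) auto
  show "norm (q x) \<le> 1 + (q x)\<^sup>2" for x
    using sum_squares_bound[of "\<bar>q x\<bar>" 1] zero_le_power2[of "q x"] by (simp del: zero_le_power2)
qed auto

lemma volterra: "volterra (\<lambda>s. complex_of_real (q s) - lam) a"
proof
  have "(\<lambda>s. complex_of_real (q s)) absolutely_integrable_on {0..a}"
    using absolutely_integrable_linear[OF q_abs_integrable bounded_linear_of_real]
    unfolding o_def .
  moreover have "(\<lambda>s. lam) absolutely_integrable_on {0..a}"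
    by (intro absolutely_integrable_continuous_real continuous_on_const)
  ultimately show "(\<lambda>s. complex_of_real (q s) - lam) absolutely_integrable_on {0..a}"
    by (rule set_integral_diff(1))
qed (rule a_pos)

lemma edge_solD:
  assumes "edge_sol q a lam y y'"
  shows "\<And>t. t \<in> {0..a} \<Longrightarrow> (y has_vector_derivative y' t) (at t within {0..a})"
    "(\<lambda>s. (complex_of_real (q s) - lam) * y s) integrable_on {0..a}"
    "\<And>t. t \<in> {0..a} \<Longrightarrow> y' t = y' 0 + integral {0..t} (\<lambda>s. (complex_of_real (q s) - lam) * y s)"
  using assms unfolding edge_sol_def by blast+

lemma edge_sol_cont:
  assumes "edge_sol q a lam y y'"
  shows "continuous_on {0..a} y"
  unfolding continuous_on_eq_continuous_within
proof
  fix t assume "t \<in> {0..a}"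
  then have "(y has_vector_derivative y' t) (at t within {0..a})"
    using assms unfolding edge_sol_def by blast
  then show "continuous (at t within {0..a}) y"
    by (rule has_vector_derivative_continuous)
qed

lemma edge_sol_exists: "\<exists>y y'. edge_sol q a lam y y' \<and> y 0 = \<alpha> \<and> y' 0 = \<beta>"
proof -
  interpret volterra "\<lambda>s. complex_of_real (q s) - lam" a by (rule volterra)
  have "continuous_on {0..a} (\<lambda>t. \<alpha> + \<beta> * complex_of_real t)" by (intro continuous_intros)
  from K_fixpoint_exists[OF this] obtain y where
    "continuous_on {0..a} y \<and> (\<forall>t\<in>{0..a}. y t = \<alpha> + \<beta> * complex_of_real t + K y t)"
    by (rule exE)
  then have y: "continuous_on {0..a} y"
    and eq: "\<forall>t\<in>{0..a}. y t = \<alpha> + \<beta> * complex_of_real t + K y t" by simp_all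
  define y' where "y' t = \<beta> + V1 y t" for t
  have K0: "K y 0 = 0" and V0: "V1 y 0 = 0" by (simp_all add: K_def V1_def)
  have "(y has_vector_derivative y' t) (at t within {0..a})" if t: "t \<in> {0..a}" for t
  proof -
    have "((\<lambda>t. integral {0..t} (V1 y)) has_vector_derivative V1 y t) (at t within {0..a})"
      using integral_has_vector_derivative[OF V1_cont[OF y] t] .
    then have "((\<lambda>t. \<alpha> + \<beta> * complex_of_real t + K y t) has_vector_derivative
        (0 + \<beta> * 1 + V1 y t)) (at t within {0..a})"
      unfolding K_def
      by (intro has_vector_derivative_add has_vector_derivative_const has_vector_derivative_mult_right)
         (auto intro!: derivative_eq_intros simp: has_vector_derivative_def scaleR_conv_of_real)
    then show ?thesis
      using eq by (intro has_vector_derivative_transform[OF t, of y "\<lambda>t. \<alpha> + \<beta> * complex_of_real t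
          + K y t"])
        (auto simp: y'_def)
  qed
  moreover have "y' t = y' 0 + integral {0..t} (\<lambda>s. (complex_of_real (q s) - lam) * y s)" for t
    by (simp add: y'_def V0) (simp add: V1_def)
  ultimately have "edge_sol q a lam y y'"
    unfolding edge_sol_def using pu_integrable[OF y order_refl] by blast
  moreover have "y 0 = \<alpha>" using bspec[OF eq, of 0] a_pos K0 by simp
  moreover have "y' 0 = \<beta>" by (simp add: y'_def V0)
  ultimately show ?thesis by blast
qed

lemma edge_sol_linear:
  assumes y: "edge_sol q a lam y y'" and z: "edge_sol q a lam z z'"
  shows "edge_sol q a lam (\<lambda>t. \<alpha> * y t + \<beta> * z t) (\<lambda>t. \<alpha> * y' t + \<beta> * z' t)"
  unfolding edge_sol_def
proof (intro conjI ballI)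
  let ?p = "\<lambda>s. complex_of_real (q s) - lam"
  have D: "(y has_vector_derivative y' t) (at t within {0..a})"
    "(z has_vector_derivative z' t) (at t within {0..a})"
    "y' t = y' 0 + integral {0..t} (\<lambda>s. ?p s * y s)"
    "z' t = z' 0 + integral {0..t} (\<lambda>s. ?p s * z s)" if "t \<in> {0..a}" for t
    using y z that unfolding edge_sol_def by blast+
  have int: "(\<lambda>s. ?p s * y s) integrable_on {0..a}" "(\<lambda>s. ?p s * z s) integrable_on {0..a}"
    using y z unfolding edge_sol_def by blast+
  have int': "(\<lambda>s. ?p s * y s) integrable_on {0..t}" "(\<lambda>s. ?p s * z s) integrable_on {0..t}"
    if "t \<in> {0..a}" for t
    using that by (intro integrable_on_subinterval[OF int(1)] integrable_on_subinterval[OF int(2)],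
        simp)+
  show "((\<lambda>t. \<alpha> * y t + \<beta> * z t) has_vector_derivative \<alpha> * y' t + \<beta> * z' t) (at t within {0..a})"
    if "t \<in> {0..a}" for t
    using D[OF that] by (intro has_vector_derivative_add has_vector_derivative_mult_right)
  have eq: "?p s * (\<alpha> * y s + \<beta> * z s) = \<alpha> * (?p s * y s) + \<beta> * (?p s * z s)" for s
    by (simp add: algebra_simps)
  show "(\<lambda>s. ?p s * (\<alpha> * y s + \<beta> * z s)) integrable_on {0..a}"
    unfolding eq by (intro integrable_add integrable_on_mult_right int)
  show "\<alpha> * y' t + \<beta> * z' t = \<alpha> * y' 0 + \<beta> * z' 0 + integral {0..t} (\<lambda>s. ?p s * (\<alpha> * y s
      + \<beta> * z s))"
    if t: "t \<in> {0..a}" for t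
  proof -
    have "integral {0..t} (\<lambda>s. ?p s * (\<alpha> * y s + \<beta> * z s))
      = integral {0..t} (\<lambda>s. \<alpha> * (?p s * y s)) + integral {0..t} (\<lambda>s. \<beta> * (?p s * z s))"
      unfolding eq by (intro integral_add integrable_on_mult_right int'[OF t])
    then show ?thesis
      unfolding D(3)[OF t] D(4)[OF t] by (simp only: integral_mult_right distrib_left add_ac)
  qed
qed

text \<open>By the fundamental theorem of calculus a solution with zero initial data satisfies
  \<open>y = K y\<close> on the edge, and the contraction \<open>K\<close> has only the zero fixed
  point.\<close>

lemma edge_sol_zero:
  assumes y: "edge_sol q a lam y y'" and "y 0 = 0" "y' 0 = 0" and t: "t \<in> {0..a}"
  shows "y t = 0" "y' t = 0"
proof -
  interpret volterra "\<lambda>s. complex_of_real (q s) - lam" a by (rule volterra)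
  have y': "y' s = V1 y s" if "s \<in> {0..a}" for s
    using edge_solD(3)[OF y that] assms(3) by (simp add: V1_def)
  have yK: "y s = K y s" if s: "s \<in> {0..a}" for s
  proof -
    have "(y' has_integral (y s - y 0)) {0..s}"
    proof (rule fundamental_theorem_of_calculus)
      fix x assume x: "x \<in> {0..s}"
      have "(y has_vector_derivative y' x) (at x within {0..a})"
        using edge_solD(1)[OF y, of x] x s by simp
      then show "(y has_vector_derivative y' x) (at x within {0..s})"
        by (rule has_vector_derivative_within_subset) (use s in simp)
    qed (use s in auto)
    then have "y s = integral {0..s} y'" using assms(2) by (simp add: integral_unique)
    also have "\<dots> = K y s" unfolding K_def using y' s by (intro integral_cong) auto
    finally show ?thesis .
  qed
  have 0: "y s = 0" if "s \<in> {0..a}" for s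
    using K_fixpoint_zero[OF edge_sol_cont[OF y] yK that] .
  show "y t = 0" using 0[OF t] .
  have "V1 y t = integral {0..t} (\<lambda>s. 0)"
    unfolding V1_def using 0 t by (intro integral_cong) auto
  then show "y' t = 0" using y'[OF t] by simp
qed

lemma edge_sol_unique:
  assumes "edge_sol q a lam y y'" "edge_sol q a lam z z'" "y 0 = z 0" "y' 0 = z' 0" "t \<in> {0..a}"
  shows "y t = z t" "y' t = z' t"
  using edge_sol_zero[OF edge_sol_linear[OF assms(1,2), of 1 "-1"], of t] assms(3-) by auto

text \<open>This is where evenness of \<open>q\<close> enters: the substitution
  \<open>s \<mapsto> a - s\<close> leaves the coefficient \<open>q - lam\<close> unchanged.\<close>

lemma edge_sol_reflect:
  assumes y: "edge_sol q a lam y y'"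
  shows "edge_sol q a lam (\<lambda>t. y (a - t)) (\<lambda>t. - y' (a - t))"
  unfolding edge_sol_def
proof (intro conjI ballI)
  let ?p = "\<lambda>s. complex_of_real (q s) - lam"
  have py: "(\<lambda>s. ?p s * y s) integrable_on {0..a}"
    using edge_solD(2)[OF y] .
  show "((\<lambda>t. y (a - t)) has_vector_derivative - y' (a - t)) (at t within {0..a})"
    if t: "t \<in> {0..a}" for t
  proof -
    have "(\<lambda>t. a - t) ` {0..a} = {0..a}" by simp
    moreover have "a - t \<in> {0..a}" using t by simp
    ultimately have "(y has_vector_derivative y' (a - t)) (at (a - t) within (\<lambda>t. a - t) ` {0..a})"
      using edge_solD(1)[OF y, of "a - t"] by simp
    moreover have "((\<lambda>t. a - t) has_vector_derivative -1) (at t within {0..a})"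
      by (auto intro!: derivative_eq_intros)
    ultimately have "((y \<circ> (\<lambda>t. a - t)) has_vector_derivative (-1) *\<^sub>R y' (a
        - t)) (at t within {0..a})"
      by (intro vector_diff_chain_within)
    then show ?thesis by (simp add: o_def)
  qed
  have int: "((\<lambda>s. ?p s * y (a - s)) has_integral integral {a - t..a} (\<lambda>s. ?p s * y s)) {0..t}"
    if t: "t \<in> {0..a}" for t
  proof -
    have "(\<lambda>s. ?p s * y s) integrable_on {a - t..a}"
      using py t by (auto intro: integrable_on_subinterval)
    then have "((\<lambda>s. ?p (a - s) * y (a - s)) has_integral integral {a - t..a} (\<lambda>s. ?p s * y s))
        {a - a..a - (a - t)}"
      by (intro has_integral_reflect_about) (rule integrable_integral)
    then have 1: "((\<lambda>s. ?p (a - s) * y (a - s)) has_integral integral {a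
        - t..a} (\<lambda>s. ?p s * y s)) {0..t}"
      by simp
    have "?p (a - s) * y (a - s) = ?p s * y (a - s)" if "s \<in> {0..t}" for s
      using bspec[OF q_even, of s] that t by simp
    from has_integral_eq[OF this 1] show ?thesis .
  qed
  show "(\<lambda>s. ?p s * y (a - s)) integrable_on {0..a}"
    using int[of a] a_pos by auto
  show "- y' (a - t) = - y' (a - 0) + integral {0..t} (\<lambda>s. ?p s * y (a - s))"
    if t: "t \<in> {0..a}" for t
  proof -
    from edge_solD(3)[OF y, of a] edge_solD(3)[OF y, of "a - t"]
    have "y' a - y' (a - t) = integral {0..a} (\<lambda>s. ?p s * y s) - integral {0..a
        - t} (\<lambda>s. ?p s * y s)"
      using t by simp
    also have "\<dots> = integral {a - t..a} (\<lambda>s. ?p s * y s)"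
      using integral_diff_Icc[OF py, of "a - t" a] t by simp
    also have "\<dots> = integral {0..t} (\<lambda>s. ?p s * y (a - s))"
      using int[OF t] by (simp add: integral_unique)
    finally show ?thesis by (simp add: algebra_simps)
  qed
qed

text \<open>Existence and uniqueness for the initial value problem make the definite description in
  \<open>S_data\<close> meaningful.\<close>

lemma S_end_sol:
  "\<exists>s s'. edge_sol q a (\<rho>\<^sup>2) s s' \<and> s 0 = 0 \<and> s' 0 = 1 \<and>
    s a = S_end q a \<rho> \<and> s' a = S'_end q a \<rho>"
proof -
  obtain s s' where s: "edge_sol q a (\<rho>\<^sup>2) s s'" "s 0 = 0" "s' 0 = 1"
    using edge_sol_exists by blast
  have "S_data q a \<rho> = (s a, s' a)"
    unfolding S_data_def
  proof (rule the_equality)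
    show "\<exists>y y'. edge_sol q a (\<rho>\<^sup>2) y y' \<and> y 0 = 0 \<and> y' 0 = 1 \<and> (s a, s' a) = (y a, y' a)"
      using s by blast
    fix r assume "\<exists>y y'. edge_sol q a (\<rho>\<^sup>2) y y' \<and> y 0 = 0 \<and> y' 0 = 1 \<and> r = (y a, y' a)"
    then obtain y y' where y: "edge_sol q a (\<rho>\<^sup>2) y y'" "y 0 = 0" "y' 0 = 1" "r = (y a, y' a)"
      by blast
    show "r = (s a, s' a)"
      using edge_sol_unique[OF y(1) s(1), of a] y s a_pos by simp
  qed
  then have "s a = S_end q a \<rho>" "s' a = S'_end q a \<rho>" by (simp_all add: S_end_def S'_end_def)
  then show ?thesis using s by blast
qed

text \<open>Reflecting the fundamental system about the midpoint shows that the monodromy matrix \<open>M\<close>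
  satisfies \<open>M J M = J\<close> with \<open>J = diag(1, -1)\<close>; this replaces the Wronskian.\<close>

lemma monodromy:
  assumes "S = S_end q a \<rho>" and "S' = S'_end q a \<rho>"
  shows "\<exists>C D. S * (C - S') = 0 \<and> S'\<^sup>2 - S * D = 1 \<and>
    (\<forall>y y'. edge_sol q a (\<rho>\<^sup>2) y y' \<longrightarrow>
       y a = C * y 0 + S * y' 0 \<and> y' a = D * y 0 + S' * y' 0)"
proof -
  from S_end_sol[of \<rho>] obtain s s' where "edge_sol q a (\<rho>\<^sup>2) s s' \<and> s 0 = 0 \<and> s' 0 = 1 \<and>
    s a = S_end q a \<rho> \<and> s' a = S'_end q a \<rho>"
    by (elim exE)
  then have s: "edge_sol q a (\<rho>\<^sup>2) s s'" "s 0 = 0" "s' 0 = 1" "s a = S" "s' a = S'"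
    using assms by simp_all
  obtain c c' where c: "edge_sol q a (\<rho>\<^sup>2) c c'" "c 0 = 1" "c' 0 = 0"
    using edge_sol_exists by blast
  have main: "y a = c a * y 0 + S * y' 0" "y' a = c' a * y 0 + S' * y' 0"
    if y: "edge_sol q a (\<rho>\<^sup>2) y y'" for y y'
  proof -
    note lin = edge_sol_linear[OF c(1) s(1), of "y 0" "y' 0"]
    have 0: "y 0 = y 0 * c 0 + y' 0 * s 0" "y' 0 = y 0 * c' 0 + y' 0 * s' 0"
      unfolding c s by simp_all
    have "a \<in> {0..a}" using a_pos by simp
    from edge_sol_unique[OF y lin 0 this] show "y a = c a * y 0 + S * y' 0" "y' a = c' a * y 0
        + S' * y' 0"
      unfolding s by (simp_all only: mult.commute)
  qed
  \<comment> \<open>The transfer formula for the reflected solution \<open>s (a - t)\<close>, which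
    starts with the data \<open>(S, - S')\<close> and ends with \<open>(0, -1)\<close>. Its first
    component yields only \<open>S * (C - S') = 0\<close>, enough to get \<open>C = S'\<close> when
    \<open>S\<close> is nonzero.\<close>
  have "s 0 = c a * s a - S * s' a" "- s' 0 = c' a * s a - S' * s' a"
    using main[OF edge_sol_reflect[OF s(1)]] by simp_all
  then have "S * (c a - S') = 0" "S'\<^sup>2 - S * c' a = 1"
    using s by (auto simp: algebra_simps power2_eq_square)
  then show ?thesis using main by blast
qed

lemma edge_sol_deriv_0:
  assumes "S_end q a \<rho> \<noteq> 0" "edge_sol q a (\<rho>\<^sup>2) y y'"
  shows "y' 0 = (y a - S'_end q a \<rho> * y 0) / S_end q a \<rho>"
proof -
  obtain C D where "S_end q a \<rho> * (C - S'_end q a \<rho>) = 0"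
    "y a = C * y 0 + S_end q a \<rho> * y' 0"
    using monodromy[OF refl refl, of \<rho>] assms(2) by blast
  then show ?thesis using assms(1) by (simp add: field_simps)
qed

lemma edge_sol_dirichlet:
  assumes "S_end q a \<rho> \<noteq> 0"
  shows "\<exists>y y'. edge_sol q a (\<rho>\<^sup>2) y y' \<and> y 0 = u \<and> y a = v"
proof -
  obtain y y' where y: "edge_sol q a (\<rho>\<^sup>2) y y'" "y 0 = u"
    "y' 0 = (v - S'_end q a \<rho> * u) / S_end q a \<rho>"
    using edge_sol_exists by blast
  have "y a = v" using edge_sol_deriv_0[OF assms y(1)] y(2,3) assms by (simp add: field_simps)
  then show ?thesis using y by blast
qed

lemma edge_sol_dirichlet_unique:
  assumes "S_end q a \<rho> \<noteq> 0" "edge_sol q a (\<rho>\<^sup>2) y y'" "edge_sol q a (\<rho>\<^sup>2) z z'"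
    "y 0 = z 0" "y a = z a" "t \<in> {0..a}"
  shows "y t = z t"
proof (rule edge_sol_unique(1)[OF assms(2,3,4) _ assms(6)])
  show "y' 0 = z' 0"
    unfolding edge_sol_deriv_0[OF assms(1,2)] edge_sol_deriv_0[OF assms(1,3)] assms(4,5) ..
qed

lemma S_end_zero: "S_end q a \<rho> = 0 \<Longrightarrow> (S'_end q a \<rho>)\<^sup>2 = 1"
  using monodromy[OF refl refl, of \<rho>] by auto

lemma edge_sol_vector_derivative:
  assumes "edge_sol q a lam y y'" 
  shows "vector_derivative y (at 0 within {0..a}) = y' 0"
  using edge_solD(1)[OF assms] a_pos by (intro vector_derivative_within_closed_interval) auto

end

section \<open>Periodic graphs with edges of minimal length\<close>

text \<open>Equality case of the triangle inequality, from the parallelogram law.\<close>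

lemma parallel_if_norm_add:
  fixes e f :: "'a :: real_inner"
  assumes "norm e = norm f" "norm (e + f) = 2 * norm e"
  shows "e = f"
proof -
  have "(norm (e - f))\<^sup>2 = 2 * (norm e)\<^sup>2 + 2 * (norm f)\<^sup>2 - (norm (e + f))\<^sup>2"
    unfolding power2_norm_eq_inner by (simp add: algebra_simps inner_commute)
  also have "\<dots> = 0" using assms by (simp add: power2_eq_square)
  finally show ?thesis by simp
qed

text \<open>Opposite sides of a convex quadrilateral are together shorter than its diagonals. Planarity of
  the tilings is thus a consequence of the minimal distance of their vertices.\<close>

lemma unit_segments_meet:
  fixes v w v' w' :: "'a :: real_inner"
  assumes a: "a > 0" and d: "dist v w = a" "dist v' w' = a"
    and sep: "\<And>x y. x \<in> {v, w} \<Longrightarrow> y \<in> {v', w'} \<Longrightarrow> x \<noteq> y \<Longrightarrow> a \<le> dist x y"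
    and s: "0 \<le> s" "s \<le> 1" "0 \<le> s'" "s' \<le> 1"
    and eq: "v + s *\<^sub>R (w - v) = v' + s' *\<^sub>R (w' - v')"
  shows "v = v' \<and> w = w' \<and> s = s' \<or> v = w' \<and> w = v' \<and> s = 1 - s' \<or>
    s \<in> {0, 1} \<and> s' \<in> {0, 1}"
proof -
  define x where "x = v + s *\<^sub>R (w - v)"
  have x': "x = v' + s' *\<^sub>R (w' - v')" using eq by (simp add: x_def)
  have nrm: "norm (w - v) = a" "norm (w' - v') = a"
    using d by (simp_all add: dist_norm norm_minus_commute)
  have xv: "v - x = s *\<^sub>R (v - w)" "w - x = (1 - s) *\<^sub>R (w - v)"
    by (simp_all add: x_def algebra_simps)
  have xv': "x - v' = s' *\<^sub>R (w' - v')" "x - w' = (1 - s') *\<^sub>R (v' - w')"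
    by (simp_all add: x' algebra_simps)
  have nx: "norm (v - x) = s * a" "norm (w - x) = (1 - s) * a"
    "norm (x - v') = s' * a" "norm (x - w') = (1 - s') * a"
    unfolding xv xv' using nrm s by (simp_all add: norm_minus_commute)
  have tri: "dist y z \<le> norm (y - x) + norm (x - z)" for y z
    using dist_triangle[of y z x] by (simp add: dist_norm)
  \<comment> \<open>If an endpoint is shared, the meeting point has the same distance from it along
    both segments. Unless this distance is zero, the directions agree as well.\<close>
  consider "v = v'" | "w = w'" | "v = w'" | "w = v'" | "v \<noteq> v'" "w \<noteq> w'" "v \<noteq> w'" "w \<noteq> v'"
    by blast
  then show ?thesis
  proof cases
    case 1
    then have e: "s *\<^sub>R (w - v) = s' *\<^sub>R (w' - v')" using eq by simp
    from arg_cong[OF e, of norm] have "s = s'" using nrm a s by simp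
    then show ?thesis using e 1 by auto
  next
    case 2
    then have e: "(1 - s) *\<^sub>R (w - v) = (1 - s') *\<^sub>R (w' - v')" using eq by
        (simp add: algebra_simps)
    from arg_cong[OF e, of norm] have "s = s'" using nrm a s by simp
    then show ?thesis using e 2 by auto
  next
    case 3
    then have e: "s *\<^sub>R (w - v) = (1 - s') *\<^sub>R (v' - w')" using eq by (simp add: algebra_simps)
    from arg_cong[OF e, of norm] have "s = 1 - s'" using nrm a s by (simp add: norm_minus_commute)
    then show ?thesis using e 3 by auto
  next
    case 4
    then have e: "(1 - s) *\<^sub>R (v - w) = s' *\<^sub>R (w' - v')" using eq by (simp add: algebra_simps)
    from arg_cong[OF e, of norm] have "1 - s = s'" using nrm a s by (simp add: norm_minus_commute)
    then show ?thesis using e 4 by auto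
  next
    case 5
    \<comment> \<open>Each of the four distances between endpoints is at least \<open>a\<close> and
      at most the detour through \<open>x\<close>. This forces \<open>s = s' = 1 / 2\<close> and
      equality in the triangle inequality, so \<open>x\<close> is the midpoint of \<open>v\<close>
      and \<open>v'\<close>. It is also the midpoint of \<open>v\<close> and \<open>w\<close>,
      whence \<open>w = v'\<close>, a contradiction.\<close>
    have le: "a \<le> s * a + s' * a" "a \<le> (1 - s) * a + (1 - s') * a"
      "a \<le> s * a + (1 - s') * a" "a \<le> (1 - s) * a + s' * a"
      using sep[of v v'] sep[of w w'] sep[of v w'] sep[of w v'] 5
        tri[of v v'] tri[of w w'] tri[of v w'] tri[of w v'] nx by force+
    have "a * 1 \<le> a * (s + s')" "a * 1 \<le> a * (2 - s - s')"
      "a * 1 \<le> a * (1 + s - s')" "a * 1 \<le> a * (1 - s + s')"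
      using le by (simp_all add: algebra_simps)
    then have "1 \<le> s + s'" "1 \<le> 2 - s - s'" "1 \<le> 1 + s - s'" "1 \<le> 1 - s + s'"
      using a by (simp_all only: mult_le_cancel_left_pos)
    then have s2: "s = 1 / 2" "s' = 1 / 2" by linarith+
    have "dist v v' \<le> a" using tri[of v v'] unfolding nx s2 by simp
    moreover have "a \<le> dist v v'" using sep[of v v'] 5 by simp
    ultimately have vv: "norm (v - v') = a" by (simp add: dist_norm)
    have "v - x = x - v'"
    proof (rule parallel_if_norm_add)
      have "v - x + (x - v') = v - v'" by simp
      then have "norm (v - x + (x - v')) = a" using vv by (rule ssubst)
      also have "a = 2 * norm (v - x)" unfolding nx s2 by simp
      finally show "norm (v - x + (x - v')) = 2 * norm (v - x)" .
      show "norm (v - x) = norm (x - v')" unfolding nx s2 ..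
    qed
    moreover have "v - x = x - w"
    proof -
      have "v - x = (1 / 2) *\<^sub>R (v - w)" unfolding xv(1) s2 ..
      also have "\<dots> = - ((1 - 1 / 2) *\<^sub>R (w - v))" by (simp add: algebra_simps)
      also have "(1 - 1 / 2) *\<^sub>R (w - v) = w - x" unfolding xv(2) s2 ..
      finally show ?thesis by simp
    qed
    ultimately have "x - v' = x - w" by simp
    then have "w = v'" by simp
    then show ?thesis using 5 by simp
  qed
qed

lemma edge_sol_cong:
  assumes "edge_sol q a lam y y'" "\<And>t. t \<in> {0..a} \<Longrightarrow> z t = y t" "a \<ge> 0"
  shows "edge_sol q a lam z y'"
  unfolding edge_sol_def
proof (intro conjI ballI)
  let ?p = "\<lambda>s. complex_of_real (q s) - lam"
  show "(z has_vector_derivative y' t) (at t within {0..a})" if t: "t \<in> {0..a}" for t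
  proof (rule has_vector_derivative_transform[OF t])
    show "(y has_vector_derivative y' t) (at t within {0..a})"
      using assms(1) t unfolding edge_sol_def by blast
  qed (rule assms(2))
  have "(\<lambda>s. ?p s * y s) integrable_on {0..a}"
    using assms(1) unfolding edge_sol_def by blast
  then show "(\<lambda>s. ?p s * z s) integrable_on {0..a}"
    by (rule integrable_eq) (simp add: assms(2))
  show "y' t = y' 0 + integral {0..t} (\<lambda>s. ?p s * z s)" if t: "t \<in> {0..a}" for t
  proof -
    have "y' t = y' 0 + integral {0..t} (\<lambda>s. ?p s * y s)"
      using assms(1) t unfolding edge_sol_def by blast
    also have "integral {0..t} (\<lambda>s. ?p s * y s) = integral {0..t} (\<lambda>s. ?p s * z s)"
      using assms(2) t by (intro integral_cong) simp
    finally show ?thesis .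
  qed
qed

text \<open>A pair \<open>(j, r)\<close> in \<open>nb i\<close> stands for the edge from base vertex
  \<open>i\<close> to the copy of \<open>j\<close> in the cell displaced by the period with
  coefficients \<open>r\<close>. No edge joins two translates of one vertex, so comparing indices
  selects one orientation of each edge.\<close>

locale tiling = even_potential q a
  for q :: "real \<Rightarrow> real" and a :: real +
  fixes V0 :: "(real \<times> real) list" and k1 k2 :: "real \<times> real"
    and nb :: "nat \<Rightarrow> (nat \<times> int \<times> int) list" and \<theta>1 \<theta>2 :: real
  assumes V0_ne: "V0 \<noteq> []"
    and nb_lt: "\<And>i j r. i < length V0 \<Longrightarrow> (j, r) \<in> set (nb i) \<Longrightarrow> j < length V0 \<and> j \<noteq> i"
    and nb_distinct: "\<And>i. i < length V0 \<Longrightarrow> distinct (nb i)"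
    and nb_ne: "\<And>i. i < length V0 \<Longrightarrow> nb i \<noteq> []"
    and nb_dist: "\<And>i j r. i < length V0 \<Longrightarrow> (j, r) \<in> set (nb i) \<Longrightarrow>
      dist (V0 ! i) (V0 ! j + (of_int (fst r) *\<^sub>R k1 + of_int (snd r) *\<^sub>R k2)) = a"
    and far: "\<And>i j r. i < length V0 \<Longrightarrow> j < length V0 \<Longrightarrow> (j, r) \<noteq> (i, 0) \<Longrightarrow> (j, r) \<notin> set (nb i) \<Longrightarrow>
      dist (V0 ! i) (V0 ! j + (of_int (fst r) *\<^sub>R k1 + of_int (snd r) *\<^sub>R k2)) > a"
begin

abbreviation "V \<equiv> periodic_vertices V0 k1 k2"

definition tr :: "int \<times> int \<Rightarrow> real \<times> real" where
  "tr r = of_int (fst r) *\<^sub>R k1 + of_int (snd r) *\<^sub>R k2"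

definition vt :: "nat \<Rightarrow> int \<times> int \<Rightarrow> real \<times> real" where
  "vt i r = V0 ! i + tr r"

definition ph :: "int \<times> int \<Rightarrow> complex" where
  "ph r = cis (of_int (fst r) * \<theta>1 + of_int (snd r) * \<theta>2)"

lemma tr_add: "tr (r + s) = tr r + tr s"
  and tr_diff: "tr (r - s) = tr r - tr s"
  and tr_0 [simp]: "tr 0 = 0"
  by (simp_all add: tr_def algebra_simps)

lemma ph_add: "ph (r + s) = ph r * ph s"
  by (simp add: ph_def cis_mult algebra_simps)

lemma ph_0 [simp]: "ph 0 = 1"
  by (simp add: ph_def)

lemma ph_minus: "ph r * ph (- r) = 1"
  by (simp flip: ph_add)

lemma ph_nonzero [simp]: "ph r \<noteq> 0"
  by (simp add: ph_def)

lemma vt_0 [simp]: "vt i 0 = V0 ! i"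
  by (simp add: vt_def)

lemma V_eq: "V = {vt i r | i r. i < length V0}"
proof -
  have "V \<subseteq> {vt i r | i r. i < length V0}"
  proof
    fix x assume "x \<in> V"
    then obtain v t where "x = v + t" "v \<in> set V0" "t \<in> Defs.lattice k1 k2"
      unfolding periodic_vertices_def by blast
    moreover from this obtain p1 p2 where "t = tr (p1, p2)"
      unfolding Defs.lattice_def tr_def fst_conv snd_conv by blast
    ultimately show "x \<in> {vt i r | i r. i < length V0}"
      unfolding vt_def in_set_conv_nth by blast
  qed
  moreover have "vt i r \<in> V" if "i < length V0" for i r
    unfolding periodic_vertices_def Defs.lattice_def vt_def tr_def using nth_mem[OF that] by blast
  ultimately show ?thesis by blast
qed

lemma vt_in_V [intro]: "i < length V0 \<Longrightarrow> vt i r \<in> V"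
  unfolding V_eq by blast

lemma dist_vt: "dist (vt i r) (vt j s) = dist (V0 ! i) (V0 ! j + tr (s - r))"
  by (simp add: vt_def dist_norm tr_diff algebra_simps)

lemma dist_vt_cases:
  assumes "i < length V0" "j < length V0"
  shows "i = j \<and> r = s \<or> (j, s - r) \<in> set (nb i) \<and> dist (vt i r) (vt j s) = a \<or>
    a < dist (vt i r) (vt j s)"
  unfolding dist_vt using far[OF assms, of "s - r"] nb_dist[OF assms(1), of j "s - r"]
  unfolding tr_def[symmetric] by (metis Pair_inject eq_iff_diff_eq_0)

lemma vtD: "x \<in> V \<Longrightarrow> \<exists>i r. i < length V0 \<and> x = vt i r"
  unfolding V_eq by blast

lemma dist_vt_ge: "x \<in> V \<Longrightarrow> y \<in> V \<Longrightarrow> x \<noteq> y \<Longrightarrow> a \<le> dist x y"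
  using vtD dist_vt_cases by (metis less_imp_le order_refl)

text \<open>Different index pairs lie at distance at least \<open>a > 0\<close>, since they are
  either listed neighbours or \<open>far\<close>.\<close>

lemma vt_inject:
  assumes "i < length V0" "j < length V0" "vt i r = vt j s"
  shows "i = j" "r = s"
  using dist_vt_cases[OF assms(1,2), of r s] assms(3) a_pos by auto

lemma edge_iff:
  assumes "i < length V0" "j < length V0"
  shows "(vt i r, vt j s) \<in> tiling_edges a V \<longleftrightarrow> (j, s - r) \<in> set (nb i)"
proof -
  have "dist (vt i r) (vt j s) = a \<longleftrightarrow> (j, s - r) \<in> set (nb i)"
    using dist_vt_cases[OF assms, of r s] nb_dist[OF assms(1), of j "s - r"] a_pos
    unfolding tr_def[symmetric] dist_vt[symmetric] by auto
  then show ?thesis using assms unfolding tiling_edges_def by auto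
qed

lemma edgeE:
  assumes "(v, w) \<in> tiling_edges a V"
  obtains i j r s where "i < length V0" "j < length V0" "(j, s) \<in> set (nb i)" "v = vt i r" "w
      = vt j (r + s)"
proof -
  obtain i r j s' where *: "i < length V0" "j < length V0" "v = vt i r" "w = vt j s'"
    using assms vtD unfolding tiling_edges_def by blast
  then show thesis
    using that[of i j "s' - r" r] edge_iff[of i j r s'] assms by simp
qed

text \<open>The neighbour lists inherit symmetry from the distance, because they describe exactly
  the pairs at distance \<open>a\<close>.\<close>

lemma nb_rev:
  assumes "i < length V0" "(j, s) \<in> set (nb i)"
  shows "(i, - s) \<in> set (nb j)"
proof -
  have j: "j < length V0" using nb_lt[OF assms] by simp
  have "(vt i 0, vt j s) \<in> tiling_edges a V" using edge_iff[of i j 0 s] assms j by simp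
  then have "(vt j s, vt i 0) \<in> tiling_edges a V" unfolding tiling_edges_def
      by (auto simp: dist_commute)
  then show ?thesis using edge_iff[of j i s 0] assms j by simp
qed

lemma out_edges:
  assumes "i < length V0"
  shows "{w. (vt i r, w) \<in> tiling_edges a V} = (\<lambda>(j, s). vt j (r + s)) ` set (nb i)"
proof (intro equalityI subsetI)
  fix w assume "w \<in> {w. (vt i r, w) \<in> tiling_edges a V}"
  then have w: "(vt i r, w) \<in> tiling_edges a V" by simp
  then obtain j s where "j < length V0" "w = vt j s" using vtD unfolding tiling_edges_def by blast
  then show "w \<in> (\<lambda>(j, s). vt j (r + s)) ` set (nb i)"
    using w edge_iff[OF assms, of j r s] by (auto intro!: image_eqI[of _ _ "(j, s - r)"])
next
  fix w assume "w \<in> (\<lambda>(j, s). vt j (r + s)) ` set (nb i)"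
  then obtain j s where "(j, s) \<in> set (nb i)" "w = vt j (r + s)" by auto
  then show "w \<in> {w. (vt i r, w) \<in> tiling_edges a V}"
    using edge_iff[OF assms, of j r "r + s"] nb_lt[OF assms, of j s] by simp
qed

lemma sum_out_edges:
  assumes "i < length V0"
  shows "(\<Sum>w\<in>{w. (vt i r, w) \<in> tiling_edges a V}. F w) = (\<Sum>(j, s)\<leftarrow>nb i. F (vt j (r + s)))"
proof -
  have "inj_on (\<lambda>(j, s). vt j (r + s)) (set (nb i))"
  proof (rule inj_onI, clarify)
    fix j s j' s' assume js: "(j, s) \<in> set (nb i)" "(j', s') \<in> set (nb i)"
      and eq: "vt j (r + s) = vt j' (r + s')"
    have "j < length V0" "j' < length V0" using nb_lt[OF assms] js by blast+
    from vt_inject[OF this eq] show "j = j' \<and> s = s'" by simp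
  qed
  then show ?thesis
    unfolding out_edges[OF assms]
    by (simp add: sum.reindex sum_list_distinct_conv_sum_set nb_distinct[OF assms] split_def o_def)
qed

lemma metric_graphE:
  assumes "x \<in> metric_graph a V"
  obtains i j r s t where "i < length V0" "(j, s) \<in> set (nb i)" "t \<in> {0..a}"
    "x = vt i r + (t / a) *\<^sub>R (vt j (r + s) - vt i r)"
proof -
  obtain v w where vw: "(v, w) \<in> tiling_edges a V" "x \<in> closed_segment v w"
    using assms unfolding metric_graph_def by auto
  obtain u where u: "0 \<le> u" "u \<le> 1" "x = (1 - u) *\<^sub>R v + u *\<^sub>R w"
    using vw(2) unfolding in_segment by auto
  obtain i j r s where ij: "i < length V0" "(j, s) \<in> set (nb i)" "v = vt i r" "w = vt j (r + s)"
    using edgeE[OF vw(1)] by metis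
  show thesis
    using u a_pos ij by (intro that[of i j s "u * a" r]) (auto simp: algebra_simps mult_le_one mult_left_le_one_le)
qed

lemma in_metric_graph:
  assumes "i < length V0" "(j, s) \<in> set (nb i)" "t \<in> {0..a}"
  shows "vt i r + (t / a) *\<^sub>R (vt j (r + s) - vt i r) \<in> metric_graph a V"
proof -
  have e: "(vt i r, vt j (r + s)) \<in> tiling_edges a V"
    using edge_iff[of i j r "r + s"] nb_lt assms by auto
  have "vt i r + (t / a) *\<^sub>R (vt j (r + s) - vt i r) \<in> closed_segment (vt i r) (vt j (r + s))"
    unfolding in_segment using assms(3) a_pos
    by (intro exI[of _ "t / a"]) (auto simp: algebra_simps)
  then show ?thesis unfolding metric_graph_def using e by blast
qed

lemma vt_in_metric_graph:
  assumes "i < length V0"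
  shows "vt i r \<in> metric_graph a V"
proof -
  obtain j s where "(j, s) \<in> set (nb i)" using nb_ne[OF assms] by (cases "nb i") auto
  from in_metric_graph[OF assms this, of 0 r] show ?thesis using a_pos by simp
qed

end

text \<open>Gaussian elimination, one equation and one unknown at a time.\<close>

lemma underdetermined_system:
  fixes A :: "'i \<Rightarrow> 'j \<Rightarrow> 'k :: field"
  assumes "finite I" "finite J" "card I < card J"
  shows "\<exists>x. (\<exists>j\<in>J. x j \<noteq> 0) \<and> (\<forall>i\<in>I. (\<Sum>j\<in>J. A i j * x j) = 0)"
  using assms
proof (induction I arbitrary: J A rule: finite_induct)
  case empty
  then obtain j where "j \<in> J" by fastforce
  then show ?case by (intro exI[of _ "\<lambda>_. 1"]) auto
next
  case (insert i I)
  show ?case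
  proof (cases "\<forall>j\<in>J. A i j = 0")
    case True
    have "card I < card J" using insert by simp
    from insert.IH[OF insert.prems(1) this, of A] obtain x where
      "\<exists>j\<in>J. x j \<noteq> 0" "\<forall>i\<in>I. (\<Sum>j\<in>J. A i j * x j) = 0" by blast
    then show ?thesis using True by (intro exI[of _ x]) simp
  next
    case False
    then obtain k where k: "k \<in> J" "A i k \<noteq> 0" by blast
    \<comment> \<open>Row \<open>i\<close> with pivot \<open>k\<close> is used to eliminate the
      unknown \<open>k\<close>; the value \<open>c\<close> below is what equation \<open>i\<close>
      prescribes for it.\<close>
    define B where "B i' j = A i' j - A i' k * A i j / A i k" for i' j
    have "card I < card (J - {k})" using insert k by simp
    from insert.IH[OF _ this, of B] insert.prems obtain x where
      x: "\<exists>j\<in>J - {k}. x j \<noteq> 0" "\<forall>i\<in>I. (\<Sum>j\<in>J - {k}. B i j * x j) = 0" by auto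
    define c where "c = - (\<Sum>j\<in>J - {k}. A i j * x j) / A i k"
    define y where "y j = (if j = k then c else x j)" for j
    have S: "(\<Sum>j\<in>J. A i' j * y j) = A i' k * c + (\<Sum>j\<in>J - {k}. A i' j * x j)" for i'
      using k insert.prems by (simp add: sum.remove[of J k] y_def)
    have "(\<Sum>j\<in>J. A i' j * y j) = 0" if "i' \<in> insert i I" for i'
    proof (cases "i' = i")
      case True
      then show ?thesis unfolding S using k by (simp add: c_def)
    next
      case False
      have "(\<Sum>j\<in>J - {k}. B i' j * x j)
          = (\<Sum>j\<in>J - {k}. A i' j * x j) - (\<Sum>j\<in>J - {k}. A i' k / A i k * (A i j * x j))"
        unfolding sum_subtractf[symmetric] B_def by (intro sum.cong) (simp_all add: algebra_simps)
      also have "\<dots> = (\<Sum>j\<in>J - {k}. A i' j * x j) + A i' k * c"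
        unfolding sum_distrib_left[symmetric] c_def by simp
      finally show ?thesis unfolding S using x(2) False that by (simp add: add.commute)
    qed
    moreover have "\<exists>j\<in>J. y j \<noteq> 0" using x(1) by (auto simp: y_def)
    ultimately show ?thesis by blast
  qed
qed

lemma sum_list_affine:
  fixes c e :: "'a :: comm_ring_1"
  shows "(\<Sum>x\<leftarrow>xs. c * (g x + e)) = c * ((\<Sum>x\<leftarrow>xs. g x) + of_nat (length xs) * e)"
  by (induction xs) (simp_all add: algebra_simps)

lemma sum_list_sum_swap:
  "(\<Sum>x\<leftarrow>xs. \<Sum>k\<in>J. g x k) = (\<Sum>k\<in>J. \<Sum>x\<leftarrow>xs. g x k :: 'a :: comm_monoid_add)"
  by (induction xs) (simp_all add: sum.distrib)

section \<open>Bloch eigenfunctions and the discrete eigenvalue problem\<close>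

context tiling
begin

text \<open>A relation rather than a function: a point of the plane has one description for each
  orientation of its edge, and a vertex one for each incident edge and orientation.\<close>

definition Rep :: "(nat \<Rightarrow> nat \<times> int \<times> int \<Rightarrow> real \<Rightarrow> complex) \<Rightarrow> real \<times> real \<Rightarrow> complex \<Rightarrow> bool" where
  "Rep Y x c \<longleftrightarrow> (\<exists>i j r s t. i < length V0 \<and> (j, s) \<in> set (nb i) \<and> t \<in> {0..a} \<and>
     x = vt i r + (t / a) *\<^sub>R (vt j (r + s) - vt i r) \<and> c = ph r * Y i (j, s) t)"

text \<open>The three alternatives of \<open>unit_segments_meet\<close> are the same oriented edge,
  the reversed edge and a common vertex. They are settled by injectivity of the indexing, by
  \<open>rev\<close> and by \<open>Y0\<close>, respectively.\<close>

lemma Rep_unique: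
  assumes rev: "\<And>i j s t. i < length V0 \<Longrightarrow> (j, s) \<in> set (nb i) \<Longrightarrow> t \<in> {0..a} \<Longrightarrow>
      Y i (j, s) t = ph s * Y j (i, - s) (a - t)"
    and Y0: "\<And>i d. i < length V0 \<Longrightarrow> d \<in> set (nb i) \<Longrightarrow> Y i d 0 = u i"
    and c: "Rep Y x c" "Rep Y x c'"
  shows "c = c'"
proof -
  \<comment> \<open>At an end of an edge the value depends on the vertex alone. The far end
    \<open>t = a\<close> is the near end of the reversed edge.\<close>
  have end_val: "\<exists>k p. k < length V0 \<and> vt i r + (t / a) *\<^sub>R (vt j (r + s) - vt i r) = vt k p \<and>
      ph r * Y i (j, s) t = ph p * u k"
    if i: "i < length V0" and js: "(j, s) \<in> set (nb i)" and t: "t = 0 \<or> t = a" for i j r s t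
    using t
  proof
    assume "t = 0"
    then show ?thesis using i Y0[OF i js] by (intro exI[of _ i] exI[of _ r]) simp
  next
    assume t: "t = a"
    have j: "j < length V0" using nb_lt[OF i js] by simp
    have "Y i (j, s) a = ph s * Y j (i, - s) 0" using rev[OF i js, of a] a_pos by simp
    also have "\<dots> = ph s * u j" using Y0[OF j nb_rev[OF i js]] by simp
    finally show ?thesis using j t a_pos by (intro exI[of _ j] exI[of _ "r + s"]) (simp add: ph_add)
  qed
  obtain i j r s t where 1: "i < length V0" "(j, s) \<in> set (nb i)" "t \<in> {0..a}"
    "x = vt i r + (t / a) *\<^sub>R (vt j (r + s) - vt i r)" "c = ph r * Y i (j, s) t"
    using c(1) unfolding Rep_def by blast
  obtain i' j' r' s' t' where 2: "i' < length V0" "(j', s') \<in> set (nb i')" "t' \<in> {0..a}"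
    "x = vt i' r' + (t' / a) *\<^sub>R (vt j' (r' + s') - vt i' r')" "c' = ph r' * Y i' (j', s') t'"
    using c(2) unfolding Rep_def by blast
  have j: "j < length V0" and j': "j' < length V0" using nb_lt 1 2 by blast+
  have d: "dist (vt i r) (vt j (r + s)) = a" "dist (vt i' r') (vt j' (r' + s')) = a"
    using edge_iff[OF 1(1) j, of r "r + s"] edge_iff[OF 2(1) j', of r' "r' + s'"] 1(2) 2(2)
    unfolding tiling_edges_def by auto
  have sep: "a \<le> dist y z" if "y \<in> {vt i r, vt j (r + s)}" "z \<in> {vt i' r', vt j' (r'
      + s')}" "y \<noteq> z" for y z
    using that 1(1) 2(1) j j' by (intro dist_vt_ge) auto
  have tt: "0 \<le> t / a" "t / a \<le> 1" "0 \<le> t' / a" "t' / a \<le> 1" using 1(3) 2(3) a_pos by auto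
  consider "vt i r = vt i' r'" "vt j (r + s) = vt j' (r' + s')" "t / a = t' / a"
    | "vt i r = vt j' (r' + s')" "vt j (r + s) = vt i' r'" "t / a = 1 - t' / a"
    | "t / a \<in> {0, 1}" "t' / a \<in> {0, 1}"
    using unit_segments_meet[OF a_pos d sep tt] 1(4) 2(4) by blast
  then show ?thesis
  proof cases
    case 1
    then have "i = i'" "r = r'" "j = j'" "r + s = r' + s'" "t = t'"
      using vt_inject \<open>i < length V0\<close> \<open>i' < length V0\<close> j j' a_pos by (blast, blast, blast, blast,
          simp)
    then show ?thesis using \<open>c = _\<close> \<open>c' = _\<close> by simp
  next
    case 2
    then have eq: "i = j'" "r = r' + s'" "j = i'" "r + s = r'"
      using vt_inject \<open>i < length V0\<close> \<open>i' < length V0\<close> j j' by blast+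
    have s: "s = - s'" using eq(2,4) by (simp add: prod_eq_iff)
    have t: "a - t = t'" using 2(3) a_pos by (simp add: field_simps)
    have "c = ph r * (ph s * Y j (i, - s) (a - t))"
      using rev[OF \<open>i < length V0\<close> \<open>(j, s) \<in> _\<close> \<open>t \<in> _\<close>] \<open>c = _\<close> by simp
    also have "\<dots> = ph (r + s) * Y j (i, - s) (a - t)" by (simp add: ph_add)
    also have "\<dots> = c'" unfolding eq(4) t unfolding eq(1,3) s using \<open>c' = _\<close> by simp
    finally show ?thesis .
  next
    case 3
    then have t0: "t = 0 \<or> t = a" "t' = 0 \<or> t' = a" using a_pos by auto
    obtain k p where k: "k < length V0" "x = vt k p" "c = ph p * u k"
      using end_val[OF \<open>i < length V0\<close> \<open>(j, s) \<in> _\<close> t0(1), of r] \<open>c = _\<close>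
        \<open>x = vt i r + _\<close> by auto
    obtain k' p' where k': "k' < length V0" "x = vt k' p'" "c' = ph p' * u k'"
      using end_val[OF \<open>i' < length V0\<close> \<open>(j', s') \<in> _\<close> t0(2), of r'] \<open>c' = _\<close>
        \<open>x = vt i' r' + _\<close> by auto
    show ?thesis using vt_inject[OF k(1) k'(1), of p p'] k k' by simp
  qed
qed

text \<open>Gluing: finitely many functions on the edges leaving the base vertices extend to the
  plane by the Bloch phases. Here \<open>rev\<close> expresses that the two orientations of an edge
  carry the same function, and \<open>Y0\<close> that the edge functions agree at vertices.\<close>

lemma bloch_eigenvalueI:
  assumes rev: "\<And>i j s t. i < length V0 \<Longrightarrow> (j, s) \<in> set (nb i) \<Longrightarrow> t \<in> {0..a} \<Longrightarrow>
      Y i (j, s) t = ph s * Y j (i, - s) (a - t)"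
    and Y0: "\<And>i d. i < length V0 \<Longrightarrow> d \<in> set (nb i) \<Longrightarrow> Y i d 0 = u i"
    and sol: "\<And>i d. i < length V0 \<Longrightarrow> d \<in> set (nb i) \<Longrightarrow> edge_sol q a lam (Y i d) (Y' i d)"
    and kirchhoff: "\<And>i. i < length V0 \<Longrightarrow> (\<Sum>d\<leftarrow>nb i. Y' i d 0) = 0"
    and nz: "i0 < length V0" "d0 \<in> set (nb i0)" "t0 \<in> {0..a}" "Y i0 d0 t0 \<noteq> 0"
  shows "bloch_eigenvalue a q V k1 k2 \<theta>1 \<theta>2 lam"
proof -
  \<comment> \<open>Off the metric graph the value is arbitrary; all conditions on \<open>f\<close>
    concern points of the graph.\<close>
  define f where "f x = (THE c. Rep Y x c)" for x
  have f: "f x = c" if "Rep Y x c" for x c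
    unfolding f_def
  proof (rule the_equality)
    show "Rep Y x c" by (fact that)
    show "c' = c" if "Rep Y x c'" for c'
      using Rep_unique[of Y u, OF rev Y0 that \<open>Rep Y x c\<close>] .
  qed
  have Rep_tr: "Rep Y (x + tr p) (ph p * c)" if Rep: "Rep Y x c" for x c p
  proof -
    obtain i j r s t where *: "i < length V0" "(j, s) \<in> set (nb i)" "t \<in> {0..a}"
      "x = vt i r + (t / a) *\<^sub>R (vt j (r + s) - vt i r)" "c = ph r * Y i (j, s) t"
      using Rep unfolding Rep_def by blast
    have "x + tr p = vt i (r + p) + (t / a) *\<^sub>R (vt j (r + p + s) - vt i (r + p))"
      unfolding *(4) by (simp add: vt_def tr_add algebra_simps)
    moreover have "ph p * c = ph (r + p) * Y i (j, s) t" by (simp add: *(5) ph_add)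
    ultimately show ?thesis unfolding Rep_def using *(1-3) by blast
  qed
  have edge: "edge_sol q a lam (edge_fun a (vt i r) (vt j (r + s)) f) (\<lambda>t. ph r * Y' i (j, s) t)"
    if i: "i < length V0" and js: "(j, s) \<in> set (nb i)" for i j r s
  proof (rule edge_sol_cong)
    show "edge_sol q a lam (\<lambda>t. ph r * Y i (j, s) t) (\<lambda>t. ph r * Y' i (j, s) t)"
      using edge_sol_linear[OF sol[OF i js] sol[OF i js], of "ph r" 0] by simp
    show "edge_fun a (vt i r) (vt j (r + s)) f t = ph r * Y i (j, s) t" if "t \<in> {0..a}" for t
      unfolding edge_fun_def using i js that by (intro f) (unfold Rep_def, blast)
  qed (use a_pos in simp)
  show ?thesis
    unfolding bloch_eigenvalue_def
  proof (intro exI[of _ f] conjI allI ballI)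
    fix p1 p2 :: int and x assume "x \<in> metric_graph a V"
    then obtain c where c: "Rep Y x c"
      by (elim metric_graphE) (unfold Rep_def, blast)
    show "f (x + of_int p1 *\<^sub>R k1 + of_int p2 *\<^sub>R k2) = cis (of_int p1 * \<theta>1 + of_int p2 * \<theta>2) * f x"
      using f[OF Rep_tr[OF c, of "(p1, p2)"]] f[OF c] by (simp add: tr_def ph_def add.assoc)
  next
    fix e assume e: "e \<in> tiling_edges a V"
    obtain v w where vw: "e = (v, w)" by (cases e)
    have "\<exists>y'. edge_sol q a lam (edge_fun a v w f) y'"
    proof (rule edgeE[OF e[unfolded vw]])
      fix i j r s assume *: "i < length V0" "(j, s) \<in> set (nb i)" "v = vt i r" "w = vt j (r + s)"
      show ?thesis using edge[OF *(1,2), of r] unfolding *(3,4) by blast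
    qed
    then show "case e of (v, w) \<Rightarrow> \<exists>y'. edge_sol q a lam (edge_fun a v w f) y'"
      unfolding vw by simp
  next
    fix v assume "v \<in> V"
    then obtain i r where i: "i < length V0" "v = vt i r" using vtD by blast
    have "(\<Sum>w\<in>{w. (v,
        w) \<in> tiling_edges a V}. vector_derivative (edge_fun a v w f) (at 0 within {0..a}))
        = (\<Sum>(j, s)\<leftarrow>nb i. vector_derivative (edge_fun a v (vt j (r + s)) f) (at 0 within {0..a}))"
      unfolding i(2) by (rule sum_out_edges[OF i(1)])
    also have "\<dots> = (\<Sum>d\<leftarrow>nb i. ph r * Y' i d 0)"
    proof (intro arg_cong[of _ _ sum_list] map_cong refl, clarify)
      fix j s1 s2 assume js: "(j, s1, s2) \<in> set (nb i)"
      show "vector_derivative (edge_fun a v (vt j (r + (s1, s2))) f) (at 0 within {0..a})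
          = ph r * Y' i (j, s1, s2) 0"
        unfolding i(2) by (rule edge_sol_vector_derivative[OF edge[OF i(1) js]])
    qed
    also have "\<dots> = 0" using kirchhoff[OF i(1)] by (simp add: sum_list_const_mult)
    finally show "(\<Sum>w\<in>{w. (v, w) \<in> tiling_edges a V}.
        vector_derivative (edge_fun a v w f) (at 0 within {0..a})) = 0" .
  next
    obtain j s where d0: "d0 = (j, s)" by (cases d0)
    let ?x = "vt i0 0 + (t0 / a) *\<^sub>R (vt j (0 + s) - vt i0 0)"
    have "Rep Y ?x (ph 0 * Y i0 (j, s) t0)"
      unfolding Rep_def using nz(1-3) unfolding d0 by blast
    then have "f ?x \<noteq> 0" using f nz(4) unfolding d0 by fastforce
    then show "\<exists>x\<in>metric_graph a V. f x \<noteq> 0"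
      using in_metric_graph[OF nz(1) nz(2)[unfolded d0] nz(3), of 0] by blast
  qed
qed

definition kernel :: "complex \<Rightarrow> bool" where
  "kernel z \<longleftrightarrow> (\<exists>u. (\<exists>i<length V0. u i \<noteq> 0) \<and>
     (\<forall>i<length V0. (\<Sum>(j, s)\<leftarrow>nb i. ph s * u j) = of_nat (length (nb i)) * z * u i))"

lemma kernel_imp_bloch_eigenvalue:
  assumes S: "S_end q a \<rho> \<noteq> 0" and ker: "kernel (S'_end q a \<rho>)"
  shows "bloch_eigenvalue a q V k1 k2 \<theta>1 \<theta>2 (\<rho>\<^sup>2)"
proof -
  obtain u i0 where u: "i0 < length V0" "u i0 \<noteq> 0"
    "\<And>i. i < length V0 \<Longrightarrow> (\<Sum>(j, s)\<leftarrow>nb i. ph s * u j) = of_nat (length (nb i)) * S'_end q a \<rho> * u i"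
    using ker unfolding kernel_def by auto
  have "\<forall>x. \<exists>p. edge_sol q a (\<rho>\<^sup>2) (fst p) (snd p) \<and> fst p 0 = u (fst x) \<and>
      fst p a = ph (snd (snd x)) * u (fst (snd x))"
    using edge_sol_dirichlet[OF S] by simp
  then obtain F where F: "\<forall>x. edge_sol q a (\<rho>\<^sup>2) (fst (F x)) (snd (F x)) \<and>
      fst (F x) 0 = u (fst x) \<and> fst (F x) a = ph (snd (snd x)) * u (fst (snd x))"
    by (rule choice[THEN exE])
  define Z Z' where "Z i j s = fst (F (i, j, s))" and "Z' i j s = snd (F (i, j, s))" for i j s
  have Z: "edge_sol q a (\<rho>\<^sup>2) (Z i j s) (Z' i j s)" "Z i j s 0 = u i" "Z i j s a
      = ph s * u j" for i j s
    unfolding Z_def Z'_def using spec[OF F, of "(i, j, s)"] by simp_all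
  define Y where "Y i d = Z i (fst d) (snd d)" for i d
  define Y' where "Y' i d = Z' i (fst d) (snd d)" for i d
  obtain d0 where d0: "d0 \<in> set (nb i0)" using nb_ne[OF u(1)] by (cases "nb i0") auto
  show ?thesis
  proof (rule bloch_eigenvalueI[of Y u _ Y'])
    show "edge_sol q a (\<rho>\<^sup>2) (Y i d) (Y' i d)" for i d unfolding Y_def Y'_def by (rule Z(1))
    show "Y i d 0 = u i" for i d unfolding Y_def by (rule Z(2))
    show "i0 < length V0" "d0 \<in> set (nb i0)" by fact+
    show "0 \<in> {0..a}" using a_pos by simp
    show "Y i0 d0 0 \<noteq> 0" using u(2) by (simp add: Y_def Z(2))
    fix i assume i: "i < length V0"
    have "(\<Sum>d\<leftarrow>nb i. Y' i d 0)
        = (\<Sum>(j, s)\<leftarrow>nb i. (1 / S_end q a \<rho>) * (ph s * u j + (- S'_end q a \<rho> * u i)))"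
      unfolding Y'_def edge_sol_deriv_0[OF S Z(1)] Z(2,3)
      by (simp add: split_def diff_divide_distrib)
    also have "\<dots> = (1 / S_end q a \<rho>) * ((\<Sum>(j, s)\<leftarrow>nb i. ph s * u j) +
        of_nat (length (nb i)) * (- S'_end q a \<rho> * u i))"
      unfolding split_def by (rule sum_list_affine)
    also have "\<dots> = 0" unfolding u(3)[OF i] by simp
    finally show "(\<Sum>d\<leftarrow>nb i. Y' i d 0) = 0" .
  next
    fix i j s t assume t: "t \<in> {0..a}"
    \<comment> \<open>Both sides of the compatibility condition solve the same Dirichlet problem:
      the phases cancel by \<open>ph_minus\<close>, so the end values agree. The summand with factor
      0 turns closure under linear combinations into closure under scaling.\<close>
    have "edge_sol q a (\<rho>\<^sup>2) (\<lambda>t. ph s * Z j i (- s) (a - t) + 0 * Z j i (- s) (a - t))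
        (\<lambda>t. ph s * - Z' j i (- s) (a - t) + 0 * - Z' j i (- s) (a - t))"
      by (rule edge_sol_linear[OF edge_sol_reflect[OF Z(1)] edge_sol_reflect[OF Z(1)]])
    from edge_sol_dirichlet_unique[OF S Z(1)[of i j s] this _ _ t]
    show "Y i (j, s) t = ph s * Y j (i, - s) (a - t)"
      using ph_minus[of s] by (simp add: Y_def Z(2,3) flip: mult.assoc)
  qed
qed

lemma bloch_eigenvalue_imp_kernel:
  assumes S: "S_end q a \<rho> \<noteq> 0" and ev: "bloch_eigenvalue a q V k1 k2 \<theta>1 \<theta>2 (\<rho>\<^sup>2)"
  shows "kernel (S'_end q a \<rho>)"
proof -
  obtain f where bloch: "\<forall>p1 p2 :: int. \<forall>x\<in>metric_graph a V.
          f (x + real_of_int p1 *\<^sub>R k1 + real_of_int p2 *\<^sub>R k2)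
            = cis (real_of_int p1 * \<theta>1 + real_of_int p2 * \<theta>2) * f x"
    and sol: "\<forall>(v, w)\<in>tiling_edges a V. \<exists>y'. edge_sol q a (\<rho>\<^sup>2) (edge_fun a v w f) y'"
    and kirchhoff: "\<forall>v\<in>V. (\<Sum>w\<in>{w. (v, w) \<in> tiling_edges a V}.
                 vector_derivative (edge_fun a v w f) (at 0 within {0..a})) = 0"
    and nz: "\<exists>x\<in>metric_graph a V. f x \<noteq> 0"
    using ev unfolding bloch_eigenvalue_def by blast
  define u where "u i = f (vt i 0)" for i
  have f_vt: "f (vt i r) = ph r * u i" if "i < length V0" for i r
    using bspec[OF spec[OF spec[OF bloch, of "fst r"], of "snd r"] vt_in_metric_graph[OF that,
        of 0]]
    by (simp add: vt_def tr_def ph_def u_def add.assoc)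
  have ef: "edge_fun a v w f 0 = f v" "edge_fun a v w f a = f w" for v w
    using a_pos by (simp_all add: edge_fun_def)
  have e_sol: "\<exists>y'. edge_sol q a (\<rho>\<^sup>2) (edge_fun a (vt i r) (vt j (r + s)) f) y'"
    if "i < length V0" "(j, s) \<in> set (nb i)" for i j r s
  proof -
    have "(vt i r, vt j (r + s)) \<in> tiling_edges a V"
      using edge_iff[of i j r "r + s"] nb_lt[OF that] that by simp
    then show ?thesis using sol by blast
  qed
  \<comment> \<open>For \<open>S\<close> nonzero an edge function that vanishes at both ends
    vanishes identically, so a nonzero Bloch function has a nonzero vertex value.\<close>
  have "\<exists>i<length V0. u i \<noteq> 0"
  proof (rule ccontr)
    assume "\<not> (\<exists>i<length V0. u i \<noteq> 0)"
    then have u0: "u i = 0" if "i < length V0" for i using that by blast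
    obtain x where x: "x \<in> metric_graph a V" "f x \<noteq> 0" using nz by blast
    show False
    proof (rule metric_graphE[OF x(1)])
      fix i j r s t assume *: "i < length V0" "(j, s) \<in> set (nb i)" and t: "t \<in> {0..a}"
        and xt: "x = vt i r + (t / a) *\<^sub>R (vt j (r + s) - vt i r)"
      let ?y = "edge_fun a (vt i r) (vt j (r + s)) f"
      have j: "j < length V0" using nb_lt[OF *] by simp
      have 0: "?y 0 = 0" "?y a = 0"
        unfolding ef f_vt[OF *(1)] f_vt[OF j] u0[OF *(1)] u0[OF j] by simp_all
      obtain y' where y': "edge_sol q a (\<rho>\<^sup>2) ?y y'" using e_sol[OF *] by blast
      have "y' 0 = 0" using edge_sol_deriv_0[OF S y'] 0 by simp
      from edge_sol_zero(1)[OF y' 0(1) this t] show False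
        using x(2) xt by (simp add: edge_fun_def)
    qed
  qed
  moreover have "(\<Sum>(j, s)\<leftarrow>nb i. ph s * u j) = of_nat (length (nb i)) * S'_end q a \<rho> * u i"
    if i: "i < length V0" for i
  proof -
    have "0 = (\<Sum>w\<in>{w. (vt i 0, w) \<in> tiling_edges a V}.
        vector_derivative (edge_fun a (vt i 0) w f) (at 0 within {0..a}))"
      using bspec[OF kirchhoff vt_in_V[OF i, of 0]] by simp
    also have "\<dots> = (\<Sum>(j, s)\<leftarrow>nb i.
        vector_derivative (edge_fun a (vt i 0) (vt j (0 + s)) f) (at 0 within {0..a}))"
      by (rule sum_out_edges[OF i])
    also have "\<dots> = (\<Sum>(j, s)\<leftarrow>nb i. (1 / S_end q a \<rho>) * (ph s * u j + (- S'_end q a \<rho> * u i)))"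
    proof (intro arg_cong[of _ _ sum_list] map_cong refl, clarify)
      fix j s1 s2 assume js: "(j, s1, s2) \<in> set (nb i)"
      let ?s = "(s1, s2)"
      let ?y = "edge_fun a (vt i 0) (vt j (0 + ?s)) f"
      have j: "j < length V0" using nb_lt[OF i js] by simp
      obtain y' where y': "edge_sol q a (\<rho>\<^sup>2) ?y y'" using e_sol[OF i js, of 0] by blast
      have "vector_derivative ?y (at 0 within {0..a}) = y' 0"
        by (rule edge_sol_vector_derivative[OF y'])
      also have "\<dots> = (1 / S_end q a \<rho>) * (ph ?s * u j + (- S'_end q a \<rho> * u i))"
        unfolding edge_sol_deriv_0[OF S y'] ef f_vt[OF i] f_vt[OF j] by simp
      finally show "vector_derivative ?y (at 0 within {0..a}) = \<dots>" .
    qed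
    also have "\<dots> = (1 / S_end q a \<rho>) * ((\<Sum>(j, s)\<leftarrow>nb i. ph s * u j) +
        of_nat (length (nb i)) * (- S'_end q a \<rho> * u i))"
      unfolding split_def by (rule sum_list_affine)
    finally show ?thesis using S by simp
  qed
  ultimately show ?thesis unfolding kernel_def by blast
qed

text \<open>If \<open>S = 0\<close> there are eigenfunctions vanishing at all vertices: a multiple of \<open>S(x)\<close> on every
  edge, subject to one Kirchhoff condition per vertex, and there are more edges than vertices.\<close>

lemma S_end_zero_imp_bloch_eigenvalue:
  assumes S: "S_end q a \<rho> = 0"
    and many: "length V0 < card {(i, d). i < length V0 \<and> d \<in> set (nb i) \<and> i < fst d}"
  shows "bloch_eigenvalue a q V k1 k2 \<theta>1 \<theta>2 (\<rho>\<^sup>2)"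
proof -
  let ?S' = "S'_end q a \<rho>"
  have S2: "?S' * ?S' = 1" using S_end_zero[OF S] by (simp add: power2_eq_square)
  define J where "J = {(i, d). i < length V0 \<and> d \<in> set (nb i) \<and> i < fst d}"
  have "J \<subseteq> Sigma {..<length V0} (\<lambda>i. set (nb i))" unfolding J_def by auto
  then have finJ: "finite J" by (rule finite_subset) auto
  \<comment> \<open>The unknowns sit on the edges directed to the larger index. In the reversed
    direction the factor is \<open>- S' * ph\<close>, since \<open>y (a - t) = - S' * y t\<close>
    for the sine-type solution; both orientations are consistent because
    \<open>S'\<^sup>2 = 1\<close>.\<close>
  define b where "b x i d = (if i < fst d then x (i, d)
      else - ?S' * ph (snd d) * x (fst d, i, - snd d))" for x
          :: "nat \<times> nat \<times> int \<times> int \<Rightarrow> complex" and i d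
  define e where "e j k = (if k = j then 1 else (0 :: complex))" for j k :: "nat \<times> nat \<times> int \<times> int"
  \<comment> \<open>The matrix of the Kirchhoff conditions: \<open>b\<close> is linear in
    \<open>x\<close>, so its columns are read off at the unit vectors \<open>e k\<close>.\<close>
  define A where "A i k = (\<Sum>d\<leftarrow>nb i. b (e k) i d)" for i k
  have b_sum: "b x i d = (\<Sum>k\<in>J. b (e k) i d * x k)" if "i < length V0" "d \<in> set (nb i)" for x i d
  proof -
    obtain j s where d: "d = (j, s)" by (cases d)
    have j: "j < length V0" "j \<noteq> i" using nb_lt that unfolding d by blast+
    have rev: "(i, - s) \<in> set (nb j)" using nb_rev that unfolding d by blast
    show ?thesis
    proof (cases "i < j")
      case True
      then have "(i, d) \<in> J" using that by (simp add: J_def d)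
      then have "x (i, d) = (\<Sum>k\<in>J. if (i, d) = k then x k else 0)" using finJ by simp
      also have "\<dots> = (\<Sum>k\<in>J. e k (i, d) * x k)" by (intro sum.cong) (auto simp: e_def)
      finally show ?thesis using True by (simp add: b_def d)
    next
      case False
      then have "(j, i, - s) \<in> J" using j rev by (simp add: J_def)
      then have "x (j, i, - s) = (\<Sum>k\<in>J. if (j, i, - s) = k then x k else 0)" using finJ by simp
      also have "\<dots> = (\<Sum>k\<in>J. e k (j, i, - s) * x k)" by (intro sum.cong) (auto simp: e_def)
      finally show ?thesis using False by (simp add: b_def d sum_distrib_left mult.assoc)
    qed
  qed
  have "card {..<length V0} < card J" using many by (simp add: J_def)
  from underdetermined_system[OF _ finJ this, of A] obtain x where
    x: "\<exists>k\<in>J. x k \<noteq> 0" "\<forall>i\<in>{..<length V0}. (\<Sum>k\<in>J. A i k * x k) = 0" by blast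
  have kirchhoff: "(\<Sum>d\<leftarrow>nb i. b x i d) = 0" if i: "i < length V0" for i
  proof -
    have "(\<Sum>d\<leftarrow>nb i. b x i d) = (\<Sum>d\<leftarrow>nb i. \<Sum>k\<in>J. b (e k) i d * x k)"
      using b_sum[OF i] by (intro arg_cong[of _ _ sum_list] map_cong) auto
    also have "\<dots> = (\<Sum>k\<in>J. \<Sum>d\<leftarrow>nb i. b (e k) i d * x k)"
      by (rule sum_list_sum_swap)
    also have "\<dots> = (\<Sum>k\<in>J. A i k * x k)" by (simp add: A_def sum_list_mult_const)
    finally show ?thesis using x(2) i by simp
  qed
  from S_end_sol[of \<rho>] obtain y y' where y: "edge_sol q a (\<rho>\<^sup>2) y y'" "y 0 = 0" "y' 0 = 1"
    "y a = 0" "y' a = ?S'" unfolding S by blast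
  have refl: "y (a - t) = - ?S' * y t" if t: "t \<in> {0..a}" for t
  proof -
    have "edge_sol q a (\<rho>\<^sup>2) (\<lambda>t. - ?S' * y t + 0 * y t) (\<lambda>t. - ?S' * y' t + 0 * y' t)"
      by (rule edge_sol_linear[OF y(1) y(1)])
    from edge_sol_unique(1)[OF edge_sol_reflect[OF y(1)] this _ _ t] y show ?thesis by simp
  qed
  obtain i0 d0 where d0: "(i0, d0) \<in> J" "x (i0, d0) \<noteq> 0" using x(1) by auto
  have "\<exists>t\<in>{0..a}. y t \<noteq> 0"
  proof (rule ccontr)
    assume "\<not> (\<exists>t\<in>{0..a}. y t \<noteq> 0)"
    then have "edge_sol q a (\<rho>\<^sup>2) (\<lambda>_. 0) y'"
      using a_pos by (intro edge_sol_cong[OF y(1)]) auto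
    then have "vector_derivative (\<lambda>_. 0) (at 0 within {0..a}) = y' 0"
      by (rule edge_sol_vector_derivative)
    \<comment> \<open>The zero function once more, now as a multiple of \<open>y\<close> with
      derivative 0; this clashes with \<open>y' 0 = 1\<close>.\<close>
    moreover have "vector_derivative (\<lambda>t. 0 * y t + 0 * y t) (at 0 within {0..a}) = 0 * y' 0
        + 0 * y' 0"
      by (rule edge_sol_vector_derivative[OF edge_sol_linear[OF y(1) y(1)]])
    ultimately show False using y(3) by simp
  qed
  then obtain t0 where t0: "t0 \<in> {0..a}" "y t0 \<noteq> 0" by blast
  define Y where "Y i d t = b x i d * y t" for i d t
  define Y' where "Y' i d t = b x i d * y' t" for i d t
  show ?thesis
  proof (rule bloch_eigenvalueI[of Y "\<lambda>_. 0" _ Y'])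
    show "edge_sol q a (\<rho>\<^sup>2) (Y i d) (Y' i d)" for i d
      using edge_sol_linear[OF y(1) y(1), of "b x i d" 0] unfolding Y_def Y'_def by simp
    show "Y i d 0 = 0" for i d by (simp add: Y_def y(2))
    show "(\<Sum>d\<leftarrow>nb i. Y' i d 0) = 0" if "i < length V0" for i
      using kirchhoff[OF that] by (simp add: Y'_def y(3))
    show "i0 < length V0" "d0 \<in> set (nb i0)" "t0 \<in> {0..a}" using d0 t0 by (auto simp: J_def)
    show "Y i0 d0 t0 \<noteq> 0" using d0 t0 by (auto simp: Y_def b_def J_def)
    fix i j s t assume i: "i < length V0" "(j, s) \<in> set (nb i)" and t: "t \<in> {0..a}"
    have ne: "j \<noteq> i" using nb_lt[OF i] by simp
    have "?S' * ph s * (?S' * ph (- s)) = (?S' * ?S') * (ph s * ph (- s))" by (simp only: mult_ac)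
    then have "?S' * ph s * (?S' * ph (- s)) = 1" unfolding S2 ph_minus by simp
    then have "b x i (j, s) = - ?S' * ph s * b x j (i, - s)"
      using ne by (cases "i < j") (simp_all add: b_def flip: mult.assoc)
    then show "Y i (j, s) t = ph s * Y j (i, - s) (a - t)"
      unfolding Y_def refl[OF t] by simp
  qed
qed

end

section \<open>Distances in integer arithmetic\<close>

text \<open>For edges of length 1 all vertices and periods have coordinates of the form \<open>(m + n \<surd>3) / 4\<close> with
  integers \<open>m\<close> and \<open>n\<close>, so that all distances can be compared in integer arithmetic.\<close>

type_synonym quad = "int \<times> int \<times> int \<times> int"

definition emb :: "quad \<Rightarrow> real \<times> real" where
  "emb = (\<lambda>(x0, x1, y0, y1).
     ((of_int x0 + of_int x1 * sqrt 3) / 4, (of_int y0 + of_int y1 * sqrt 3) / 4))"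

text \<open>Together with \<open>irr_part\<close>, the coefficients of 16 times the squared norm
  with respect to 1 and \<open>sqrt 3\<close>.\<close>

definition rat_part :: "quad \<Rightarrow> int" where
  "rat_part = (\<lambda>(x0, x1, y0, y1). x0 * x0 + 3 * (x1 * x1) + y0 * y0 + 3 * (y1 * y1))"

definition irr_part :: "quad \<Rightarrow> int" where
  "irr_part = (\<lambda>(x0, x1, y0, y1). 2 * (x0 * x1 + y0 * y1))"

text \<open>Decides \<open>D + B * sqrt 3 > 0\<close>: if the signs of \<open>D\<close> and
  \<open>B\<close> differ, the squares tell which term dominates.\<close>

definition surd_pos :: "int \<Rightarrow> int \<Rightarrow> bool" where
  "surd_pos D B \<longleftrightarrow> 0 < D \<and> 0 \<le> B \<or> 0 < D \<and> 3 * (B * B) < D * D \<or> 0 < B \<and> D * D < 3 * (B * B)"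

fun comb :: "int \<Rightarrow> quad \<Rightarrow> int \<Rightarrow> quad \<Rightarrow> quad \<Rightarrow> quad \<Rightarrow> quad" where
  "comb r (x0, x1, y0, y1) s (x0', x1', y0', y1') (v0, v1, v2, v3) (w0, w1, w2, w3) =
     (w0 - v0 + r * x0 + s * x0', w1 - v1 + r * x1 + s * x1',
      w2 - v2 + r * y0 + s * y0', w3 - v3 + r * y1 + s * y1')"

fun cross_rat :: "quad \<Rightarrow> quad \<Rightarrow> int" where
  "cross_rat (x0, x1, y0, y1) (x0', x1', y0', y1') = x0 * y0' + 3 * (x1 * y1') - y0 * x0'
      - 3 * (y1 * x1')"

fun cross_irr :: "quad \<Rightarrow> quad \<Rightarrow> int" where
  "cross_irr (x0, x1, y0, y1) (x0', x1', y0', y1') = x0 * y1' + x1 * y0' - y0 * x1' - y1 * x0'"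

definition cross :: "real \<times> real \<Rightarrow> real \<times> real \<Rightarrow> real" where
  "cross u v = fst u * snd v - snd u * fst v"

text \<open>\<open>period_bound R u v\<close> states \<open>(2 R + 1) |v| < 2 |u \<times> v|\<close>.\<close>

definition period_bound :: "int \<Rightarrow> quad \<Rightarrow> quad \<Rightarrow> bool" where
  "period_bound R u v \<longleftrightarrow> surd_pos
     (4 * (cross_rat u v * cross_rat u v + 3 * (cross_irr u v * cross_irr u v))
        - 16 * ((2 * R + 1) * (2 * R + 1)) * rat_part v)
     (8 * (cross_rat u v * cross_irr u v) - 16 * ((2 * R + 1) * (2 * R + 1)) * irr_part v)"

text \<open>The constant 16 is the scaled squared edge length: listed neighbours are at distance
  exactly 1, all other pairs of distinct vertices farther apart.\<close>

definition pair_ok ::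
  "quad list \<Rightarrow> quad \<Rightarrow> quad \<Rightarrow> (nat \<Rightarrow> (nat \<times> int \<times> int) list) \<Rightarrow> nat \<Rightarrow> nat \<Rightarrow> int \<Rightarrow> int \<Rightarrow> bool" where
  "pair_ok ps \<kappa>1 \<kappa>2 nb i j r s \<longleftrightarrow> (j, r, s) = (i, 0, 0) \<or>
     (let v = comb r \<kappa>1 s \<kappa>2 (ps ! i) (ps ! j) in
       if (j, r, s) \<in> set (nb i) then rat_part v = 16 \<and> irr_part v = 0
       else surd_pos (rat_part v - 16) (irr_part v))"

text \<open>A finite certificate. If all base vertices lie within distance \<open>R\<close> of the
  origin, two vertices at distance at most 1 differ by a period of norm at most
  \<open>2 * R + 1\<close>, and \<open>period_bound\<close> confines its coefficients to -1, 0 and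
  1. The last conjunct is the surplus of edges over vertices. Quantifiers range over lists so that
  the certificate can be evaluated.\<close>

definition tiling_data_ok ::
  "int \<Rightarrow> quad list \<Rightarrow> quad \<Rightarrow> quad \<Rightarrow> (nat \<Rightarrow> (nat \<times> int \<times> int) list) \<Rightarrow> bool" where
  "tiling_data_ok R ps \<kappa>1 \<kappa>2 nb \<longleftrightarrow>
     0 \<le> R \<and> ps \<noteq> [] \<and> period_bound R \<kappa>1 \<kappa>2 \<and> period_bound R \<kappa>2 \<kappa>1 \<and>
     (\<forall>p\<in>set ps. surd_pos (16 * (R * R) - rat_part p) (- irr_part p) \<or>
        rat_part p = 16 * (R * R) \<and> irr_part p = 0) \<and>
     (\<forall>i\<in>set [0..<length ps]. distinct (nb i) \<and> nb i \<noteq> [] \<and>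
       (\<forall>(j, r, s)\<in>set (nb i). j < length ps \<and> j \<noteq> i \<and> r \<in> set [-1, 0, 1] \<and> s \<in> set [-1, 0, 1])) \<and>
     (\<forall>i\<in>set [0..<length ps]. \<forall>j\<in>set [0..<length ps]. \<forall>r\<in>set [-1, 0, 1]. \<forall>s\<in>set [-1, 0, 1].
       pair_ok ps \<kappa>1 \<kappa>2 nb i j r s) \<and>
     length ps < (\<Sum>i\<leftarrow>[0..<length ps]. length (filter (\<lambda>d. i < fst d) (nb i)))"

section \<open>Soundness of the integer certificate\<close>

lemma surd_pos:
  assumes "surd_pos D B"
  shows "0 < of_int D + of_int B * sqrt 3"
proof -
  have sq: "(of_int B * sqrt 3)\<^sup>2 = (of_int (3 * (B * B)) :: real)"
    by (simp add: power2_eq_square algebra_simps)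
  have sqD: "(of_int D)\<^sup>2 = (of_int (D * D) :: real)" by (simp add: power2_eq_square)
  consider "0 < D" "0 \<le> B" | "0 < D" "3 * (B * B) < D * D" | "0 < B" "D * D < 3 * (B * B)"
    using assms unfolding surd_pos_def by blast
  then show ?thesis
  proof cases
    case 1
    then show ?thesis by (simp add: add_pos_nonneg)
  next
    case 2
    have "(of_int B * sqrt 3)\<^sup>2 < (of_int D :: real)\<^sup>2" unfolding sq sqD using 2(2) by
        (simp only: of_int_less_iff)
    then have "\<bar>of_int B * sqrt 3\<bar> < (of_int D :: real)"
      using abs_le_square_iff[of "of_int D" "of_int B * sqrt 3"] 2(1) by linarith
    then show ?thesis by linarith
  next
    case 3
    have "(of_int D)\<^sup>2 < (of_int B * sqrt 3 :: real)\<^sup>2" unfolding sq sqD using 3(2) by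
        (simp only: of_int_less_iff)
    then have "\<bar>of_int D\<bar> < \<bar>of_int B * sqrt 3 :: real\<bar>"
      using abs_le_square_iff[of "of_int B * sqrt 3" "of_int D"] by linarith
    moreover have "0 \<le> of_int B * sqrt 3" using 3(1) by simp
    ultimately show ?thesis by linarith
  qed
qed

lemma norm_emb_sq: "16 * (norm (emb v))\<^sup>2 = of_int (rat_part v) + of_int (irr_part v) * sqrt 3"
proof -
  obtain x0 x1 y0 y1 where v: "v = (x0, x1, y0, y1)" by (cases v) auto
  have "(norm (emb v))\<^sup>2 = (fst (emb v))\<^sup>2 + (snd (emb v))\<^sup>2" by (simp add: norm_prod_def)
  moreover have "sqrt 3 * sqrt 3 = (3 :: real)" by simp
  ultimately show ?thesis
    unfolding v emb_def rat_part_def irr_part_def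
    by (simp add: power2_eq_square field_simps)
qed

lemma cross_emb: "16 * cross (emb u) (emb v) = of_int (cross_rat u v)
    + of_int (cross_irr u v) * sqrt 3"
proof -
  obtain x0 x1 y0 y1 where u: "u = (x0, x1, y0, y1)" by (cases u) auto
  obtain x0' x1' y0' y1' where v: "v = (x0', x1', y0', y1')" by (cases v) auto
  have "sqrt 3 * sqrt 3 = (3 :: real)" by simp
  then show ?thesis
    unfolding u v emb_def cross_def by (simp add: field_simps)
qed

lemma emb_comb:
  "emb (comb r u s u' v w) = emb w - emb v + (of_int r *\<^sub>R emb u + of_int s *\<^sub>R emb u')"
  by (cases u; cases u'; cases v; cases w) (simp add: emb_def field_simps)

text \<open>Lagrange's identity: the squares differ by the square of the inner product.\<close>

lemma cross_le: "\<bar>cross u v\<bar> \<le> norm u * norm v"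
proof -
  have "(cross u v)\<^sup>2 \<le> (norm u * norm v)\<^sup>2"
  proof -
    have "(norm u * norm v)\<^sup>2 - (cross u v)\<^sup>2 = (fst u * fst v + snd u * snd v)\<^sup>2"
      unfolding power_mult_distrib norm_prod_def cross_def
      by (simp add: algebra_simps power2_eq_square)
    also have "\<dots> \<ge> 0" by simp
    finally show ?thesis by simp
  qed
  then show ?thesis by (simp add: abs_le_square_iff[symmetric])
qed

lemma period_bound:
  assumes "period_bound R u v" "0 \<le> R"
  shows "(2 * of_int R + 1) * norm (emb v) < 2 * \<bar>cross (emb u) (emb v)\<bar>"
proof -
  let ?c = "cross (emb u) (emb v)" and ?s = "sqrt 3 :: real"
  have s3: "?s * ?s = 3" by simp
  \<comment> \<open>The squared inequality multiplied by 256, which clears the denominator 16 of the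
    cross product and of the squared norm.\<close>
  have "0 < 4 * ((16 * ?c) * (16 * ?c)) - 16 * ((2 * of_int R + 1) * (2 * of_int R
      + 1)) * (16 * (norm (emb v))\<^sup>2)"
    unfolding norm_emb_sq cross_emb
    using surd_pos[OF assms(1)[unfolded period_bound_def]] s3 by (simp add: algebra_simps)
  then have "((2 * of_int R + 1) * norm (emb v))\<^sup>2 < (2 * \<bar>?c\<bar>)\<^sup>2"
    by (simp add: power_mult_distrib power2_eq_square algebra_simps)
  then show ?thesis by (rule power2_less_imp_less) simp
qed

text \<open>Cramer's rule: the cross product with \<open>emb v\<close> isolates the coefficient
  \<open>r\<close>, and \<open>period_bound\<close> makes its absolute value less than 2.\<close>

lemma period_small:
  assumes "period_bound R u v" "0 \<le> R" "norm (of_int r *\<^sub>R emb u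
      + of_int s *\<^sub>R emb v) \<le> 2 * of_int R + 1"
  shows "\<bar>r\<bar> \<le> 1"
proof -
  let ?e = "of_int r *\<^sub>R emb u + of_int s *\<^sub>R emb v"
  have "cross ?e (emb v) = of_int r * cross (emb u) (emb v)"
    by (simp add: cross_def algebra_simps)
  then have "\<bar>of_int r\<bar> * \<bar>cross (emb u) (emb v)\<bar> \<le> norm ?e * norm (emb v)"
    using cross_le[of ?e "emb v"] by (simp add: abs_mult)
  also have "\<dots> \<le> (2 * of_int R + 1) * norm (emb v)"
    using assms(3) by (rule mult_right_mono) simp
  also have "\<dots> < 2 * \<bar>cross (emb u) (emb v)\<bar>"
    using period_bound[OF assms(1,2)] .
  finally have "\<bar>of_int r :: real\<bar> < 2"
    by (meson abs_ge_zero mult_less_cancel_right not_less_iff_gr_or_eq order.strict_trans1)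
  then show ?thesis by linarith
qed

lemma tiling_data_okD:
  fixes a :: real
  assumes ok: "tiling_data_ok R ps \<kappa>1 \<kappa>2 nb" and a: "a > 0"
  defines "V0 \<equiv> map (\<lambda>p. a *\<^sub>R emb p) ps" and "k1 \<equiv> a *\<^sub>R emb \<kappa>1" and "k2 \<equiv> a *\<^sub>R emb \<kappa>2"
  assumes i: "i < length ps"
  shows "(j, r) \<in> set (nb i) \<Longrightarrow> j < length ps \<and> j \<noteq> i \<and> fst r \<in> {-1, 0, 1} \<and> snd r \<in> {-1, 0, 1}"
    and "distinct (nb i)" and "nb i \<noteq> []"
    and "(j, r) \<in> set (nb i) \<Longrightarrow>
      dist (V0 ! i) (V0 ! j + (of_int (fst r) *\<^sub>R k1 + of_int (snd r) *\<^sub>R k2)) = a"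
    and "j < length ps \<Longrightarrow> (j, r) \<noteq> (i, 0) \<Longrightarrow> (j, r) \<notin> set (nb i) \<Longrightarrow>
      dist (V0 ! i) (V0 ! j + (of_int (fst r) *\<^sub>R k1 + of_int (snd r) *\<^sub>R k2)) > a"
proof -
  have R: "0 \<le> R" and pb: "period_bound R \<kappa>1 \<kappa>2" "period_bound R \<kappa>2 \<kappa>1"
    using ok unfolding tiling_data_ok_def by blast+
  have "\<forall>i\<in>set [0..<length ps]. distinct (nb i) \<and> nb i \<noteq> [] \<and>
       (\<forall>(j, r, s)\<in>set (nb i). j < length ps \<and> j \<noteq> i \<and> r \<in> set [-1, 0, 1] \<and> s \<in> set [-1, 0, 1])"
    using ok unfolding tiling_data_ok_def by blast
  then have nb: "distinct (nb i) \<and> nb i \<noteq> [] \<and>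
       (\<forall>(j, r, s)\<in>set (nb i). j < length ps \<and> j \<noteq> i \<and> r \<in> set [-1, 0, 1] \<and> s \<in> set [-1, 0, 1])"
    using i by simp
  then show "distinct (nb i)" "nb i \<noteq> []" by simp_all
  show nb3: "j < length ps \<and> j \<noteq> i \<and> fst r \<in> {-1, 0, 1} \<and> snd r \<in> {-1, 0, 1}"
    if "(j, r) \<in> set (nb i)" for j r
    using nb that by (cases r) fastforce
  have "\<forall>i\<in>set [0..<length ps]. \<forall>j\<in>set [0..<length ps]. \<forall>r\<in>set [-1, 0, 1]. \<forall>s\<in>set [-1, 0, 1].
       pair_ok ps \<kappa>1 \<kappa>2 nb i j r s"
    using ok unfolding tiling_data_ok_def by blast
  then have grid: "pair_ok ps \<kappa>1 \<kappa>2 nb i j r s"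
    if "j < length ps" "r \<in> {-1, 0, 1}" "s \<in> {-1, 0, 1}" for j r s
    using i that by fastforce
  have norm_le: "norm (emb p) \<le> of_int R" if "p \<in> set ps" for p
  proof -
    have "surd_pos (16 * (R * R) - rat_part p) (- irr_part p) \<or> rat_part p = 16 * (R * R)
        \<and> irr_part p = 0"
      using ok that unfolding tiling_data_ok_def by blast
    then have "16 * (norm (emb p))\<^sup>2 \<le> 16 * (of_int R)\<^sup>2"
      unfolding norm_emb_sq using surd_pos[of "16 * (R * R) - rat_part p" "- irr_part p"]
      by (auto simp: power2_eq_square)
    then show ?thesis using R by (simp add: power2_le_iff_abs_le)
  qed
  have dist: "dist (V0 ! i) (V0 ! j + (of_int (fst r) *\<^sub>R k1 + of_int (snd r) *\<^sub>R k2)) =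
      a * norm (emb (comb (fst r) \<kappa>1 (snd r) \<kappa>2 (ps ! i) (ps ! j)))" if "j < length ps" for j r
  proof -
    have "V0 ! j + (of_int (fst r) *\<^sub>R k1 + of_int (snd r) *\<^sub>R k2) - V0 ! i
        = a *\<^sub>R emb (comb (fst r) \<kappa>1 (snd r) \<kappa>2 (ps ! i) (ps ! j))"
      unfolding emb_comb V0_def k1_def k2_def using i that by (simp add: algebra_simps)
    then show ?thesis unfolding dist_norm norm_minus_commute[of "V0 ! i"] using a by simp
  qed
  show "dist (V0 ! i) (V0 ! j + (of_int (fst r) *\<^sub>R k1 + of_int (snd r) *\<^sub>R k2)) = a"
    if jr: "(j, r) \<in> set (nb i)" for j r
  proof -
    let ?v = "comb (fst r) \<kappa>1 (snd r) \<kappa>2 (ps ! i) (ps ! j)"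
    have j: "j < length ps" and ji: "j \<noteq> i" using nb3[OF jr] by simp_all
    have "rat_part ?v = 16 \<and> irr_part ?v = 0"
      using grid[of j "fst r" "snd r"] nb3[OF jr] jr unfolding pair_ok_def by (simp add: Let_def)
    then have "norm (emb ?v) = 1" using norm_emb_sq[of ?v] norm_ge_zero[of "emb ?v"]
      by (simp add: power2_eq_1_iff del: norm_ge_zero)
    then show ?thesis using dist[OF j] by simp
  qed
  show "dist (V0 ! i) (V0 ! j + (of_int (fst r) *\<^sub>R k1 + of_int (snd r) *\<^sub>R k2)) > a"
    if j: "j < length ps" and ne: "(j, r) \<noteq> (i, 0)" "(j, r) \<notin> set (nb i)" for j r
  proof -
    let ?v = "comb (fst r) \<kappa>1 (snd r) \<kappa>2 (ps ! i) (ps ! j)"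
    have "1 < norm (emb ?v)"
    proof (rule ccontr)
      assume "\<not> 1 < norm (emb ?v)"
      then have le: "norm (emb ?v) \<le> 1" by simp
      let ?e = "of_int (fst r) *\<^sub>R emb \<kappa>1 + of_int (snd r) *\<^sub>R emb \<kappa>2"
      have "?e = emb ?v - emb (ps ! j) + emb (ps ! i)" unfolding emb_comb by simp
      then have "norm ?e \<le> norm (emb ?v - emb (ps ! j)) + norm (emb (ps ! i))"
        by (simp only: norm_triangle_ineq)
      also have "\<dots> \<le> norm (emb ?v) + norm (emb (ps ! j)) + norm (emb (ps ! i))"
        by (intro add_right_mono norm_triangle_ineq4)
      also have "\<dots> \<le> 2 * of_int R + 1"
        using le norm_le[OF nth_mem[OF i]] norm_le[OF nth_mem[OF j]] by linarith
      finally have e: "norm ?e \<le> 2 * of_int R + 1" .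
      have "\<bar>fst r\<bar> \<le> 1" using period_small[OF pb(1) R e] .
      moreover have "\<bar>snd r\<bar> \<le> 1"
        using period_small[OF pb(2) R, of "snd r" "fst r"] e by (simp add: add.commute)
      ultimately have "fst r \<in> {-1, 0, 1}" "snd r \<in> {-1, 0, 1}" by auto
      from grid[OF j this] have "surd_pos (rat_part ?v - 16) (irr_part ?v)"
        using ne unfolding pair_ok_def
            by (auto simp: Let_def zero_prod_def prod_eq_iff split: if_splits)
      from surd_pos[OF this] have "16 < 16 * (norm (emb ?v))\<^sup>2" unfolding norm_emb_sq by simp
      moreover have "(norm (emb ?v))\<^sup>2 \<le> 1" using le by (simp add: power_le_one)
      ultimately show False by simp
    qed
    then show ?thesis using dist[OF j] a by simp
  qed
qed

lemma card_edges_conv: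
  "card {(i, d). i < n \<and> d \<in> set (nb i) \<and> i < fst d}
      = (\<Sum>i\<leftarrow>[0..<n]. length (filter (\<lambda>d. i < fst d) (nb i)))"
  if "\<And>i. i < n \<Longrightarrow> distinct (nb i)" for nb :: "nat \<Rightarrow> (nat \<times> 'b) list"
proof -
  have "{(i, d). i < n \<and> d \<in> set (nb i) \<and> i < fst d}
      = (SIGMA i:{..<n}. set (filter (\<lambda>d. i < fst d) (nb i)))"
    by auto
  then have "card {(i, d). i < n \<and> d \<in> set (nb i) \<and> i < fst d}
      = (\<Sum>i<n. card (set (filter (\<lambda>d. i < fst d) (nb i))))" by simp
  also have "\<dots> = (\<Sum>i<n. length (filter (\<lambda>d. i < fst d) (nb i)))"
    by (intro sum.cong refl distinct_card distinct_filter that) simp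
  finally show ?thesis by (simp add: interv_sum_list_conv_sum_set_nat atLeast0LessThan)
qed

section \<open>Determinants of Floquet matrices\<close>

fun del :: "nat \<Rightarrow> 'a list \<Rightarrow> 'a list" where
  "del _ [] = []"
| "del 0 (x # xs) = xs"
| "del (Suc j) (x # xs) = x # del j xs"

lemma length_del: "j < length xs \<Longrightarrow> length (del j xs) = length xs - 1"
proof (induction j xs rule: del.induct)
  case (3 j x xs)
  then show ?case by (cases xs) auto
qed auto

lemma nth_del: "j < length xs \<Longrightarrow> k < length xs - 1 \<Longrightarrow> del j xs ! k
    = (if k < j then xs ! k else xs ! Suc k)"
proof (induction j xs arbitrary: k rule: del.induct)
  case (3 j x xs)
  then show ?case by (cases k) auto
qed auto

text \<open>Expansion along the first row, in a form that can be unfolded by rewriting when the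
  entries are symbolic.\<close>

fun ldet :: "'a :: comm_ring_1 list list \<Rightarrow> 'a" where
  "ldet [] = 1"
| "ldet (r # rs) = (\<Sum>j\<leftarrow>[0..<length r]. (-1) ^ j * r ! j * ldet (map (del j) rs))"

lemma det_eq_ldet:
  assumes "length M = n" "\<And>r. r \<in> set M \<Longrightarrow> length r = n"
  shows "det (Matrix.mat n n (\<lambda>(i, j). M ! i ! j)) = ldet M"
  using assms
proof (induction n arbitrary: M)
  case 0
  then show ?case by simp
next
  case (Suc n)
  then obtain r rs where M: "M = r # rs" by (cases M) auto
  let ?A = "Matrix.mat (Suc n) (Suc n) (\<lambda>(i, j). M ! i ! j)"
  have len: "length r = Suc n" "length rs = n" "\<And>r. r \<in> set rs \<Longrightarrow> length r = Suc n"
    using Suc.prems unfolding M by auto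
  have A: "?A \<in> carrier_mat (Suc n) (Suc n)" by simp
  have "det ?A = (\<Sum>j<Suc n. ?A $$ (0, j) * cofactor ?A 0 j)"
    by (rule laplace_expansion_row[OF A]) simp
  also have "\<dots> = (\<Sum>j<Suc n. (-1) ^ j * r ! j * ldet (map (del j) rs))"
  proof (rule sum.cong[OF refl])
    fix j assume "j \<in> {..<Suc n}"
    then have j: "j < Suc n" by simp
    have "mat_delete ?A 0 j = Matrix.mat n n (\<lambda>(i, k). map (del j) rs ! i ! k)"
      unfolding mat_delete_def using len j nth_mem
      by (intro eq_matI) (auto simp: M nth_del)
    moreover have "length r' = n" if "r' \<in> set (map (del j) rs)" for r'
      using that len(3) j by (auto simp: length_del)
    ultimately have "det (mat_delete ?A 0 j) = ldet (map (del j) rs)"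
      using Suc.IH[of "map (del j) rs"] len(2) by simp
    then show "?A $$ (0, j) * cofactor ?A 0 j = (-1) ^ j * r ! j * ldet (map (del j) rs)"
      using j by (simp add: cofactor_def M)
  qed
  also have "\<dots> = ldet M"
    unfolding M using len by (simp add: interv_sum_list_conv_sum_set_nat atLeast0LessThan del: upt_Suc)
  finally show ?case .
qed

lemma ldet_eq_0_iff:
  fixes M :: "'a :: field list list"
  assumes "length M = n" "\<And>r. r \<in> set M \<Longrightarrow> length r = n"
  shows "ldet M = 0 \<longleftrightarrow> (\<exists>u. (\<exists>i<n. u i \<noteq> 0) \<and> (\<forall>i<n. (\<Sum>j<n. M ! i ! j * u j) = 0))"
proof -
  let ?A = "Matrix.mat n n (\<lambda>(i, j). M ! i ! j)"
  have A: "?A \<in> carrier_mat n n" by simp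
  have mv: "?A *\<^sub>v v = 0\<^sub>v n \<longleftrightarrow> (\<forall>i<n. (\<Sum>j<n. M ! i ! j * v $ j) = 0)"
    if "v \<in> carrier_vec n" for v
    using that by (auto simp: vec_eq_iff scalar_prod_def atLeast0LessThan)
  have "ldet M = 0 \<longleftrightarrow> (\<exists>v. v \<in> carrier_vec n \<and> v \<noteq> 0\<^sub>v n \<and> ?A *\<^sub>v v = 0\<^sub>v n)"
    using det_0_iff_vec_prod_zero_field[OF A] det_eq_ldet[OF assms] by simp
  also have "\<dots> \<longleftrightarrow> (\<exists>u. (\<exists>i<n. u i \<noteq> 0) \<and> (\<forall>i<n. (\<Sum>j<n. M ! i ! j * u j) = 0))"
  proof
    assume "\<exists>v. v \<in> carrier_vec n \<and> v \<noteq> 0\<^sub>v n \<and> ?A *\<^sub>v v = 0\<^sub>v n"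
    then obtain v where v: "v \<in> carrier_vec n" "v \<noteq> 0\<^sub>v n" "?A *\<^sub>v v = 0\<^sub>v n" by blast
    then show "\<exists>u. (\<exists>i<n. u i \<noteq> 0) \<and> (\<forall>i<n. (\<Sum>j<n. M ! i ! j * u j) = 0)"
      using mv[OF v(1)] by (intro exI[of _ "\<lambda>i. v $ i"]) (auto simp: vec_eq_iff)
  next
    assume "\<exists>u. (\<exists>i<n. u i \<noteq> 0) \<and> (\<forall>i<n. (\<Sum>j<n. M ! i ! j * u j) = 0)"
    then obtain u i where u: "i < n" "u i \<noteq> 0" "\<forall>i<n. (\<Sum>j<n. M ! i ! j * u j) = 0" by blast
    let ?v = "Matrix.vec n u"
    have "?v \<in> carrier_vec n" by simp
    moreover have "?v \<noteq> 0\<^sub>v n" using u(1,2) by (auto simp: vec_eq_iff)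
    moreover have "?A *\<^sub>v ?v = 0\<^sub>v n" using u(3) mv[of ?v] by simp
    ultimately show "\<exists>v. v \<in> carrier_vec n \<and> v \<noteq> 0\<^sub>v n \<and> ?A *\<^sub>v v = 0\<^sub>v n" by blast
  qed
  finally show ?thesis .
qed

text \<open>Deletion indices are in successor form so that \<open>del.simps\<close> apply directly;
  a row is expanded without touching its entries.\<close>

lemma ldet_row:
  "ldet ([a0] # rs) = a0 * ldet (map (del 0) rs)"
  "ldet ([a0, a1] # rs) = a0 * ldet (map (del 0) rs) - a1 * ldet (map (del (Suc 0)) rs)"
  "ldet ([a0, a1, a2] # rs) = a0 * ldet (map (del 0) rs) - a1 * ldet (map (del (Suc 0)) rs)
      + a2 * ldet (map (del (Suc (Suc 0))) rs)"
  "ldet ([a0, a1, a2, a3] # rs) = a0 * ldet (map (del 0) rs) - a1 * ldet (map (del (Suc 0)) rs)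
      + a2 * ldet (map (del (Suc (Suc 0))) rs) - a3 * ldet (map (del (Suc (Suc (Suc 0)))) rs)"
  "ldet ([a0, a1, a2, a3, a4] # rs) = a0 * ldet (map (del 0) rs) - a1 * ldet (map (del (Suc 0)) rs)
      + a2 * ldet (map (del (Suc (Suc 0))) rs) - a3 * ldet (map (del (Suc (Suc (Suc 0)))) rs)
      + a4 * ldet (map (del (Suc (Suc (Suc (Suc 0))))) rs)"
  "ldet ([a0, a1, a2, a3, a4, a5] # rs) = a0 * ldet (map (del 0) rs)
      - a1 * ldet (map (del (Suc 0)) rs) + a2 * ldet (map (del (Suc (Suc 0))) rs)
      - a3 * ldet (map (del (Suc (Suc (Suc 0)))) rs)
      + a4 * ldet (map (del (Suc (Suc (Suc (Suc 0))))) rs)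
      - a5 * ldet (map (del (Suc (Suc (Suc (Suc (Suc 0)))))) rs)"
  by (simp_all add: eval_nat_numeral)

text \<open>\<open>nb i\<close> lists the neighbours of \<open>i\<close> together with the exponents of the Floquet multipliers \<open>z\<close>
  and \<open>w\<close>. Row \<open>i\<close> is multiplied by the monomial with exponents \<open>sh i\<close>, chosen such that all entries
  become polynomials.\<close>

definition floquet_matrix ::
  "nat \<Rightarrow> (nat \<Rightarrow> (nat \<times> int \<times> int) list) \<Rightarrow> (nat \<Rightarrow> nat \<times> nat) \<Rightarrow> 'a :: field \<Rightarrow> 'a \<Rightarrow> 'a \<Rightarrow> 'a list list"
      where
  "floquet_matrix n nb sh \<mu> z w = map (\<lambda>i. map (\<lambda>j.
     (\<Sum>(k, s)\<leftarrow>nb i. if k = j then z ^ nat (fst s + int (fst (sh i))) * w ^ nat (snd s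
         + int (snd (sh i))) else 0)
     - (if i = j then \<mu> * z ^ fst (sh i) * w ^ snd (sh i) else 0)) [0..<n]) [0..<n]"

text \<open>The row multipliers are nonzero monomials and leave the kernel unchanged; nonnegative
  shifted exponents keep \<open>nat\<close> from truncating. Several edges to translates of the same
  vertex add up in one matrix entry.\<close>

lemma floquet_matrix_iff:
  fixes z w :: "'a :: field"
  assumes zw: "z \<noteq> 0" "w \<noteq> 0"
    and nb: "\<And>i j s. i < n \<Longrightarrow> (j, s) \<in> set (nb i) \<Longrightarrow>
      j < n \<and> 0 \<le> fst s + int (fst (sh i)) \<and> 0 \<le> snd s + int (snd (sh i))"
  shows "(\<exists>u. (\<exists>i<n. u i \<noteq> 0) \<and>
      (\<forall>i<n. (\<Sum>(j, s)\<leftarrow>nb i. z powi fst s * w powi snd s * u j) = \<mu> * u i)) \<longleftrightarrow>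
    ldet (floquet_matrix n nb sh \<mu> z w) = 0"
proof -
  let ?M = "floquet_matrix n nb sh \<mu> z w"
  have row: "(\<Sum>j<n. ?M ! i ! j * u j) = z ^ fst (sh i) * w ^ snd (sh i) *
      ((\<Sum>(j, s)\<leftarrow>nb i. z powi fst s * w powi snd s * u j) - \<mu> * u i)" if i: "i < n" for i u
  proof -
    have pow: "y ^ nat (e + int m) = y ^ m * y powi e" if "y \<noteq> 0" "0 \<le> e + int m" for y
        :: 'a and e m
      using that power_int_of_nat[of y "nat (e + int m)"] by (simp add: power_int_add mult.commute)
    define g where "g k s = z ^ nat (fst s + int (fst (sh i))) * w ^ nat (snd s
        + int (snd (sh i)))" for k :: nat and s
    have sub: "(\<Sum>j<n. (\<Sum>(k, s)\<leftarrow>xs. if k = j then g k s else 0) * u j)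
        = z ^ fst (sh i) * w ^ snd (sh i) * (\<Sum>(j, s)\<leftarrow>xs. z powi fst s * w powi snd s * u j)"
      if "set xs \<subseteq> set (nb i)" for xs
      using that
    proof (induction xs)
      case Nil
      then show ?case by simp
    next
      case (Cons x xs)
      obtain k s where x: "x = (k, s)" by (cases x)
      have k: "k < n" "0 \<le> fst s + int (fst (sh i))" "0 \<le> snd s + int (snd (sh i))"
        using nb[OF i, of k s] Cons.prems unfolding x by auto
      have "(\<Sum>j<n. (\<Sum>(k, s)\<leftarrow>x # xs. if k = j then g k s else 0) * u j)
          = (\<Sum>j<n. if k = j then g k s * u j else 0)
            + (\<Sum>j<n. (\<Sum>(k, s)\<leftarrow>xs. if k = j then g k s else 0) * u j)"
        unfolding sum.distrib[symmetric] by (intro sum.cong) (auto simp: x algebra_simps)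
      also have "(\<Sum>j<n. if k = j then g k s * u j else 0) = g k s * u k" using k by simp
      also have "g k s = z ^ fst (sh i) * w ^ snd (sh i) * (z powi fst s * w powi snd s)"
        unfolding g_def using zw k by (simp add: pow)
      finally show ?case using Cons by (simp add: x algebra_simps)
    qed
    have nth: "map f [0..<n] ! j = f j" if "j < n" for f :: "nat \<Rightarrow> 'b" and j
      using that by simp
    have M: "?M ! i ! j = (\<Sum>(k, s)\<leftarrow>nb i. if k = j then g k s else 0)
        - (if i = j then \<mu> * z ^ fst (sh i) * w ^ snd (sh i) else 0)" if "j < n" for j
      unfolding floquet_matrix_def nth[OF i] nth[OF that] g_def ..
    have "(\<Sum>j<n. ?M ! i ! j * u j) = (\<Sum>j<n. (\<Sum>(k, s)\<leftarrow>nb i. if k = j then g k s else 0) * u j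
        - (if i = j then \<mu> * z ^ fst (sh i) * w ^ snd (sh i) * u j else 0))"
      by (intro sum.cong) (auto simp: M left_diff_distrib)
    also have "\<dots> = z ^ fst (sh i) * w ^ snd (sh i) * (\<Sum>(j,
        s)\<leftarrow>nb i. z powi fst s * w powi snd s * u j)
        - \<mu> * z ^ fst (sh i) * w ^ snd (sh i) * u i"
      unfolding sum_subtractf sub[OF order_refl] using i by simp
    finally show ?thesis by (simp add: algebra_simps)
  qed
  have "length ?M = n" "\<And>r. r \<in> set ?M \<Longrightarrow> length r = n"
    by (auto simp: floquet_matrix_def)
  from ldet_eq_0_iff[OF this] show ?thesis
    using zw by (simp add: row cong: conj_cong)
qed

text \<open>For the block matrix with off-diagonal blocks \<open>B\<close> and \<open>C\<close>, the
  square acts on the first half as the product of \<open>B\<close> and \<open>C\<close>. The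
  delicate case is \<open>c = 0\<close>, where one half of an eigenvector may vanish.\<close>

lemma bipartite_kernel_iff:
  fixes B C :: "nat \<Rightarrow> nat \<Rightarrow> 'a :: field"
  shows "(\<exists>u v. (\<exists>i<n. u i \<noteq> 0 \<or> v i \<noteq> 0) \<and> (\<forall>i<n. (\<Sum>k<n. B i k * v k) = c * u i) \<and>
      (\<forall>k<n. (\<Sum>j<n. C k j * u j) = c * v k)) \<longleftrightarrow>
    (\<exists>u. (\<exists>i<n. u i \<noteq> 0) \<and> (\<forall>i<n. (\<Sum>k<n. B i k * (\<Sum>j<n. C k j * u j)) = c\<^sup>2 * u i))"
    (is "?L \<longleftrightarrow> ?R")
proof
  assume ?L
  then obtain u v where uv: "\<exists>i<n. u i \<noteq> 0 \<or> v i \<noteq> 0" "\<And>i. i < n \<Longrightarrow> (\<Sum>k<n. B i k * v k) = c * u i"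
    "\<And>k. k < n \<Longrightarrow> (\<Sum>j<n. C k j * u j) = c * v k" by blast
  show ?R
  proof (cases "\<exists>i<n. u i \<noteq> 0")
    case True
    have "(\<Sum>k<n. B i k * (\<Sum>j<n. C k j * u j)) = c\<^sup>2 * u i" if "i < n" for i
    proof -
      have "(\<Sum>k<n. B i k * (\<Sum>j<n. C k j * u j)) = (\<Sum>k<n. c * (B i k * v k))"
        using uv(3) by (intro sum.cong) auto
      also have "\<dots> = c\<^sup>2 * u i"
        unfolding sum_distrib_left[symmetric] uv(2)[OF that] by (simp add: power2_eq_square)
      finally show ?thesis .
    qed
    then show ?thesis using True by blast
  next
    case False
    then obtain i where i: "i < n" "v i \<noteq> 0" using uv(1) by auto
    have "c * v i = 0" using uv(3)[OF i(1)] False by simp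
    then have c: "c = 0" using i by simp
    \<comment> \<open>Here \<open>v\<close> lies in the kernel of \<open>B\<close> and need not be
      an image under \<open>C\<close>. As the blocks are square, the determinant of \<open>B\<close>
      and hence that of the product vanishes, which supplies another vector.\<close>
    let ?B = "Matrix.mat n n (\<lambda>(i, k). B i k)" and ?C = "Matrix.mat n n (\<lambda>(k, j). C k j)"
    have M: "?B \<in> carrier_mat n n" "?C \<in> carrier_mat n n" by simp_all
    have "?B *\<^sub>v Matrix.vec n v = 0\<^sub>v n"
      using uv(2) False c by (auto simp: vec_eq_iff scalar_prod_def atLeast0LessThan)
    moreover have "Matrix.vec n v \<noteq> 0\<^sub>v n" using i by (auto simp: vec_eq_iff)
    ultimately have "Determinant.det ?B = 0"
      using det_0_iff_vec_prod_zero_field[OF M(1)] vec_carrier by blast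
    then have "Determinant.det (?B * ?C) = 0" using det_mult[OF M] by simp
    then obtain x where x: "x \<in> carrier_vec n" "x \<noteq> 0\<^sub>v n" "(?B * ?C) *\<^sub>v x = 0\<^sub>v n"
      using det_0_iff_vec_prod_zero_field[OF mult_carrier_mat[OF M]] by blast
    have "?B *\<^sub>v (?C *\<^sub>v x) = 0\<^sub>v n" using x M by (simp add: assoc_mult_mat_vec[of _ n n _ n])
    then have "(\<Sum>k<n. B i k * (\<Sum>j<n. C k j * x $ j)) = 0" if "i < n" for i
      using that x(1) by (auto simp: vec_eq_iff scalar_prod_def atLeast0LessThan)
    moreover have "\<exists>i<n. x $ i \<noteq> 0" using x(1,2) by (auto simp: vec_eq_iff)
    ultimately show ?thesis using c by (intro exI[of _ "\<lambda>i. x $ i"]) simp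
  qed
next
  assume ?R
  then obtain u where u: "\<exists>i<n. u i \<noteq> 0"
    "\<And>i. i < n \<Longrightarrow> (\<Sum>k<n. B i k * (\<Sum>j<n. C k j * u j)) = c\<^sup>2 * u i" by blast
  define v where "v k = (\<Sum>j<n. C k j * u j)" for k
  have Bv: "(\<Sum>k<n. B i k * v k) = c * (c * u i)" if "i < n" for i
    unfolding v_def u(2)[OF that] by (simp add: power2_eq_square)
  \<comment> \<open>The eigenvectors are \<open>(c u, v)\<close>, \<open>(u, 0)\<close> and
    \<open>(0, v)\<close>, respectively.\<close>
  consider "c \<noteq> 0" | "c = 0" "\<forall>k<n. v k = 0" | "c = 0" "\<exists>k<n. v k \<noteq> 0" by blast
  then show ?L
  proof cases
    case 1
    show ?thesis
    proof (rule exI[of _ "\<lambda>i. c * u i"], rule exI[of _ v], intro conjI allI impI)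
      show "\<exists>i<n. c * u i \<noteq> 0 \<or> v i \<noteq> 0" using u(1) 1 by auto
      show "(\<Sum>k<n. B i k * v k) = c * (c * u i)" if "i < n" for i by (rule Bv[OF that])
      show "(\<Sum>j<n. C k j * (c * u j)) = c * v k" for k
        by (simp add: v_def sum_distrib_left algebra_simps)
    qed
  next
    case 2
    then show ?thesis using u(1) by - (rule exI[of _ u], rule exI[of _ "\<lambda>_. 0"], auto simp: v_def)
  next
    case 3
    then show ?thesis using Bv by - (rule exI[of _ "\<lambda>_. 0"], rule exI[of _ v], auto)
  qed
qed

text \<open>On a graph with edges between even and odd vertices only, eigenvectors can be computed from
  the square of the adjacency operator on the even vertices. This halves the size of the
  determinant for the tiling \<open>(4, 6, 12)\<close>.\<close>

definition two_step :: "(nat \<Rightarrow> (nat \<times> int \<times> int) list) \<Rightarrow> nat \<Rightarrow> (nat \<times> int \<times> int) list" where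
  "two_step nb i = concat (map (\<lambda>(j, s). map (\<lambda>(k, t). (k div 2, s + t)) (nb j)) (nb (2 * i)))"

lemma sum_list_as_sum:
  fixes g :: "'b \<Rightarrow> 'a :: comm_ring_1" and h :: "'b \<Rightarrow> nat"
  assumes "\<And>x. x \<in> set xs \<Longrightarrow> h x < n"
  shows "(\<Sum>k<n. (\<Sum>x\<leftarrow>xs. if h x = k then g x else 0) * v k) = (\<Sum>x\<leftarrow>xs. g x * v (h x))"
  using assms
proof (induction xs)
  case Nil
  then show ?case by simp
next
  case (Cons x xs)
  have "(\<Sum>k<n. (\<Sum>y\<leftarrow>x # xs. if h y = k then g y else 0) * v k)
      = (\<Sum>k<n. if h x = k then g x * v k else 0) + (\<Sum>k<n. (\<Sum>y\<leftarrow>xs. if h y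
          = k then g y else 0) * v k)"
    unfolding sum.distrib[symmetric] by (intro sum.cong) (auto simp: algebra_simps)
  also have "(\<Sum>k<n. if h x = k then g x * v k else 0) = g x * v (h x)"
    using Cons.prems[of x] by simp
  finally show ?case using Cons by simp
qed

lemma bipartite_floquet_iff:
  fixes z w :: "'a :: field"
  assumes zw: "z \<noteq> 0" "w \<noteq> 0"
    and nb: "\<And>i j s. i < 2 * n \<Longrightarrow> (j, s) \<in> set (nb i) \<Longrightarrow> j < 2 * n \<and> odd (i + j)"
  defines "m \<equiv> \<lambda>s :: int \<times> int. z powi fst s * w powi snd s"
  shows "(\<exists>u. (\<exists>i<2 * n. u i \<noteq> 0) \<and> (\<forall>i<2 * n. (\<Sum>(j, s)\<leftarrow>nb i. m s * u j) = c * u i)) \<longleftrightarrow>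
    (\<exists>u. (\<exists>i<n. u i \<noteq> 0) \<and> (\<forall>i<n. (\<Sum>(j, s)\<leftarrow>two_step nb i. m s * u j) = c\<^sup>2 * u i))"
proof -
  \<comment> \<open>Halves are renumbered by \<open>div 2\<close>: \<open>i\<close> stands for the
    even vertex \<open>2 * i\<close>, \<open>k\<close> for the odd vertex \<open>2 * k + 1\<close>.
    \<open>B\<close> maps odd to even, \<open>C\<close> even to odd.\<close>
  define B where "B i k = (\<Sum>x\<leftarrow>nb (2 * i). if fst x div 2 = k then m (snd x) else 0)" for i k
  define C where "C k i = (\<Sum>x\<leftarrow>nb (2 * k + 1). if fst x div 2 = i then m (snd x) else 0)" for k i
  have B: "(\<Sum>k<n. B i k * v k) = (\<Sum>x\<leftarrow>nb (2 * i). m (snd x) * v (fst x div 2))" if "i < n" for i v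
    unfolding B_def using nb[of "2 * i"] that by (intro sum_list_as_sum) fastforce
  have C: "(\<Sum>i<n. C k i * u i) = (\<Sum>x\<leftarrow>nb (2 * k
      + 1). m (snd x) * u (fst x div 2))" if "k < n" for k u
    unfolding C_def using nb[of "2 * k + 1"] that by (intro sum_list_as_sum) fastforce
  have m_add: "m (s + t) = m s * m t" for s t
    unfolding m_def using zw by (simp add: power_int_add)
  have BC: "(\<Sum>k<n. B i k * (\<Sum>j<n. C k j * u j)) = (\<Sum>(j, s)\<leftarrow>two_step nb i. m s * u j)"
    if i: "i < n" for i u
  proof -
    have "(\<Sum>k<n. B i k * (\<Sum>j<n. C k j * u j))
        = (\<Sum>x\<leftarrow>nb (2 * i). m (snd x) * (\<Sum>j<n. C (fst x div 2) j * u j))" by (rule B[OF i])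
    also have "\<dots> = (\<Sum>x\<leftarrow>nb (2 * i). \<Sum>y\<leftarrow>nb (fst x). m (snd x + snd y) * u (fst y div 2))"
    proof (intro arg_cong[of _ _ sum_list] map_cong refl)
      fix x assume x: "x \<in> set (nb (2 * i))"
      obtain j s where js: "x = (j, s)" by (cases x)
      have j: "j < 2 * n" "odd j" using nb[of "2 * i" j s] x i unfolding js by auto
      then have j2: "j div 2 < n" "2 * (j div 2) + 1 = j" by auto
      show "m (snd x) * (\<Sum>j<n. C (fst x div 2) j * u j)
          = (\<Sum>y\<leftarrow>nb (fst x). m (snd x + snd y) * u (fst y div 2))"
        unfolding js fst_conv snd_conv C[OF j2(1)] j2(2) m_add
        by (simp add: sum_list_const_mult mult.assoc)
    qed
    also have "\<dots> = (\<Sum>(j, s)\<leftarrow>two_step nb i. m s * u j)"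
    proof -
      have "(\<Sum>x\<leftarrow>xs. \<Sum>y\<leftarrow>nb (fst x). m (snd x + snd y) * u (fst y div 2))
        = (\<Sum>(j, s)\<leftarrow>concat (map (\<lambda>(j, s). map (\<lambda>(k, t). (k div 2, s
            + t)) (nb j)) xs). m s * u j)" for xs
        by (induction xs) (simp_all add: split_def o_def)
      then show ?thesis unfolding two_step_def .
    qed
    finally show ?thesis .
  qed
  have split: "(\<forall>i<2 * n. P i) \<longleftrightarrow> (\<forall>i<n. P (2 * i)) \<and> (\<forall>i<n. P (2 * i + 1))" for P :: "nat \<Rightarrow> bool"
  proof safe
    fix i assume A: "\<forall>i<n. P (2 * i)" "\<forall>i<n. P (2 * i + 1)" "i < 2 * n"
    then have "i div 2 < n" by auto
    then show "P i" using A by (cases "even i") (auto elim!: evenE oddE)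
  qed auto
  have half: "even j \<longleftrightarrow> odd i" "j < 2 * n" if "i < 2 * n" "(j, s) \<in> set (nb i)" for i j s
    using nb[OF that] by auto
  have eqs: "(\<Sum>(j, s)\<leftarrow>nb (2 * i). m s * f j) = (\<Sum>k<n. B i k * f (2 * k + 1))"
    "(\<Sum>(j, s)\<leftarrow>nb (2 * i + 1). m s * f j) = (\<Sum>k<n. C i k * f (2 * k))" if i: "i < n" for f i
  proof -
    have "2 * (fst x div 2) + 1 = fst x" if "x \<in> set (nb (2 * i))" for x
      using half[of "2 * i" "fst x" "snd x"] that i by auto
    then show "(\<Sum>(j, s)\<leftarrow>nb (2 * i). m s * f j) = (\<Sum>k<n. B i k * f (2 * k + 1))"
      unfolding B[OF i] split_def by (intro arg_cong[of _ _ sum_list] map_cong refl) simp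
    have "2 * (fst x div 2) = fst x" if "x \<in> set (nb (2 * i + 1))" for x
      using half[of "2 * i + 1" "fst x" "snd x"] that i by auto
    then show "(\<Sum>(j, s)\<leftarrow>nb (2 * i + 1). m s * f j) = (\<Sum>k<n. C i k * f (2 * k))"
      unfolding C[OF i] split_def by (intro arg_cong[of _ _ sum_list] map_cong refl) simp
  qed
  have "(\<exists>u. (\<exists>i<2 * n. u i \<noteq> 0) \<and> (\<forall>i<2 * n. (\<Sum>(j, s)\<leftarrow>nb i. m s * u j) = c * u i)) \<longleftrightarrow>
    (\<exists>u v. (\<exists>i<n. u i \<noteq> 0 \<or> v i \<noteq> 0) \<and> (\<forall>i<n. (\<Sum>k<n. B i k * v k) = c * u i) \<and>
      (\<forall>k<n. (\<Sum>j<n. C k j * u j) = c * v k))" (is "?L \<longleftrightarrow> ?R")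
  proof
    assume ?L
    then obtain f where f: "\<not> (\<forall>i<2 * n. f i = 0)" "\<forall>i<2 * n. (\<Sum>(j, s)\<leftarrow>nb i. m s * f j) = c * f i"
        by blast
    show ?R
      using f unfolding split
      by - (rule exI[of _ "\<lambda>i. f (2 * i)"], rule exI[of _ "\<lambda>i. f (2 * i + 1)"],
          auto simp: eqs simp del: One_nat_def)
  next
    assume ?R
    then obtain u v where uv: "\<exists>i<n. u i \<noteq> 0 \<or> v i \<noteq> 0" "\<forall>i<n. (\<Sum>k<n. B i k * v k) = c * u i"
      "\<forall>k<n. (\<Sum>j<n. C k j * u j) = c * v k" by blast
    define f where "f i = (if even i then u (i div 2) else v (i div 2))" for i
    have f: "f (2 * i) = u i" "f (2 * i + 1) = v i" for i by (simp_all add: f_def)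
    have "\<not> (\<forall>i<2 * n. f i = 0)" unfolding split f using uv(1) by blast
    moreover have "\<forall>i<2 * n. (\<Sum>(j, s)\<leftarrow>nb i. m s * f j) = c * f i"
      unfolding split f using uv(2,3) by (simp add: eqs f del: One_nat_def)
    ultimately show ?L by blast
  qed
  also have "\<dots> \<longleftrightarrow> (\<exists>u. (\<exists>i<n. u i \<noteq> 0) \<and> (\<forall>i<n. (\<Sum>(j, s)\<leftarrow>two_step nb i. m s * u j) = c\<^sup>2 * u i))"
    unfolding bipartite_kernel_iff by (simp add: BC cong: conj_cong)
  finally show ?thesis .
qed

section \<open>The five tilings\<close>

definition trH_nb :: "nat \<Rightarrow> (nat \<times> int \<times> int) list" where
  "trH_nb i =
   [[(1, 0, 0), (4, 1, 0), (5, 1, 0)],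
    [(0, 0, 0), (2, 0, 0), (4, 1, 0)],
    [(1, 0, 0), (3, 0, 0), (5, 0, 1)],
    [(2, 0, 0), (4, 0, 0), (5, 0, 1)],
    [(0, -1, 0), (1, -1, 0), (3, 0, 0)],
    [(0, -1, 0), (2, 0, -1), (3, 0, -1)]] ! i"

text \<open>The negated least exponents in each row of \<open>trH_nb\<close>. Their total
  \<open>(2, 1)\<close> is the origin of the prefactor \<open>z^2 * w\<close> in the determinant;
  the other tilings are treated alike.\<close>

definition trH_sh :: "nat \<Rightarrow> nat \<times> nat" where
  "trH_sh i = [(0, 0), (0, 0), (0, 0), (0, 0), (1, 0), (1, 1)] ! i"

text \<open>Below, \<open>ckl\<close> stands for \<open>cos (k \<theta>1 + l \<theta>2)\<close>; a negative index is preceded by \<open>m\<close>.\<close>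

lemma trH_ldet:
  fixes x z w c10 c01 c1m1 :: "'a :: field_char_0"
  assumes H: "2 * c10 * z = z^2 + 1"
      "2 * c01 * w = w^2 + 1"
      "2 * c1m1 * (z * w) = z^2 + w^2"
  shows "ldet (floquet_matrix 6 trH_nb trH_sh (3 * x) z w) =
    (z^2 * w) * (3 * x * (3 * x + 2) * (81 * x^4 - 54 * x^3 - 45 * x^2 + 18 * x - 2 * (1 + c10 + c01
        + c1m1) + 8))"
proof -
  \<comment> \<open>Each cosine is first grouped with the monomial from \<open>H\<close>. Unfolding
    \<open>H\<close> then removes the cosines, and a pure polynomial identity in \<open>x\<close>,
    \<open>z\<close>, \<open>w\<close> remains.\<close>
  have "(z^2 * w) * (3 * x * (3 * x + 2) * (81 * x^4 - 54 * x^3 - 45 * x^2 + 18 * x - 2 * (1 + c10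
      + c01 + c1m1) + 8)) =
    3 * x * (3 * x + 2) * ((81 * x^4 - 54 * x^3 - 45 * x^2 + 18 * x + 6) * (z^2 * w)
        - ((2 * c10 * z) * (z * w) + (2 * c01 * w) * (z^2) + (2 * c1m1 * (z * w)) * z))"
    by Groebner_Basis.algebra
  also have "\<dots> = ldet (floquet_matrix 6 trH_nb trH_sh (3 * x) z w)"
    unfolding H
    by (simp add: floquet_matrix_def trH_nb_def trH_sh_def upt_rec del: ldet.simps)
      (simp only: ldet_row ldet.simps(1) list.map del.simps, Groebner_Basis.algebra)
  finally show ?thesis ..
qed

definition SS_nb :: "nat \<Rightarrow> (nat \<times> int \<times> int) list" where
  "SS_nb i =
   [[(1, 0, 0), (1, 0, 1), (2, 1, 0), (3, 0, 0), (3, 1, 0)],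
    [(0, 0, -1), (0, 0, 0), (2, 0, 0), (2, 1, 0), (3, 0, -1)],
    [(0, -1, 0), (1, -1, 0), (1, 0, 0), (3, 0, -1), (3, 0, 0)],
    [(0, -1, 0), (0, 0, 0), (1, 0, 1), (2, 0, 0), (2, 0, 1)]] ! i"

definition SS_sh :: "nat \<Rightarrow> nat \<times> nat" where
  "SS_sh i = [(0, 0), (0, 1), (1, 1), (1, 0)] ! i"

text \<open>Mixed frequencies enter only through products of \<open>c10\<close> and
  \<open>c01\<close>, so two relations suffice.\<close>

lemma SS_ldet:
  fixes x z w c10 c01 :: "'a :: field_char_0"
  assumes H: "2 * c10 * z = z^2 + 1"
      "2 * c01 * w = w^2 + 1"
  shows "ldet (floquet_matrix 4 SS_nb SS_sh (5 * x) z w) =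
    (z^2 * w^2) * (625 * x^4 - 250 * x^2 - 40 * x + 1 - 100 * (c10 + c01) * x^2 - 40 * (c10 + c01
        + c10 * c01) * x - 4 * (c10 + c01 + 4 * c10 * c01 - c10^2 - c01^2))"
proof -
  have "(z^2 * w^2) * (625 * x^4 - 250 * x^2 - 40 * x + 1 - 100 * (c10 + c01) * x^2 - 40 * (c10
      + c01 + c10 * c01) * x - 4 * (c10 + c01 + 4 * c10 * c01 - c10^2 - c01^2)) =
    (625 * x^4 - 250 * x^2 - 40 * x + 1) * (z^2 * w^2) - (50 * x^2 + 20 * x
        + 2) * ((2 * c10 * z) * (z * w^2) + (2 * c01 * w) * (z^2 * w)) - (10 * x
        + 4) * ((2 * c10 * z) * (2 * c01 * w)) * (z * w) + (2 * c10 * z)^2 * w^2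
        + (2 * c01 * w)^2 * z^2"
    by Groebner_Basis.algebra
  also have "\<dots> = ldet (floquet_matrix 4 SS_nb SS_sh (5 * x) z w)"
    unfolding H
    by (simp add: floquet_matrix_def SS_nb_def SS_sh_def upt_rec del: ldet.simps)
      (simp only: ldet_row ldet.simps(1) list.map del.simps, Groebner_Basis.algebra)
  finally show ?thesis ..
qed

definition RTH_nb :: "nat \<Rightarrow> (nat \<times> int \<times> int) list" where
  "RTH_nb i =
   [[(1, 0, 0), (2, 1, 1), (4, 1, 0), (5, 0, 0)],
    [(0, 0, 0), (2, 0, 0), (3, 1, 0), (5, 0, -1)],
    [(0, -1, -1), (1, 0, 0), (3, 0, 0), (4, 0, -1)],
    [(1, -1, 0), (2, 0, 0), (4, 0, 0), (5, -1, -1)],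
    [(0, -1, 0), (2, 0, 1), (3, 0, 0), (5, 0, 0)],
    [(0, 0, 0), (1, 0, 1), (3, 1, 1), (4, 0, 0)]] ! i"

definition RTH_sh :: "nat \<Rightarrow> nat \<times> nat" where
  "RTH_sh i = [(0, 0), (0, 1), (1, 1), (1, 1), (1, 0), (0, 0)] ! i"

text \<open>The factor 2 comes from the leading coefficient \<open>4 ^ 6 = 2 * 2048\<close>.\<close>

lemma RTH_ldet:
  fixes x z w c10 c11 c01 c22 c20 c02 c21 c1m1 c12 :: "'a :: field_char_0"
  assumes H: "2 * c10 * z = z^2 + 1"
      "2 * c11 * (z * w) = (z * w)^2 + 1"
      "2 * c01 * w = w^2 + 1"
      "2 * c22 * (z^2 * w^2) = (z^2 * w^2)^2 + 1"
      "2 * c20 * (z^2) = (z^2)^2 + 1"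
      "2 * c02 * (w^2) = (w^2)^2 + 1"
      "2 * c21 * (z^2 * w) = (z^2 * w)^2 + 1"
      "2 * c1m1 * (z * w) = z^2 + w^2"
      "2 * c12 * (z * w^2) = (z * w^2)^2 + 1"
  shows "ldet (floquet_matrix 6 RTH_nb RTH_sh (4 * x) z w) =
    2 * (z^3 * w^3) * (2048 * x^6 - 1536 * x^4 - 128 * x^3 + 192 * x^2 - 3 - 2 * (64 * x^3
        + 32 * x^2 - 1) * (c10 + c11 + c01) + (c22 + c20 + c02) - 2 * (c21 + c1m1 + c12))"
proof -
  have "2 * (z^3 * w^3) * (2048 * x^6 - 1536 * x^4 - 128 * x^3 + 192 * x^2 - 3 - 2 * (64 * x^3
      + 32 * x^2 - 1) * (c10 + c11 + c01) + (c22 + c20 + c02) - 2 * (c21 + c1m1 + c12)) =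
    2 * (2048 * x^6 - 1536 * x^4 - 128 * x^3 + 192 * x^2 - 3) * (z^3 * w^3) - 2 * (64 * x^3
        + 32 * x^2 - 1) * ((2 * c10 * z) * (z^2 * w^3) + (2 * c11 * (z * w)) * (z^2 * w^2)
        + (2 * c01 * w) * (z^3 * w^2)) + ((2 * c22 * (z^2 * w^2)) * (z * w)
        + (2 * c20 * (z^2)) * (z * w^3) + (2 * c02 * (w^2)) * (z^3 * w))
        - 2 * ((2 * c21 * (z^2 * w)) * (z * w^2) + (2 * c1m1 * (z * w)) * (z^2 * w^2)
        + (2 * c12 * (z * w^2)) * (z^2 * w))"
    by Groebner_Basis.algebra
  also have "\<dots> = ldet (floquet_matrix 6 RTH_nb RTH_sh (4 * x) z w)"
    unfolding H
    by (simp add: floquet_matrix_def RTH_nb_def RTH_sh_def upt_rec del: ldet.simps)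
      (simp only: ldet_row ldet.simps(1) list.map del.simps, Groebner_Basis.algebra)
  finally show ?thesis ..
qed

definition STH_nb :: "nat \<Rightarrow> (nat \<times> int \<times> int) list" where
  "STH_nb i =
   [[(1, 0, 0), (2, 0, -1), (3, 0, -1), (4, 1, 0), (5, 0, 0)],
    [(0, 0, 0), (2, 0, 0), (3, 1, 0), (4, 1, 0), (5, 1, 1)],
    [(0, 0, 1), (1, 0, 0), (3, 0, 0), (4, 1, 1), (5, 1, 1)],
    [(0, 0, 1), (1, -1, 0), (2, 0, 0), (4, 0, 0), (5, 0, 1)],
    [(0, -1, 0), (1, -1, 0), (2, -1, -1), (3, 0, 0), (5, 0, 0)],
    [(0, 0, 0), (1, -1, -1), (2, -1, -1), (3, 0, -1), (4, 0, 0)]] ! i"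

definition STH_sh :: "nat \<Rightarrow> nat \<times> nat" where
  "STH_sh i = [(0, 1), (0, 0), (0, 0), (1, 0), (1, 1), (1, 1)] ! i"

lemma STH_ldet:
  fixes x z w c10 c01 c11 c20 c02 c22 c21 c12 cm11 :: "'a :: field_char_0"
  assumes H: "2 * c10 * z = z^2 + 1"
      "2 * c01 * w = w^2 + 1"
      "2 * c11 * (z * w) = (z * w)^2 + 1"
      "2 * c20 * (z^2) = (z^2)^2 + 1"
      "2 * c02 * (w^2) = (w^2)^2 + 1"
      "2 * c22 * (z^2 * w^2) = (z^2 * w^2)^2 + 1"
      "2 * c21 * (z^2 * w) = (z^2 * w)^2 + 1"
      "2 * c12 * (z * w^2) = (z * w^2)^2 + 1"
      "2 * cm11 * (w * z) = w^2 + z^2"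
  shows "ldet (floquet_matrix 6 STH_nb STH_sh (5 * x) z w) =
    (z^3 * w^3) * (15625 * x^6 - 9375 * x^4 - 2000 * x^3 + 675 * x^2 + 120 * x - 11 + 2 * (c20 + c02
        + c22) - 4 * (c21 + c12 + cm11) * (2 + 5 * x) - 4 * (c10 + c01 + c11) * (250 * x^3
        + 150 * x^2 + 15 * x - 2))"
proof -
  have "(z^3 * w^3) * (15625 * x^6 - 9375 * x^4 - 2000 * x^3 + 675 * x^2 + 120 * x - 11 + 2 * (c20
      + c02 + c22) - 4 * (c21 + c12 + cm11) * (2 + 5 * x) - 4 * (c10 + c01 + c11) * (250 * x^3
      + 150 * x^2 + 15 * x - 2)) =
    (15625 * x^6 - 9375 * x^4 - 2000 * x^3 + 675 * x^2 + 120 * x - 11) * (z^3 * w^3)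
        + ((2 * c20 * (z^2)) * (z * w^3) + (2 * c02 * (w^2)) * (z^3 * w)
        + (2 * c22 * (z^2 * w^2)) * (z * w)) - 2 * ((2 * c21 * (z^2 * w)) * (z * w^2)
        + (2 * c12 * (z * w^2)) * (z^2 * w) + (2 * cm11 * (w * z)) * (z^2 * w^2)) * (2 + 5 * x)
        - 2 * ((2 * c10 * z) * (z^2 * w^3) + (2 * c01 * w) * (z^3 * w^2)
        + (2 * c11 * (z * w)) * (z^2 * w^2)) * (250 * x^3 + 150 * x^2 + 15 * x - 2)"
    by Groebner_Basis.algebra
  also have "\<dots> = ldet (floquet_matrix 6 STH_nb STH_sh (5 * x) z w)"
    unfolding H
    by (simp add: floquet_matrix_def STH_nb_def STH_sh_def upt_rec del: ldet.simps)
      (simp only: ldet_row ldet.simps(1) list.map del.simps, Groebner_Basis.algebra)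
  finally show ?thesis ..
qed

text \<open>All faces of this tiling have an even number of sides. Numbering the vertices around a
  dodecagon makes the parity of the index a proper 2-colouring.\<close>

definition trTH_nb :: "nat \<Rightarrow> (nat \<times> int \<times> int) list" where
  "trTH_nb i =
   [[(1, 0, 0), (7, 1, 0), (11, 0, 0)],
    [(0, 0, 0), (2, 0, 0), (6, 1, 0)],
    [(1, 0, 0), (3, 0, 0), (9, 1, -1)],
    [(2, 0, 0), (4, 0, 0), (8, 1, -1)],
    [(3, 0, 0), (5, 0, 0), (11, 0, -1)],
    [(4, 0, 0), (6, 0, 0), (10, 0, -1)],
    [(1, -1, 0), (5, 0, 0), (7, 0, 0)],
    [(0, -1, 0), (6, 0, 0), (8, 0, 0)],
    [(3, -1, 1), (7, 0, 0), (9, 0, 0)],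
    [(2, -1, 1), (8, 0, 0), (10, 0, 0)],
    [(5, 0, 1), (9, 0, 0), (11, 0, 0)],
    [(0, 0, 0), (4, 0, 1), (10, 0, 0)]] ! i"

text \<open>Entry \<open>i\<close> belongs to the even vertex \<open>2 * i\<close> and to the
  exponents in \<open>two_step trTH_nb i\<close>.\<close>

definition trTH_sh :: "nat \<Rightarrow> nat \<times> nat" where
  "trTH_sh i = [(0, 0), (0, 1), (0, 1), (1, 1), (1, 0), (1, 0)] ! i"

lemma trTH_ldet:
  fixes x z w c10 c1m1 c01 c20 c02 c2m2 c2m1 c11 c1m2 :: "'a :: field_char_0"
  assumes H: "2 * c10 * z = z^2 + 1"
      "2 * c1m1 * (z * w) = z^2 + w^2"
      "2 * c01 * w = w^2 + 1"
      "2 * c20 * (z^2) = (z^2)^2 + 1"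
      "2 * c02 * (w^2) = (w^2)^2 + 1"
      "2 * c2m2 * (z^2 * w^2) = (z^2)^2 + (w^2)^2"
      "2 * c2m1 * (z^2 * w) = (z^2)^2 + w^2"
      "2 * c11 * (z * w) = (z * w)^2 + 1"
      "2 * c1m2 * (z * w^2) = z^2 + (w^2)^2"
  shows "ldet (floquet_matrix 6 (two_step trTH_nb) trTH_sh ((3 * x)\<^sup>2) z w) =
    (z^3 * w^3) * (531441 * x^12 - 1062882 * x^10 + 728271 * x^8 - 204120 * x^6 + 21627 * x^4
        - 918 * x^2 + 15 + 2 * (c20 + c02 + c2m2) + 4 * (c2m1 + c11 + c1m2) * (1 - 18 * x^2)
        + 4 * (c10 + c1m1 + c01) * (- 2187 * x^6 + 1215 * x^4 - 135 * x^2 + 4))"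
proof -
  have "(z^3 * w^3) * (531441 * x^12 - 1062882 * x^10 + 728271 * x^8 - 204120 * x^6 + 21627 * x^4
      - 918 * x^2 + 15 + 2 * (c20 + c02 + c2m2) + 4 * (c2m1 + c11 + c1m2) * (1 - 18 * x^2)
      + 4 * (c10 + c1m1 + c01) * (- 2187 * x^6 + 1215 * x^4 - 135 * x^2 + 4)) =
    (531441 * x^12 - 1062882 * x^10 + 728271 * x^8 - 204120 * x^6 + 21627 * x^4 - 918 * x^2
        + 15) * (z^3 * w^3) + ((2 * c20 * (z^2)) * (z * w^3) + (2 * c02 * (w^2)) * (z^3 * w)
        + (2 * c2m2 * (z^2 * w^2)) * (z * w)) + 2 * ((2 * c2m1 * (z^2 * w)) * (z * w^2)
        + (2 * c11 * (z * w)) * (z^2 * w^2) + (2 * c1m2 * (z * w^2)) * (z^2 * w)) * (1 - 18 * x^2)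
        + 2 * ((2 * c10 * z) * (z^2 * w^3) + (2 * c1m1 * (z * w)) * (z^2 * w^2)
        + (2 * c01 * w) * (z^3 * w^2)) * (- 2187 * x^6 + 1215 * x^4 - 135 * x^2 + 4)"
    by Groebner_Basis.algebra
  also have "\<dots> = ldet (floquet_matrix 6 (two_step trTH_nb) trTH_sh ((3 * x)\<^sup>2) z w)"
    unfolding H
    by (simp add: floquet_matrix_def trTH_nb_def trTH_sh_def two_step_def upt_rec del: ldet.simps)
      (simp only: ldet_row ldet.simps(1) list.map del.simps, Groebner_Basis.algebra)
  finally show ?thesis ..
qed

text \<open>A homogeneous form of \<open>2 cos t e^(it) = e^(2it) + 1\<close>. With \<open>p\<close>
  and \<open>r\<close> monomials in the multipliers it yields the hypotheses \<open>H\<close>, and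
  differences of angles are covered without inverses.\<close>

lemma two_cos_cis:
  assumes "cis t * r = p" "r \<noteq> 0"
  shows "2 * complex_of_real (cos t) * (p * r) = p\<^sup>2 + r\<^sup>2"
proof -
  have "2 * complex_of_real (cos t) * cis t = (cis t)\<^sup>2 + 1"
    using sin_cos_squared_add[of t] by (simp add: complex_eq_iff power2_eq_square algebra_simps)
  then have "2 * complex_of_real (cos t) * cis t * r\<^sup>2 = ((cis t)\<^sup>2 + 1) * r\<^sup>2" by simp
  then show ?thesis
    unfolding assms(1)[symmetric] by (simp add: power2_eq_square algebra_simps)
qed

lemma two_cos_cis_1: "cis t = p \<Longrightarrow> 2 * complex_of_real (cos t) * p = p\<^sup>2 + 1"
  using two_cos_cis[of t 1 p] by simp

text \<open>The determinant produces the sum of three cosines, whereas the relation for (3, 12, 12)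
  is stated with half-angles.\<close>

lemma eight_cos_half:
  fixes s t :: real
  shows "8 * cos (s / 2) * cos (t / 2) * cos ((s - t) / 2) = 2 * (1 + cos s + cos t + cos (s - t))"
proof -
  have double: "cos x = 2 * (cos (x / 2))\<^sup>2 - 1" for x :: real
    using cos_double_cos[of "x / 2"] by simp
  note double[of s] double[of t] double[of "s - t"]
  moreover have "cos ((s - t) / 2) = cos (s / 2) * cos (t / 2) + sin (s / 2) * sin (t / 2)"
    by (simp add: cos_diff diff_divide_distrib)
  moreover have "(sin (s / 2))\<^sup>2 = 1 - (cos (s / 2))\<^sup>2" "(sin (t / 2))\<^sup>2 = 1 - (cos (t / 2))\<^sup>2"
    by (simp_all add: sin_squared_eq)
  ultimately show ?thesis by Groebner_Basis.algebra
qed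

section \<open>Dispersion relations of the individual tilings\<close>

context even_potential
begin

text \<open>The bridge from analysis to the finite tables: once the certificate is checked and the
  graph is \<open>d\<close>-regular, only a matrix kernel remains.\<close>

lemma bloch_eigenvalue_iff:
  fixes ps :: "quad list" and \<theta>1 \<theta>2 :: real
  assumes ok: "tiling_data_ok R ps \<kappa>1 \<kappa>2 nb"
    and n: "length ps = n" and deg: "\<And>i. i < n \<Longrightarrow> length (nb i) = d"
  defines "V0 \<equiv> map (\<lambda>p. a *\<^sub>R emb p) ps" and "k1 \<equiv> a *\<^sub>R emb \<kappa>1" and "k2 \<equiv> a *\<^sub>R emb \<kappa>2"
  shows "bloch_eigenvalue a q (periodic_vertices V0 k1 k2) k1 k2 \<theta>1 \<theta>2 (\<rho>\<^sup>2) \<longleftrightarrow>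
    S_end q a \<rho> = 0 \<or> (\<exists>u. (\<exists>i<n. u i \<noteq> 0) \<and> (\<forall>i<n.
      (\<Sum>(j, s)\<leftarrow>nb i. cis \<theta>1 powi fst s * cis \<theta>2 powi snd s * u j) = of_nat d * S'_end q a \<rho> * u i))"
proof -
  note D = tiling_data_okD[OF ok a_pos, folded V0_def k1_def k2_def]
  have len: "length V0 = n" by (simp add: V0_def n)
  have "ps \<noteq> []" and many: "n < (\<Sum>i\<leftarrow>[0..<n]. length (filter (\<lambda>d. i < fst d) (nb i)))"
    using ok unfolding tiling_data_ok_def n by blast+
  interpret tiling q a V0 k1 k2 nb \<theta>1 \<theta>2
  proof
    show "V0 \<noteq> []" using \<open>ps \<noteq> []\<close> by (simp add: V0_def)
  qed (use D[unfolded n] len in simp_all)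
  have ph: "ph r = cis \<theta>1 powi fst r * cis \<theta>2 powi snd r" for r
    by (simp add: ph_def cis_power_int cis_mult)
  have kernel: "kernel (S'_end q a \<rho>) \<longleftrightarrow> (\<exists>u. (\<exists>i<n. u i \<noteq> 0) \<and> (\<forall>i<n.
      (\<Sum>(j, s)\<leftarrow>nb i. cis \<theta>1 powi fst s * cis \<theta>2 powi snd s * u j) = of_nat d * S'_end q a \<rho> * u i))"
    unfolding kernel_def len ph using deg by simp
  have card: "length V0 < card {(i, d). i < length V0 \<and> d \<in> set (nb i) \<and> i < fst d}"
    unfolding len using D(2)[unfolded n] many by (subst card_edges_conv) simp_all
  show ?thesis
    using kernel_imp_bloch_eigenvalue[of \<rho>] bloch_eigenvalue_imp_kernel[of \<rho>]
      S_end_zero_imp_bloch_eigenvalue[OF _ card, of \<rho>]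
    unfolding kernel by blast
qed

text \<open>\<open>R = 2\<close> exceeds the circumradius, about 1.93, of the unit dodecagon. For
  the tilings built around a square or a hexagon \<open>R = 1\<close> suffices, with equality at the
  hexagon.\<close>

lemma trH_data_ok: "tiling_data_ok 2 [(4, 2, 2, 0), (2, 2, 2, 2), (2, 0, 4, 2), (-2, 0, 4, 2), (-2,
    -2, 2, 2), (-4, -2, -2, 0)]
    (8, 4, 0, 0) (4, 2, 6, 4) trH_nb"
  by code_simp

text \<open>The factors \<open>S'\<close> and \<open>3 * S' + 2\<close> stem from the adjacency
  eigenvalues 0 and -2, which occur for every choice of the angles.\<close>

lemma trH_iff:
  fixes \<theta>1 \<theta>2 :: real and \<rho> :: complex
  defines "S' \<equiv> S'_end q a \<rho>" and "c \<equiv> \<lambda>x. complex_of_real (cos x)"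
  shows "bloch_eigenvalue a q (trH_V a) (trH_k1 a) (trH_k2 a) \<theta>1 \<theta>2 (\<rho>\<^sup>2) \<longleftrightarrow> S_end q a \<rho> = 0 \<or>
    3 * S' * (3 * S' + 2) * (81 * S'^4 - 54 * S'^3 - 45 * S'^2 + 18 * S'
        - 8 * c (\<theta>1/2) * c (\<theta>2/2) * c ((\<theta>1 - \<theta>2)/2) + 8) = 0"
proof -
  define z w where "z = cis \<theta>1" and "w = cis \<theta>2"
  have zw: "z \<noteq> 0" "w \<noteq> 0" by (simp_all add: z_def w_def)
  let ?ps = "[(4, 2, 2, 0), (2, 2, 2, 2), (2, 0, 4, 2), (-2, 0, 4, 2), (-2, -2, 2, 2), (-4, -2, -2,
      0)]"
  have k: "trH_k1 a = a *\<^sub>R emb (8, 4, 0, 0)" "trH_k2 a = a *\<^sub>R emb (4, 2, 6, 4)"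
    by (simp_all add: trH_k1_def trH_k2_def emb_def field_simps)
  have V: "trH_V a = periodic_vertices (map (\<lambda>p. a *\<^sub>R emb p) ?ps) (a *\<^sub>R emb (8, 4, 0,
      0)) (a *\<^sub>R emb (4, 2, 6, 4))"
    unfolding trH_V_def k by (rule arg_cong[of _ _ "\<lambda>V0. periodic_vertices V0 _ _"])
        (simp add: emb_def field_simps)
  have "\<forall>i\<in>set [0..<6]. length (trH_nb i) = 3" by code_simp
  then have deg: "length (trH_nb i) = 3" if "i < 6" for i
    using that by simp
  have "\<forall>i\<in>set [0..<6]. \<forall>(j, s)\<in>set (trH_nb i). j < 6 \<and>
      0 \<le> fst s + int (fst (trH_sh i)) \<and> 0 \<le> snd s + int (snd (trH_sh i))" by code_simp
  then have nb2: "j < 6 \<and> 0 \<le> fst s + int (fst (trH_sh i)) \<and> 0 \<le> snd s + int (snd (trH_sh i))"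
    if "i < 6" "(j, s) \<in> set (trH_nb i)" for i j s
    using that by fastforce
  have half: "8 * c (\<theta>1/2) * c (\<theta>2/2) * c ((\<theta>1 - \<theta>2)/2) = 2 * (1 + c \<theta>1 + c \<theta>2 + c (\<theta>1 - \<theta>2))"
    unfolding c_def using arg_cong[OF eight_cos_half[of \<theta>1 \<theta>2], of complex_of_real] by simp
  have "bloch_eigenvalue a q (trH_V a) (trH_k1 a) (trH_k2 a) \<theta>1 \<theta>2 (\<rho>\<^sup>2) \<longleftrightarrow> S_end q a \<rho> = 0 \<or>
    (\<exists>u. (\<exists>i<6. u i \<noteq> 0) \<and> (\<forall>i<6. (\<Sum>(j, s)\<leftarrow>trH_nb i. z powi fst s * w powi snd s * u j)
        = 3 * S' * u i))"
    (is "_ \<longleftrightarrow> _ \<or> ?ker")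
    unfolding V k S'_def z_def w_def using bloch_eigenvalue_iff[OF trH_data_ok _ deg, of 6 \<theta>1 \<theta>2 \<rho>]
        by simp
  also have "?ker \<longleftrightarrow> ldet (floquet_matrix 6 trH_nb trH_sh (3 * S') z w) = 0"
    by (rule floquet_matrix_iff[OF zw nb2])
  also have "ldet (floquet_matrix 6 trH_nb trH_sh (3 * S') z w)
      = (z^2 * w) * (3 * S' * (3 * S' + 2) * (81 * S'^4 - 54 * S'^3 - 45 * S'^2 + 18 * S' - 2 * (1
          + c \<theta>1 + c \<theta>2 + c (\<theta>1 - \<theta>2)) + 8))"
    unfolding c_def
    by (rule trH_ldet; (rule two_cos_cis_1 | rule two_cos_cis))
      (simp_all add: z_def w_def power2_eq_square cis_mult algebra_simps)
  also have "3 * S' * (3 * S' + 2) * (81 * S'^4 - 54 * S'^3 - 45 * S'^2 + 18 * S' - 2 * (1 + c \<theta>1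
      + c \<theta>2 + c (\<theta>1 - \<theta>2)) + 8) = 3 * S' * (3 * S' + 2) * (81 * S'^4 - 54 * S'^3 - 45 * S'^2
      + 18 * S' - 8 * c (\<theta>1/2) * c (\<theta>2/2) * c ((\<theta>1 - \<theta>2)/2) + 8)"
    unfolding half ..
  finally show ?thesis using zw by simp
qed

lemma SS_data_ok: "tiling_data_ok 1 [(1, 1, -1, 1), (1, -1, 1, 1), (-1, -1, 1, -1), (-1, 1, -1, -1)]
    (2, 2, 2, 2) (2, 2, -2, -2) SS_nb"
  by code_simp

lemma SS_iff:
  fixes \<theta>1 \<theta>2 :: real and \<rho> :: complex
  defines "S' \<equiv> S'_end q a \<rho>" and "c \<equiv> \<lambda>x. complex_of_real (cos x)"
  shows "bloch_eigenvalue a q (SS_V a) (SS_k1 a) (SS_k2 a) \<theta>1 \<theta>2 (\<rho>\<^sup>2) \<longleftrightarrow> S_end q a \<rho> = 0 \<or>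
    625 * S'^4 - 250 * S'^2 - 40 * S' + 1 - 100 * (c \<theta>1 + c \<theta>2) * S'^2 - 40 * (c \<theta>1 + c \<theta>2
        + c \<theta>1 * c \<theta>2) * S' - 4 * (c \<theta>1 + c \<theta>2 + 4 * c \<theta>1 * c \<theta>2 - c \<theta>1^2 - c \<theta>2^2) = 0"
proof -
  define z w where "z = cis \<theta>1" and "w = cis \<theta>2"
  have zw: "z \<noteq> 0" "w \<noteq> 0" by (simp_all add: z_def w_def)
  let ?ps = "[(1, 1, -1, 1), (1, -1, 1, 1), (-1, -1, 1, -1), (-1, 1, -1, -1)]"
  have k: "SS_k1 a = a *\<^sub>R emb (2, 2, 2, 2)" "SS_k2 a = a *\<^sub>R emb (2, 2, -2, -2)"
    by (simp_all add: SS_k1_def SS_k2_def emb_def field_simps)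
  have V: "SS_V a = periodic_vertices (map (\<lambda>p. a *\<^sub>R emb p) ?ps) (a *\<^sub>R emb (2, 2, 2,
      2)) (a *\<^sub>R emb (2, 2, -2, -2))"
    unfolding SS_V_def k by (rule arg_cong[of _ _ "\<lambda>V0. periodic_vertices V0 _ _"])
        (simp add: emb_def field_simps)
  have "\<forall>i\<in>set [0..<4]. length (SS_nb i) = 5" by code_simp
  then have deg: "length (SS_nb i) = 5" if "i < 4" for i
    using that by simp
  have "\<forall>i\<in>set [0..<4]. \<forall>(j, s)\<in>set (SS_nb i). j < 4 \<and>
      0 \<le> fst s + int (fst (SS_sh i)) \<and> 0 \<le> snd s + int (snd (SS_sh i))" by code_simp
  then have nb2: "j < 4 \<and> 0 \<le> fst s + int (fst (SS_sh i)) \<and> 0 \<le> snd s + int (snd (SS_sh i))"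
    if "i < 4" "(j, s) \<in> set (SS_nb i)" for i j s
    using that by fastforce
  have "bloch_eigenvalue a q (SS_V a) (SS_k1 a) (SS_k2 a) \<theta>1 \<theta>2 (\<rho>\<^sup>2) \<longleftrightarrow> S_end q a \<rho> = 0 \<or>
    (\<exists>u. (\<exists>i<4. u i \<noteq> 0) \<and> (\<forall>i<4. (\<Sum>(j, s)\<leftarrow>SS_nb i. z powi fst s * w powi snd s * u j)
        = 5 * S' * u i))"
    (is "_ \<longleftrightarrow> _ \<or> ?ker")
    unfolding V k S'_def z_def w_def using bloch_eigenvalue_iff[OF SS_data_ok _ deg, of 4 \<theta>1 \<theta>2 \<rho>]
        by simp
  also have "?ker \<longleftrightarrow> ldet (floquet_matrix 4 SS_nb SS_sh (5 * S') z w) = 0"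
    by (rule floquet_matrix_iff[OF zw nb2])
  also have "ldet (floquet_matrix 4 SS_nb SS_sh (5 * S') z w)
      = (z^2 * w^2) * (625 * S'^4 - 250 * S'^2 - 40 * S' + 1 - 100 * (c \<theta>1 + c \<theta>2) * S'^2
          - 40 * (c \<theta>1 + c \<theta>2 + c \<theta>1 * c \<theta>2) * S' - 4 * (c \<theta>1 + c \<theta>2 + 4 * c \<theta>1 * c \<theta>2 - c \<theta>1^2
          - c \<theta>2^2))"
    unfolding c_def
    by (rule SS_ldet; (rule two_cos_cis_1 | rule two_cos_cis))
      (simp_all add: z_def w_def power2_eq_square cis_mult algebra_simps)
  finally show ?thesis using zw by simp
qed

lemma RTH_data_ok: "tiling_data_ok 1 [(0, 2, 2, 0), (0, 0, 4, 0), (0, -2, 2, 0), (0, -2, -2, 0), (0,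
    0, -4, 0), (0, 2, -2, 0)]
    (2, 2, 6, 2) (2, 2, -6, -2) RTH_nb"
  by code_simp

lemma RTH_iff:
  fixes \<theta>1 \<theta>2 :: real and \<rho> :: complex
  defines "S' \<equiv> S'_end q a \<rho>" and "c \<equiv> \<lambda>x. complex_of_real (cos x)"
  shows "bloch_eigenvalue a q (RTH_V a) (RTH_k1 a) (RTH_k2 a) \<theta>1 \<theta>2 (\<rho>\<^sup>2) \<longleftrightarrow> S_end q a \<rho> = 0 \<or>
    2048 * S'^6 - 1536 * S'^4 - 128 * S'^3 + 192 * S'^2 - 3 - 2 * (64 * S'^3 + 32 * S'^2
        - 1) * (c \<theta>1 + c (\<theta>1 + \<theta>2) + c \<theta>2) + (c (2 * (\<theta>1 + \<theta>2)) + c (2 * \<theta>1) + c (2 * \<theta>2))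
        - 2 * (c (2 * \<theta>1 + \<theta>2) + c (\<theta>1 - \<theta>2) + c (\<theta>1 + 2 * \<theta>2)) = 0"
proof -
  define z w where "z = cis \<theta>1" and "w = cis \<theta>2"
  have zw: "z \<noteq> 0" "w \<noteq> 0" by (simp_all add: z_def w_def)
  let ?ps = "[(0, 2, 2, 0), (0, 0, 4, 0), (0, -2, 2, 0), (0, -2, -2, 0), (0, 0, -4, 0), (0, 2, -2,
      0)]"
  have k: "RTH_k1 a = a *\<^sub>R emb (2, 2, 6, 2)" "RTH_k2 a = a *\<^sub>R emb (2, 2, -6, -2)"
    by (simp_all add: RTH_k1_def RTH_k2_def emb_def field_simps)
  have V: "RTH_V a = periodic_vertices (map (\<lambda>p. a *\<^sub>R emb p) ?ps) (a *\<^sub>R emb (2, 2, 6,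
      2)) (a *\<^sub>R emb (2, 2, -6, -2))"
    unfolding RTH_V_def k by (rule arg_cong[of _ _ "\<lambda>V0. periodic_vertices V0 _ _"])
        (simp add: emb_def field_simps)
  have "\<forall>i\<in>set [0..<6]. length (RTH_nb i) = 4" by code_simp
  then have deg: "length (RTH_nb i) = 4" if "i < 6" for i
    using that by simp
  have "\<forall>i\<in>set [0..<6]. \<forall>(j, s)\<in>set (RTH_nb i). j < 6 \<and>
      0 \<le> fst s + int (fst (RTH_sh i)) \<and> 0 \<le> snd s + int (snd (RTH_sh i))" by code_simp
  then have nb2: "j < 6 \<and> 0 \<le> fst s + int (fst (RTH_sh i)) \<and> 0 \<le> snd s + int (snd (RTH_sh i))"
    if "i < 6" "(j, s) \<in> set (RTH_nb i)" for i j s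
    using that by fastforce
  have "bloch_eigenvalue a q (RTH_V a) (RTH_k1 a) (RTH_k2 a) \<theta>1 \<theta>2 (\<rho>\<^sup>2) \<longleftrightarrow> S_end q a \<rho> = 0 \<or>
    (\<exists>u. (\<exists>i<6. u i \<noteq> 0) \<and> (\<forall>i<6. (\<Sum>(j, s)\<leftarrow>RTH_nb i. z powi fst s * w powi snd s * u j)
        = 4 * S' * u i))"
    (is "_ \<longleftrightarrow> _ \<or> ?ker")
    unfolding V k S'_def z_def w_def using bloch_eigenvalue_iff[OF RTH_data_ok _ deg, of 6 \<theta>1 \<theta>2 \<rho>]
        by simp
  also have "?ker \<longleftrightarrow> ldet (floquet_matrix 6 RTH_nb RTH_sh (4 * S') z w) = 0"
    by (rule floquet_matrix_iff[OF zw nb2])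
  also have "ldet (floquet_matrix 6 RTH_nb RTH_sh (4 * S') z w)
      = 2 * (z^3 * w^3) * (2048 * S'^6 - 1536 * S'^4 - 128 * S'^3 + 192 * S'^2 - 3 - 2 * (64 * S'^3
          + 32 * S'^2 - 1) * (c \<theta>1 + c (\<theta>1 + \<theta>2) + c \<theta>2) + (c (2 * (\<theta>1 + \<theta>2)) + c (2 * \<theta>1)
          + c (2 * \<theta>2)) - 2 * (c (2 * \<theta>1 + \<theta>2) + c (\<theta>1 - \<theta>2) + c (\<theta>1 + 2 * \<theta>2)))"
    unfolding c_def
    by (rule RTH_ldet; (rule two_cos_cis_1 | rule two_cos_cis))
      (simp_all add: z_def w_def power2_eq_square cis_mult algebra_simps)
  finally show ?thesis using zw by simp
qed

lemma STH_data_ok: "tiling_data_ok 1 [(4, 0, 0, 0), (2, 0, 0, 2), (-2, 0, 0, 2), (-4, 0, 0, 0), (-2,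
    0, 0, -2), (2, 0, 0, -2)]
    (8, 0, 0, 4) (-10, 0, 0, 2) STH_nb"
  by code_simp

text \<open>The periods enclose 120 degrees, so the six shortest periods are \<open>k1\<close>,
  \<open>k2\<close>, \<open>k1 + k2\<close> and their negatives; hence
  \<open>\<theta>1 + \<theta>2\<close> accompanies \<open>\<theta>1\<close> and
  \<open>\<theta>2\<close>. The generator \<open>- STH_k2 a\<close> spans the same lattice but turns
  \<open>\<theta>2\<close> into \<open>- \<theta>2\<close>. For (3, 12, 12) and (4, 6, 12) the angle
  is 60 degrees and \<open>\<theta>1 - \<theta>2\<close> appears instead.\<close>

lemma STH_iff:
  fixes \<theta>1 \<theta>2 :: real and \<rho> :: complex
  defines "S' \<equiv> S'_end q a \<rho>" and "c \<equiv> \<lambda>x. complex_of_real (cos x)"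
  shows "bloch_eigenvalue a q (STH_V a) (STH_k1 a) (STH_k2 a) \<theta>1 \<theta>2 (\<rho>\<^sup>2) \<longleftrightarrow> S_end q a \<rho> = 0 \<or>
    15625 * S'^6 - 9375 * S'^4 - 2000 * S'^3 + 675 * S'^2 + 120 * S' - 11 + 2 * (c (2 * \<theta>1)
        + c (2 * \<theta>2) + c (2 * (\<theta>1 + \<theta>2))) - 4 * (c (2 * \<theta>1 + \<theta>2) + c (\<theta>1 + 2 * \<theta>2) + c (\<theta>2
        - \<theta>1)) * (2 + 5 * S') - 4 * (c \<theta>1 + c \<theta>2 + c (\<theta>1 + \<theta>2)) * (250 * S'^3 + 150 * S'^2 + 15 * S'
        - 2) = 0"
proof -
  define z w where "z = cis \<theta>1" and "w = cis \<theta>2"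
  have zw: "z \<noteq> 0" "w \<noteq> 0" by (simp_all add: z_def w_def)
  let ?ps = "[(4, 0, 0, 0), (2, 0, 0, 2), (-2, 0, 0, 2), (-4, 0, 0, 0), (-2, 0, 0, -2), (2, 0, 0,
      -2)]"
  have k: "STH_k1 a = a *\<^sub>R emb (8, 0, 0, 4)" "STH_k2 a = a *\<^sub>R emb (-10, 0, 0, 2)"
    by (simp_all add: STH_k1_def STH_k2_def emb_def field_simps)
  have V: "STH_V a = periodic_vertices (map (\<lambda>p. a *\<^sub>R emb p) ?ps) (a *\<^sub>R emb (8, 0, 0,
      4)) (a *\<^sub>R emb (-10, 0, 0, 2))"
    unfolding STH_V_def k by (rule arg_cong[of _ _ "\<lambda>V0. periodic_vertices V0 _ _"])
        (simp add: emb_def field_simps)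
  have "\<forall>i\<in>set [0..<6]. length (STH_nb i) = 5" by code_simp
  then have deg: "length (STH_nb i) = 5" if "i < 6" for i
    using that by simp
  have "\<forall>i\<in>set [0..<6]. \<forall>(j, s)\<in>set (STH_nb i). j < 6 \<and>
      0 \<le> fst s + int (fst (STH_sh i)) \<and> 0 \<le> snd s + int (snd (STH_sh i))" by code_simp
  then have nb2: "j < 6 \<and> 0 \<le> fst s + int (fst (STH_sh i)) \<and> 0 \<le> snd s + int (snd (STH_sh i))"
    if "i < 6" "(j, s) \<in> set (STH_nb i)" for i j s
    using that by fastforce
  have "bloch_eigenvalue a q (STH_V a) (STH_k1 a) (STH_k2 a) \<theta>1 \<theta>2 (\<rho>\<^sup>2) \<longleftrightarrow> S_end q a \<rho> = 0 \<or>
    (\<exists>u. (\<exists>i<6. u i \<noteq> 0) \<and> (\<forall>i<6. (\<Sum>(j, s)\<leftarrow>STH_nb i. z powi fst s * w powi snd s * u j)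
        = 5 * S' * u i))"
    (is "_ \<longleftrightarrow> _ \<or> ?ker")
    unfolding V k S'_def z_def w_def using bloch_eigenvalue_iff[OF STH_data_ok _ deg, of 6 \<theta>1 \<theta>2 \<rho>]
        by simp
  also have "?ker \<longleftrightarrow> ldet (floquet_matrix 6 STH_nb STH_sh (5 * S') z w) = 0"
    by (rule floquet_matrix_iff[OF zw nb2])
  also have "ldet (floquet_matrix 6 STH_nb STH_sh (5 * S') z w)
      = (z^3 * w^3) * (15625 * S'^6 - 9375 * S'^4 - 2000 * S'^3 + 675 * S'^2 + 120 * S' - 11
          + 2 * (c (2 * \<theta>1) + c (2 * \<theta>2) + c (2 * (\<theta>1 + \<theta>2))) - 4 * (c (2 * \<theta>1 + \<theta>2) + c (\<theta>1
          + 2 * \<theta>2) + c (\<theta>2 - \<theta>1)) * (2 + 5 * S') - 4 * (c \<theta>1 + c \<theta>2 + c (\<theta>1 + \<theta>2)) * (250 * S'^3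
          + 150 * S'^2 + 15 * S' - 2))"
    unfolding c_def
    by (rule STH_ldet; (rule two_cos_cis_1 | rule two_cos_cis))
      (simp_all add: z_def w_def power2_eq_square cis_mult algebra_simps)
  finally show ?thesis using zw by simp
qed

lemma trTH_data_ok: "tiling_data_ok 2 [(4, 2, 2, 0), (2, 2, 2, 2), (2, 0, 4, 2), (-2, 0, 4, 2), (-2,
    -2, 2, 2), (-4, -2, 2, 0), (-4, -2, -2, 0), (-2, -2, -2, -2), (-2, 0, -4, -2), (2, 0, -4, -2),
    (2, 2, -2, -2), (4, 2, -2, 0)]
    (6, 6, 6, 2) (6, 6, -6, -2) trTH_nb"
  by code_simp

lemma trTH_iff:
  fixes \<theta>1 \<theta>2 :: real and \<rho> :: complex
  defines "S' \<equiv> S'_end q a \<rho>" and "c \<equiv> \<lambda>x. complex_of_real (cos x)"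
  shows "bloch_eigenvalue a q (trTH_V a) (trTH_k1 a) (trTH_k2 a) \<theta>1 \<theta>2 (\<rho>\<^sup>2) \<longleftrightarrow> S_end q a \<rho> = 0 \<or>
    531441 * S'^12 - 1062882 * S'^10 + 728271 * S'^8 - 204120 * S'^6 + 21627 * S'^4 - 918 * S'^2
        + 15 + 2 * (c (2 * \<theta>1) + c (2 * \<theta>2) + c (2 * (\<theta>1 - \<theta>2))) + 4 * (c (2 * \<theta>1 - \<theta>2) + c (\<theta>1
        + \<theta>2) + c (\<theta>1 - 2 * \<theta>2)) * (1 - 18 * S'^2) + 4 * (c \<theta>1 + c (\<theta>1 - \<theta>2)
        + c \<theta>2) * (- 2187 * S'^6 + 1215 * S'^4 - 135 * S'^2 + 4) = 0"
proof -
  define z w where "z = cis \<theta>1" and "w = cis \<theta>2"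
  have zw: "z \<noteq> 0" "w \<noteq> 0" by (simp_all add: z_def w_def)
  let ?ps = "[(4, 2, 2, 0), (2, 2, 2, 2), (2, 0, 4, 2), (-2, 0, 4, 2), (-2, -2, 2, 2), (-4, -2, 2,
      0), (-4, -2, -2, 0), (-2, -2, -2, -2), (-2, 0, -4, -2), (2, 0, -4, -2), (2, 2, -2, -2), (4, 2,
      -2, 0)]"
  have k: "trTH_k1 a = a *\<^sub>R emb (6, 6, 6, 2)" "trTH_k2 a = a *\<^sub>R emb (6, 6, -6, -2)"
    by (simp_all add: trTH_k1_def trTH_k2_def emb_def field_simps)
  have V: "trTH_V a = periodic_vertices (map (\<lambda>p. a *\<^sub>R emb p) ?ps) (a *\<^sub>R emb (6, 6, 6,
      2)) (a *\<^sub>R emb (6, 6, -6, -2))"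
    unfolding trTH_V_def k by (rule arg_cong[of _ _ "\<lambda>V0. periodic_vertices V0 _ _"])
        (simp add: emb_def field_simps)
  have "\<forall>i\<in>set [0..<12]. length (trTH_nb i) = 3" by code_simp
  then have deg: "length (trTH_nb i) = 3" if "i < 12" for i
    using that by simp
  have "\<forall>i\<in>set [0..<12]. \<forall>(j, s)\<in>set (trTH_nb i). j < 12 \<and> odd (i + j)" by code_simp
  then have nb: "j < 12 \<and> odd (i + j)" if "i < 12" "(j, s) \<in> set (trTH_nb i)" for i j s
    using that by fastforce
  have "\<forall>i\<in>set [0..<6]. \<forall>(j, s)\<in>set ((two_step trTH_nb) i). j < 6 \<and>
      0 \<le> fst s + int (fst (trTH_sh i)) \<and> 0 \<le> snd s + int (snd (trTH_sh i))" by code_simp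
  then have nb2: "j < 6 \<and> 0 \<le> fst s + int (fst (trTH_sh i)) \<and> 0 \<le> snd s + int (snd (trTH_sh i))"
    if "i < 6" "(j, s) \<in> set ((two_step trTH_nb) i)" for i j s
    using that by fastforce
  have "bloch_eigenvalue a q (trTH_V a) (trTH_k1 a) (trTH_k2 a) \<theta>1 \<theta>2 (\<rho>\<^sup>2) \<longleftrightarrow> S_end q a \<rho> = 0 \<or>
    (\<exists>u. (\<exists>i<12. u i \<noteq> 0) \<and> (\<forall>i<12. (\<Sum>(j, s)\<leftarrow>trTH_nb i. z powi fst s * w powi snd s * u j)
        = 3 * S' * u i))"
    (is "_ \<longleftrightarrow> _ \<or> ?ker")
    unfolding V k S'_def z_def w_def using bloch_eigenvalue_iff[OF trTH_data_ok _ deg,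
        of 12 \<theta>1 \<theta>2 \<rho>] by simp
  also have "?ker \<longleftrightarrow> (\<exists>u. (\<exists>i<6. u i \<noteq> 0) \<and> (\<forall>i<6.
      (\<Sum>(j, s)\<leftarrow>two_step trTH_nb i. z powi fst s * w powi snd s * u j) = (3 * S')\<^sup>2 * u i))"
    using bipartite_floquet_iff[OF zw, of 6 trTH_nb "3 * S'"] nb by simp
  also have "(\<exists>u. (\<exists>i<6. u i \<noteq> 0) \<and> (\<forall>i<6.
      (\<Sum>(j, s)\<leftarrow>two_step trTH_nb i. z powi fst s * w powi snd s * u j) = (3 * S')\<^sup>2 * u i))
          \<longleftrightarrow> ldet (floquet_matrix 6 (two_step trTH_nb) trTH_sh ((3 * S')\<^sup>2) z w) = 0"
    by (rule floquet_matrix_iff[OF zw nb2])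
  also have "ldet (floquet_matrix 6 (two_step trTH_nb) trTH_sh ((3 * S')\<^sup>2) z w)
      = (z^3 * w^3) * (531441 * S'^12 - 1062882 * S'^10 + 728271 * S'^8 - 204120 * S'^6
          + 21627 * S'^4 - 918 * S'^2 + 15 + 2 * (c (2 * \<theta>1) + c (2 * \<theta>2) + c (2 * (\<theta>1 - \<theta>2)))
          + 4 * (c (2 * \<theta>1 - \<theta>2) + c (\<theta>1 + \<theta>2) + c (\<theta>1 - 2 * \<theta>2)) * (1 - 18 * S'^2) + 4 * (c \<theta>1
          + c (\<theta>1 - \<theta>2) + c \<theta>2) * (- 2187 * S'^6 + 1215 * S'^4 - 135 * S'^2 + 4))"
    unfolding c_def
    by (rule trTH_ldet; (rule two_cos_cis_1 | rule two_cos_cis))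
      (simp_all add: z_def w_def power2_eq_square cis_mult algebra_simps)
  finally show ?thesis using zw by simp
qed

end

theorem theorem1p2:
  fixes a :: real and q :: "real \<Rightarrow> real"
  assumes a_pos: "a > 0"
    and q_meas: "q \<in> borel_measurable (lebesgue_on {0..a})"
    and q_L2: "(\<lambda>x. (q x)\<^sup>2) integrable_on {0..a}"
    and q_even: "\<forall>x\<in>{0..a}. q x = q (a - x)"
  shows
   "(\<forall>\<theta>1\<in>{-pi..pi}. \<forall>\<theta>2\<in>{-pi..pi}. \<forall>\<rho>::complex.
      bloch_eigenvalue a q (trH_V a) (trH_k1 a) (trH_k2 a) \<theta>1 \<theta>2 (\<rho>\<^sup>2) \<longleftrightarrow>
      (let S = S_end q a \<rho>; S' = S'_end q a \<rho>; c = (\<lambda>x. complex_of_real (cos x)) in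
        3 * S^3 * S' * (3 * S' + 2) *
        (81 * S'^4 - 54 * S'^3 - 45 * S'^2 + 18 * S'
         - 8 * c (\<theta>1/2) * c (\<theta>2/2) * c ((\<theta>1 - \<theta>2)/2) + 8) = 0))
  \<and>
   (\<forall>\<theta>1\<in>{-pi..pi}. \<forall>\<theta>2\<in>{-pi..pi}. \<forall>\<rho>::complex.
      bloch_eigenvalue a q (SS_V a) (SS_k1 a) (SS_k2 a) \<theta>1 \<theta>2 (\<rho>\<^sup>2) \<longleftrightarrow>
      (let S = S_end q a \<rho>; S' = S'_end q a \<rho>;
           c = complex_of_real (cos \<theta>1); d = complex_of_real (cos \<theta>2) in
        S^6 * (625 * S'^4 - 250 * S'^2 - 40 * S' + 1 - 100 * (c + d) * S'^2
               - 40 * (c + d + c * d) * S' - 4 * (c + d + 4 * c * d - c^2 - d^2)) = 0))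
  \<and>
   (\<forall>\<theta>1\<in>{-pi..pi}. \<forall>\<theta>2\<in>{-pi..pi}. \<forall>\<rho>::complex.
      bloch_eigenvalue a q (RTH_V a) (RTH_k1 a) (RTH_k2 a) \<theta>1 \<theta>2 (\<rho>\<^sup>2) \<longleftrightarrow>
      (let S = S_end q a \<rho>; S' = S'_end q a \<rho>; c = (\<lambda>x. complex_of_real (cos x)) in
        S^6 * (2048 * S'^6 - 1536 * S'^4 - 128 * S'^3 + 192 * S'^2 - 3
          - 2 * (64 * S'^3 + 32 * S'^2 - 1) * (c \<theta>1 + c (\<theta>1 + \<theta>2) + c \<theta>2)
          + (c (2 * (\<theta>1 + \<theta>2)) + c (2 * \<theta>1) + c (2 * \<theta>2))
          - 2 * (c (2 * \<theta>1 + \<theta>2) + c (\<theta>1 - \<theta>2) + c (\<theta>1 + 2 * \<theta>2))) = 0))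
  \<and>
   (\<forall>\<theta>1\<in>{-pi..pi}. \<forall>\<theta>2\<in>{-pi..pi}. \<forall>\<rho>::complex.
      bloch_eigenvalue a q (STH_V a) (STH_k1 a) (STH_k2 a) \<theta>1 \<theta>2 (\<rho>\<^sup>2) \<longleftrightarrow>
      (let S = S_end q a \<rho>; S' = S'_end q a \<rho>; c = (\<lambda>x. complex_of_real (cos x)) in
        S^9 * (15625 * S'^6 - 9375 * S'^4 - 2000 * S'^3 + 675 * S'^2 + 120 * S' - 11
          + 2 * (c (2 * \<theta>1) + c (2 * \<theta>2) + c (2 * (\<theta>1 + \<theta>2)))
          - 4 * (c (2 * \<theta>1 + \<theta>2) + c (\<theta>1 + 2 * \<theta>2) + c (\<theta>2 - \<theta>1)) * (2 + 5 * S')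
          - 4 * (c \<theta>1 + c \<theta>2 + c (\<theta>1 + \<theta>2)) * (250 * S'^3 + 150 * S'^2 + 15 * S' - 2)) = 0))
  \<and>
   (\<forall>\<theta>1\<in>{-pi..pi}. \<forall>\<theta>2\<in>{-pi..pi}. \<forall>\<rho>::complex.
      bloch_eigenvalue a q (trTH_V a) (trTH_k1 a) (trTH_k2 a) \<theta>1 \<theta>2 (\<rho>\<^sup>2) \<longleftrightarrow>
      (let S = S_end q a \<rho>; S' = S'_end q a \<rho>; c = (\<lambda>x. complex_of_real (cos x)) in
        S^6 * (531441 * S'^12 - 1062882 * S'^10 + 728271 * S'^8 - 204120 * S'^6
          + 21627 * S'^4 - 918 * S'^2 + 15
          + 2 * (c (2 * \<theta>1) + c (2 * \<theta>2) + c (2 * (\<theta>1 - \<theta>2)))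
          + 4 * (c (2 * \<theta>1 - \<theta>2) + c (\<theta>1 + \<theta>2) + c (\<theta>1 - 2 * \<theta>2)) * (1 - 18 * S'^2)
          + 4 * (c \<theta>1 + c (\<theta>1 - \<theta>2) + c \<theta>2)
              * (- 2187 * S'^6 + 1215 * S'^4 - 135 * S'^2 + 4)) = 0))"
proof -
  interpret even_potential q a
    using assms by unfold_locales
  \<comment> \<open>A product vanishes exactly if a factor does, and a positive power of
    \<open>S\<close> exactly if \<open>S\<close> does; this splits each relation into the two
    alternatives of the lemmas above.\<close>
  show ?thesis
    by (intro conjI ballI allI) (simp_all only: Let_def trH_iff SS_iff RTH_iff STH_iff trTH_iff
        mult_eq_0_iff power_eq_0_iff numeral_neq_zero zero_less_numeral simp_thms disj_assoc)
qed

end
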